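(* Let $K$ be a field of prime characteristic $p$ and let $n\geq 2$ be an integer. In the representation ring of $K\mathfrak{S}_n$, we have \[ [\operatorname{Sym}^r S^{(n-1,1)}] = [\operatorname{Sym}^r M^{(n-1,1)}] - [\operatorname{Sym}^{r-1} M^{(n-1,1)}] \] for $2\leq r\leq p-1$. If moreover $p\mid n$, then \[ [\operatorname{Sym}^r D^{(n-1,1)}] = [\operatorname{Sym}^r M^{(n-1,1)}] + [\operatorname{Sym}^{r-2} M^{(n-1,1)}] - 2[\operatorname{Sym}^{r-1} M^{(n-1,1)}] \] for $3\leq r\leq p-1$.
   Context: $\mathfrak{S}_n$ is the symmetric group. The representation ring of $K\mathfrak{S}_n$ is the (Green) ring generated by isomorphism classes $[V]$ of finite-dimensional $K\mathfrak{S}_n$-modules subject to $[U\oplus V]=[U]+[V]$ (and $[U\otimes V]=[U][V]$); it is a free abelian group on the classes of indecomposable modules, so equalities in it amount to isomorphisms of direct sums of modules. $M^{(n-1,1)}$ is the natural $n$-dimensional permutation $K\mathfrak{S}_n$-module with permutation basis $x_1,\dots,x_n$. The Specht module $S^{(n-1,1)}$ is the kernel of the map $M^{(n-1,1)}\to K$, $x_i\mapsto 1$, to the trivial module. For $n\ge 3$ with $p\mid n$, $D^{(n-1,1)}$ is the simple head of $S^{(n-1,1)}$; it is the quotient of $S^{(n-1,1)}$ by the trivial submodule spanned by $\sum_{i=1}^n x_i$. $\operatorname{Sym}^r$ denotes the $r$th symmetric power over $K$, with its natural $\mathfrak{S}_n$-action. *)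

theory Defs
  imports
    "HOL-Library.Poly_Mapping"
    "HOL-Computational_Algebra.Primes"
    "HOL-Algebra.QuotRing"
    "HOL-Algebra.Generated_Groups"
    "HOL-Algebra.Sym_Groups"
    "Jordan_Normal_Form.VS_Connect"
begin

section \<open>Modules over a group algebra\<close>

text \<open>
  The ground field is a type \<open>'k\<close> of class \<open>field\<close>, used as the ring record \<open>class_ring\<close>.
  A \<open>KG\<close>-module is a vector space with a linear \<open>G\<close>-action. As for the library's module records,
  the ring fields \<open>mult\<close> and \<open>one\<close> carry no meaning.
\<close>

record ('g, 'k, 'v) rep = "('k, 'v) module" +
  act :: "'g \<Rightarrow> 'v \<Rightarrow> 'v"

locale fd_rep = group G + vectorspace "class_ring :: 'k::field ring" V
  for G :: "('g, 'm) monoid_scheme" and V :: "('g, 'k::field, 'v) rep" +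
  assumes fin_dim: "fin_dim"
    and act_linear: "g \<in> carrier G \<Longrightarrow> act V g \<in> LinearCombinations.module_hom class_ring V V"
    and act_one: "v \<in> carrier V \<Longrightarrow> act V \<one>\<^bsub>G\<^esub> v = v"
    and act_mult: "g \<in> carrier G \<Longrightarrow> h \<in> carrier G \<Longrightarrow> v \<in> carrier V \<Longrightarrow>
      act V (g \<otimes>\<^bsub>G\<^esub> h) v = act V g (act V h v)"

definition rep_iso :: "('g, 'm) monoid_scheme \<Rightarrow> ('g, 'k::field, 'v) rep \<Rightarrow> ('g, 'k, 'w) rep \<Rightarrow> bool"
  where "rep_iso G V W \<longleftrightarrow>
    (\<exists>f \<in> LinearCombinations.module_hom class_ring V W. bij_betw f (carrier V) (carrier W) \<and>
      (\<forall>g\<in>carrier G. \<forall>v\<in>carrier V. f (act V g v) = act W g (f v)))"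

definition dsum_rep :: "('g, 'k::field, 'v) rep \<Rightarrow> ('g, 'k, 'w) rep \<Rightarrow> ('g, 'k, 'v \<times> 'w) rep"
  where "dsum_rep V W =
    module.extend (direct_sum V W) (rep.fields (\<lambda>g. map_prod (act V g) (act W g)))"

text \<open>
  The quotient of \<open>V\<close> by a \<open>G\<close>-stable subspace \<open>U\<close>, on the set of cosets \<open>U +> v\<close>; the operations
  are those on representatives, in the style of \<^const>\<open>FactRing\<close>.
\<close>

definition quot_rep :: "('g, 'k::field, 'v) rep \<Rightarrow> 'v set \<Rightarrow> ('g, 'k, 'v set) rep"
  where "quot_rep V U =
    \<lparr>carrier = a_rcosets\<^bsub>V\<^esub> U, monoid.mult = (\<lambda>_ _. U), one = U, zero = U, add = set_add V,
     smult = (\<lambda>c A. \<Union>a\<in>A. U +>\<^bsub>V\<^esub> (c \<odot>\<^bsub>V\<^esub> a)),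
     act = (\<lambda>g A. \<Union>a\<in>A. U +>\<^bsub>V\<^esub> act V g a)\<rparr>"

text \<open>
  The vector space with basis \<open>S\<close>, on which \<open>G\<close> acts by linearly extending an action \<open>\<phi>\<close> on \<open>S\<close>.
  The basis element belonging to \<open>s \<in> S\<close> is \<open>Poly_Mapping.single s 1\<close>.
\<close>

definition free_rep :: "'s set \<Rightarrow> ('g \<Rightarrow> 's \<Rightarrow> 's) \<Rightarrow> ('g, 'k::field, 's \<Rightarrow>\<^sub>0 'k) rep"
  where "free_rep S \<phi> =
    \<lparr>carrier = {f. Poly_Mapping.keys f \<subseteq> S}, monoid.mult = (\<lambda>_ _. 0), one = 0, zero = 0, add = (+),
     smult = (\<lambda>c. Poly_Mapping.map ((*) c)),
     act = (\<lambda>g f. \<Sum>s\<in>Poly_Mapping.keys f.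
       Poly_Mapping.single (\<phi> g s) (Poly_Mapping.lookup f s))\<rparr>"

definition triv_rep :: "('g, 'k::field, unit \<Rightarrow>\<^sub>0 'k) rep"
  where "triv_rep = free_rep {()} (\<lambda>_ x. x)"

definition span_in :: "('g, 'k::field, 'v) rep \<Rightarrow> 'v set \<Rightarrow> 'v set"
  where "span_in V = LinearCombinations.module.span class_ring V"


section \<open>Tensor products and symmetric powers\<close>

text \<open>Both are given by generators (pairs, resp. lists of length \<open>r\<close>, of vectors) and relations.\<close>

definition tensor_rep ::
  "('g, 'k::field, 'v) rep \<Rightarrow> ('g, 'k, 'w) rep \<Rightarrow> ('g, 'k, ('v \<times> 'w \<Rightarrow>\<^sub>0 'k) set) rep"
  where "tensor_rep V W =
    (let F = free_rep (carrier V \<times> carrier W) (\<lambda>g. map_prod (act V g) (act W g));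
         e = (\<lambda>v w. Poly_Mapping.single (v, w) (1 :: 'k))
     in quot_rep F (span_in F
       ({e (v \<oplus>\<^bsub>V\<^esub> v') w - e v w - e v' w | v v' w.
           v \<in> carrier V \<and> v' \<in> carrier V \<and> w \<in> carrier W} \<union>
        {e v (w \<oplus>\<^bsub>W\<^esub> w') - e v w - e v w' | v w w'.
           v \<in> carrier V \<and> w \<in> carrier W \<and> w' \<in> carrier W} \<union>
        {e (c \<odot>\<^bsub>V\<^esub> v) w - c \<odot>\<^bsub>F\<^esub> e v w | c v w. v \<in> carrier V \<and> w \<in> carrier W} \<union>
        {e v (c \<odot>\<^bsub>W\<^esub> w) - c \<odot>\<^bsub>F\<^esub> e v w | c v w. v \<in> carrier V \<and> w \<in> carrier W})))"

definition Sym :: "nat \<Rightarrow> ('g, 'k::field, 'v) rep \<Rightarrow> ('g, 'k, ('v list \<Rightarrow>\<^sub>0 'k) set) rep"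
  where "Sym r V =
    (let L = {xs. set xs \<subseteq> carrier V \<and> length xs = r};
         F = free_rep L (\<lambda>g. map (act V g));
         e = (\<lambda>xs. Poly_Mapping.single xs (1 :: 'k))
     in quot_rep F (span_in F
       ({e (xs @ (u \<oplus>\<^bsub>V\<^esub> v) # ys) - e (xs @ u # ys) - e (xs @ v # ys) | xs u v ys.
           u \<in> carrier V \<and> v \<in> carrier V \<and> xs @ u # ys \<in> L} \<union>
        {e (xs @ (c \<odot>\<^bsub>V\<^esub> u) # ys) - c \<odot>\<^bsub>F\<^esub> e (xs @ u # ys) | xs c u ys.
           xs @ u # ys \<in> L} \<union>
        {e xs - e ys | xs ys. xs \<in> L \<and> ys \<in> L \<and> mset xs = mset ys})))"


section \<open>The representation ring\<close>

text \<open>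
  Every finite-dimensional module is isomorphic to one whose carrier is a set of finitely supported
  functions \<open>nat \<Rightarrow>\<^sub>0 'k\<close>. The isomorphism class of \<open>V\<close> is represented by the set of its
  isomorphic copies of this kind, so that classes of modules over different carrier types
  become comparable.
\<close>

type_synonym ('g, 'k) iso_class = "('g, 'k, nat \<Rightarrow>\<^sub>0 'k) rep set"

definition iso_class :: "('g, 'm) monoid_scheme \<Rightarrow> ('g, 'k::field, 'v) rep \<Rightarrow> ('g, 'k) iso_class"
  where "iso_class G V = {W. fd_rep G W \<and> rep_iso G V W}"

definition iso_classes :: "('g, 'm) monoid_scheme \<Rightarrow> ('g, 'k::field) iso_class set"
  where "iso_classes G = {iso_class G V | V :: ('g, 'k, nat \<Rightarrow>\<^sub>0 'k) rep. fd_rep G V}"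

definition class_tensor ::
  "('g, 'm) monoid_scheme \<Rightarrow> ('g, 'k::field) iso_class \<Rightarrow> ('g, 'k) iso_class \<Rightarrow> ('g, 'k) iso_class"
  where "class_tensor G X Y = iso_class G (tensor_rep (SOME V. V \<in> X) (SOME W. W \<in> Y))"

text \<open>The free abelian group on the isomorphism classes, with multiplication extending \<open>\<otimes>\<close>.\<close>

definition class_ring_free ::
  "'k::field itself \<Rightarrow> ('g, 'm) monoid_scheme \<Rightarrow> (('g, 'k) iso_class \<Rightarrow>\<^sub>0 int) ring"
  where "class_ring_free K G =
    \<lparr>carrier = {c. Poly_Mapping.keys c \<subseteq> iso_classes G},
     monoid.mult = (\<lambda>a b. frag_extend (\<lambda>X. frag_extend (\<lambda>Y. frag_of (class_tensor G X Y)) b) a),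
     one = frag_of (iso_class G triv_rep),
     zero = 0, add = (+)\<rparr>"

text \<open>
  The additive subgroup generated by all \<open>[U \<oplus> V] - [U] - [V]\<close>. It is an ideal, because tensoring
  commutes with direct sums up to isomorphism.
\<close>

definition sum_relations ::
  "'k::field itself \<Rightarrow> ('g, 'm) monoid_scheme \<Rightarrow> (('g, 'k) iso_class \<Rightarrow>\<^sub>0 int) set"
  where "sum_relations K G =
    generate (add_monoid (class_ring_free K G))
      {frag_of (iso_class G (dsum_rep U V)) - frag_of (iso_class G U) - frag_of (iso_class G V) |
        (U :: ('g, 'k, nat \<Rightarrow>\<^sub>0 'k) rep) (V :: ('g, 'k, nat \<Rightarrow>\<^sub>0 'k) rep).
        fd_rep G U \<and> fd_rep G V}"

definition green_ring ::
  "'k::field itself \<Rightarrow> ('g, 'm) monoid_scheme \<Rightarrow> (('g, 'k) iso_class \<Rightarrow>\<^sub>0 int) set ring"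
  where "green_ring K G = class_ring_free K G Quot sum_relations K G"

definition green_class ::
  "('g, 'm) monoid_scheme \<Rightarrow> ('g, 'k::field, 'v) rep \<Rightarrow> (('g, 'k) iso_class \<Rightarrow>\<^sub>0 int) set"
  where "green_class G V =
    sum_relations TYPE('k) G +>\<^bsub>class_ring_free TYPE('k) G\<^esub> frag_of (iso_class G V)"


section \<open>The modules attached to the partition \<open>(n-1,1)\<close>\<close>

definition perm_module :: "'k::field itself \<Rightarrow> nat \<Rightarrow> (nat \<Rightarrow> nat, 'k, nat \<Rightarrow>\<^sub>0 'k) rep"
  where "perm_module K n = free_rep {1..n} (\<lambda>\<sigma> i. \<sigma> i)"

text \<open>
  Writing \<open>x\<^sub>i\<close> for \<open>Poly_Mapping.single i 1\<close>, this is the kernel of the linear map \<open>x\<^sub>i \<mapsto> 1\<close>.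
\<close>

definition specht_module :: "'k::field itself \<Rightarrow> nat \<Rightarrow> (nat \<Rightarrow> nat, 'k, nat \<Rightarrow>\<^sub>0 'k) rep"
  where "specht_module K n =
    (perm_module K n)
      \<lparr>carrier := {f \<in> carrier (perm_module K n). (\<Sum>i=1..n. Poly_Mapping.lookup f i) = 0}\<rparr>"

text \<open>
  If the characteristic divides \<open>n\<close>, then \<open>x\<^sub>1 + \<dots> + x\<^sub>n\<close> lies in the Specht module, and
  for \<open>n \<ge> 3\<close> the following quotient is its simple head \<open>D\<close>. Other cases are not meaningful.
\<close>

definition D_module :: "'k::field itself \<Rightarrow> nat \<Rightarrow> (nat \<Rightarrow> nat, 'k, (nat \<Rightarrow>\<^sub>0 'k) set) rep"
  where "D_module K n =
    quot_rep (specht_module K n)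
      (span_in (specht_module K n) {\<Sum>i=1..n. Poly_Mapping.single i 1})"

end

theory Submission
  imports Defs
begin

text \<open>
  The symmetric powers are realised inside the polynomial ring in \<open>x\<^sub>1, \<dots>, x\<^sub>n\<close>. Let \<open>\<partial>\<close> be the sum
  of the partial derivatives \<open>\<partial>\<^sub>i\<close> and let \<open>e\<close> be the sum of the variables. In degree \<open>r < p\<close>,
  \<open>Sym\<^sup>r M\<close> consists of all homogeneous polynomials, \<open>Sym\<^sup>r S\<close> is the kernel of \<open>\<partial>\<close> on it, and
  \<open>Sym\<^sup>r D\<close> is \<open>Sym\<^sup>r S\<close> modulo \<open>e Sym\<^sup>r\<^sup>-\<^sup>1 S\<close>. If \<open>\<delta>\<close> is a derivation with \<open>\<delta> u = 1\<close>, then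
  \<open>f \<mapsto> \<Sum>\<^sub>j (-1)\<^sup>j u\<^sup>j\<^sup>+\<^sup>1/(j+1)! \<delta>\<^sup>j f\<close> is a section of \<open>\<delta>\<close>, and
  \<open>f \<mapsto> \<Sum>\<^sub>j (-1)\<^sup>j u\<^sup>j/(j+1)! \<delta>\<^sup>j\<^sup>+\<^sup>1 f\<close> is a retraction of multiplication by \<open>u\<close>. The first applies to
  \<open>(\<partial>, x\<^sub>i)\<close> and the second to \<open>(\<partial>\<^sub>i, e)\<close>, but neither is equivariant for a single \<open>i\<close>. By Euler's
  identity, in degree \<open>k\<close> the operators \<open>x\<^sub>i \<partial>\<^sub>i / k\<close> sum to the identity; averaging with these
  weights makes both maps equivariant, provided that \<open>0 < k < p - 1\<close>. Hence \<open>\<partial>\<close> and multiplication by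
  \<open>e\<close> are split.
\<close>

section \<open>Finitely supported functions as vector spaces\<close>

text \<open>Euler's operators can take over because a permutation carries the weight
  \<open>x_i d_i / k\<close> and the map belonging to \<open>i\<close> to those belonging to the
  image of \<open>i\<close>. They vanish on constants, and the Taylor coefficients reach
  \<open>1/(k+1)!\<close>; this accounts for \<open>0 < k < p - 1\<close>. For \<open>S\<close> one
  has \<open>r = k + 1\<close>, hence \<open>r >= 2\<close>. For \<open>D\<close> a polynomial of
  degree \<open>k + 2\<close> is divided by \<open>e\<close> and the result corrected by a section
  that starts in degree \<open>k\<close>, hence \<open>r >= 3\<close>. The bound
  \<open>r < p\<close> also makes the kernel equal to the symmetric power of \<open>S\<close>: the
  derivation kills \<open>x_1^p\<close>, which is not a combination of products of differences
  \<open>x_i - x_j\<close>. The other obstacle is that \<open>Sym\<close> is a quotient by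
  relations, where it is hard to see that anything is nonzero. A multilinear map into polynomials
  detects elements, and a linear map back, inverse to it only modulo the relations, shows that
  nothing else is left.\<close>

definition scl :: "'k::field \<Rightarrow> ('s \<Rightarrow>\<^sub>0 'k) \<Rightarrow> ('s \<Rightarrow>\<^sub>0 'k)"
  where "scl = (\<lambda>c. Poly_Mapping.map ((*) c))"

lemma lookup_scl [simp]: "Poly_Mapping.lookup (scl c f) s = c * Poly_Mapping.lookup f s"
  by (simp add: scl_def Poly_Mapping.map.rep_eq when_def)

lemma keys_scl: "Poly_Mapping.keys (scl c f) \<subseteq> Poly_Mapping.keys f"
  by (auto simp: in_keys_iff)

lemma scl_single [simp]: "scl c (Poly_Mapping.single s a) = Poly_Mapping.single s (c * a)"
  by (rule poly_mapping_eqI) (simp add: lookup_single when_def)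

lemma scl_conv_mult: "scl c (f :: 'm::comm_monoid_add \<Rightarrow>\<^sub>0 'k::field) = Poly_Mapping.single 0 c * f"
  by (simp add: scl_def mult_map_scale_conv_mult)

text \<open>Linear algebra is done over the whole type, where subspaces are plain sets;
  \<open>sub_rep_vectorspace\<close> and \<open>span_in_sub_rep\<close> link it to modules with
  explicit carriers.\<close>

interpretation pm: vector_space scl
  by unfold_locales
    (auto intro!: poly_mapping_eqI simp: lookup_add algebra_simps)

interpretation pm: vector_space_pair scl scl
  by unfold_locales

abbreviation lin :: "(('s \<Rightarrow>\<^sub>0 'k::field) \<Rightarrow> ('t \<Rightarrow>\<^sub>0 'k)) \<Rightarrow> bool"
  where "lin \<equiv> Vector_Spaces.linear scl scl"

lemma linI:
  assumes "\<And>a b. f (a + b) = f a + f b" "\<And>c a. f (scl c a) = scl c (f a)"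
  shows "lin f"
  using assms by (auto simp: Vector_Spaces.linear_iff pm.vector_space_axioms)

definition lext :: "('s \<Rightarrow> ('t \<Rightarrow>\<^sub>0 'k)) \<Rightarrow> ('s \<Rightarrow>\<^sub>0 'k::field) \<Rightarrow> ('t \<Rightarrow>\<^sub>0 'k)"
  where "lext \<phi> f = (\<Sum>s\<in>Poly_Mapping.keys f. scl (Poly_Mapping.lookup f s) (\<phi> s))"

lemma lin_lext: "lin (lext \<phi>)"
proof (rule linI)
  show "lext \<phi> (f + g) = lext \<phi> f + lext \<phi> g" for f g
    unfolding lext_def by (rule setsum_keys_plus_distrib) (simp_all add: pm.scale_left_distrib)
  show "lext \<phi> (scl c f) = scl c (lext \<phi> f)" for c f
  proof -
    have "lext \<phi> (scl c f) = (\<Sum>s\<in>Poly_Mapping.keys f. scl (Poly_Mapping.lookup (scl c f) s) (\<phi> s))"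
      unfolding lext_def
      by (rule sum.mono_neutral_left) (use keys_scl[of c f] in \<open>auto simp: in_keys_iff\<close>)
    then show ?thesis
      by (simp add: lext_def pm.scale_sum_right)
  qed
qed

lemma lext_single [simp]: "lext \<phi> (Poly_Mapping.single s c) = scl c (\<phi> s)"
  by (cases "c = 0") (auto simp: lext_def)

lemma poly_mapping_expand: "f = (\<Sum>s\<in>Poly_Mapping.keys f. Poly_Mapping.single s (Poly_Mapping.lookup f s))"
  by (rule poly_mapping_eqI) (auto simp: lookup_sum lookup_single when_def in_keys_iff)

lemma lext_id: "lext (\<lambda>s. Poly_Mapping.single s 1) f = f"
  by (simp add: lext_def flip: poly_mapping_expand)

lemma lin_eqI:
  assumes "lin f" "lin g" "\<And>s. f (Poly_Mapping.single s 1) = g (Poly_Mapping.single s 1)"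
  shows "f x = g x"
proof -
  have "f (\<Sum>s\<in>Poly_Mapping.keys x. scl (Poly_Mapping.lookup x s) (Poly_Mapping.single s 1)) =
    g (\<Sum>s\<in>Poly_Mapping.keys x. scl (Poly_Mapping.lookup x s) (Poly_Mapping.single s 1))"
    unfolding pm.linear_sum[OF assms(1)] pm.linear_sum[OF assms(2)]
      pm.linear_scale[OF assms(1)] pm.linear_scale[OF assms(2)] by (simp add: assms(3))
  then show ?thesis by (simp flip: poly_mapping_expand)
qed

text \<open>Carriers described by supports become spans of basis vectors, so a linear claim about
  them need only be checked on \<open>Poly_Mapping.single s 1\<close>, by
  \<open>pm.span_minimal\<close>.\<close>

lemma keys_subset_span:
  "{f. Poly_Mapping.keys f \<subseteq> S} = pm.span ((\<lambda>s. Poly_Mapping.single s (1::'k::field)) ` S)"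
proof (rule antisym; rule subsetI)
  fix f :: "'a \<Rightarrow>\<^sub>0 'k" assume "f \<in> {f. Poly_Mapping.keys f \<subseteq> S}"
  then have "(\<Sum>s\<in>Poly_Mapping.keys f. scl (Poly_Mapping.lookup f s) (Poly_Mapping.single s 1))
      \<in> pm.span ((\<lambda>s. Poly_Mapping.single s 1) ` S)"
    by (intro pm.span_sum pm.span_scale pm.span_base) auto
  then show "f \<in> pm.span ((\<lambda>s. Poly_Mapping.single s 1) ` S)"
    by (simp flip: poly_mapping_expand)
next
  have sub: "pm.subspace {f :: 'a \<Rightarrow>\<^sub>0 'k. Poly_Mapping.keys f \<subseteq> S}"
  proof (rule pm.subspaceI)
    show "f + g \<in> {f. Poly_Mapping.keys f \<subseteq> S}"
      if "f \<in> {f. Poly_Mapping.keys f \<subseteq> S}" "g \<in> {f. Poly_Mapping.keys f \<subseteq> S}" for f g :: "'a \<Rightarrow>\<^sub>0 'k"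
      using that Poly_Mapping.keys_add[of f g] by blast
    show "scl c f \<in> {f. Poly_Mapping.keys f \<subseteq> S}"
      if "f \<in> {f. Poly_Mapping.keys f \<subseteq> S}" for c and f :: "'a \<Rightarrow>\<^sub>0 'k"
      using that keys_scl[of c f] by blast
  qed simp
  have "pm.span ((\<lambda>s. Poly_Mapping.single s (1::'k)) ` S) \<subseteq> {f. Poly_Mapping.keys f \<subseteq> S}"
    by (rule pm.span_minimal[OF _ sub]) auto
  then show "f \<in> {f. Poly_Mapping.keys f \<subseteq> S}"
    if "f \<in> pm.span ((\<lambda>s. Poly_Mapping.single s 1) ` S)" for f :: "'a \<Rightarrow>\<^sub>0 'k"
    using that by blast
qed

text \<open>The common form of \<open>perm_module\<close>, \<open>specht_module\<close> and all
  polynomial models. The action is a function on the whole type, but being a module restricts it on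
  \<open>W\<close> only.\<close>

definition sub_rep :: "('s \<Rightarrow>\<^sub>0 'k) set \<Rightarrow> ('g \<Rightarrow> ('s \<Rightarrow>\<^sub>0 'k) \<Rightarrow> ('s \<Rightarrow>\<^sub>0 'k)) \<Rightarrow> ('g, 'k::field, 's \<Rightarrow>\<^sub>0 'k) rep"
  where "sub_rep W a =
    \<lparr>carrier = W, monoid.mult = (\<lambda>_ _. 0), one = 0, zero = 0, add = (+), smult = scl, act = a\<rparr>"

lemma sub_rep_simps [simp]:
  "carrier (sub_rep W a) = W" "zero (sub_rep W a) = 0" "add (sub_rep W a) = (+)"
  "smult (sub_rep W a) = scl" "act (sub_rep W a) = a"
  by (simp_all add: sub_rep_def)

lemma free_rep_eq: "free_rep S \<phi> =
    sub_rep {f. Poly_Mapping.keys f \<subseteq> S} (\<lambda>g. lext (\<lambda>s. Poly_Mapping.single (\<phi> g s) 1))"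
  by (simp add: free_rep_def sub_rep_def scl_def[symmetric] lext_def fun_eq_iff)

lemma sub_rep_vectorspace:
  fixes W :: "('s \<Rightarrow>\<^sub>0 'k::field) set"
  assumes "pm.subspace W"
  shows "vectorspace class_ring (sub_rep W a)"
proof -
  have "Module.module class_ring (sub_rep W a)"
  proof (rule moduleI)
    show "cring (class_ring :: 'k ring)"
      by (rule class_cring.cring_axioms)
    show "abelian_group (sub_rep W a)"
      by (rule abelian_groupI) (use assms in \<open>auto simp: pm.subspace_def algebra_simps
        intro!: bexI[of _ "- x" for x] pm.subspace_neg\<close>)
  qed (use assms in \<open>auto simp: pm.subspace_def algebra_simps\<close>)
  then show ?thesis
    by (intro vectorspace.intro class_field.field_axioms)
qed

lemma sub_rep_finsum:
  assumes "pm.subspace W" "finite A" "f ` A \<subseteq> W"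
  shows "finsum (sub_rep W a) f A = sum f A"
proof -
  interpret vectorspace class_ring "sub_rep W a" by (rule sub_rep_vectorspace[OF assms(1)])
  from assms(2,3) show ?thesis
    proof (induction A)
    case (insert x F)
    then have "finsum (sub_rep W a) f (insert x F) = f x \<oplus>\<^bsub>sub_rep W a\<^esub> finsum (sub_rep W a) f F"
      by (intro finsum_insert) auto
    then show ?case
      using insert by simp
  qed simp
qed

lemma span_in_sub_rep:
  assumes W: "pm.subspace W" and A: "A \<subseteq> W"
  shows "span_in (sub_rep W a) A = pm.span A"
proof -
  interpret vectorspace class_ring "sub_rep W a" by (rule sub_rep_vectorspace[OF W])
  have *: "lincomb r t = (\<Sum>a\<in>t. scl (r a) a)" if "finite t" "t \<subseteq> A" for r t
    unfolding lincomb_def using that A W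
    by (subst sub_rep_finsum) (auto intro!: pm.subspace_scale)
  have "span A = {\<Sum>a\<in>t. scl (r a) a |t r. finite t \<and> t \<subseteq> A}" (is "?L = ?R")
  proof (rule subset_antisym; rule subsetI)
    fix x assume "x \<in> ?L"
    then obtain r t where "x = lincomb r t" "finite t" "t \<subseteq> A"
      unfolding span_def by blast
    then show "x \<in> ?R" using *[of t r] by blast
  next
    fix x assume "x \<in> ?R"
    then obtain r t where "x = (\<Sum>a\<in>t. scl (r a) a)" "finite t" "t \<subseteq> A" by blast
    then have "x = lincomb r t \<and> finite t \<and> t \<subseteq> A \<and> r \<in> t \<rightarrow> carrier class_ring"
      using * by simp
    then show "x \<in> ?L" unfolding span_def by blast
  qed
  then show ?thesis
    unfolding span_in_def pm.span_explicit .
qed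

lemma fd_rep_sub_rep:
  assumes G: "group G" and W: "pm.subspace W" and finB: "finite B" and WB: "W \<subseteq> pm.span B"
    and add: "\<And>g x y. g \<in> carrier G \<Longrightarrow> x \<in> W \<Longrightarrow> y \<in> W \<Longrightarrow> a g (x + y) = a g x + a g y"
    and scl: "\<And>g c x. g \<in> carrier G \<Longrightarrow> x \<in> W \<Longrightarrow> a g (scl c x) = scl c (a g x)"
    and st: "\<And>g x. g \<in> carrier G \<Longrightarrow> x \<in> W \<Longrightarrow> a g x \<in> W"
    and one: "\<And>x. x \<in> W \<Longrightarrow> a \<one>\<^bsub>G\<^esub> x = x"
    and mult: "\<And>g h x. g \<in> carrier G \<Longrightarrow> h \<in> carrier G \<Longrightarrow> x \<in> W \<Longrightarrow> a (g \<otimes>\<^bsub>G\<^esub> h) x = a g (a h x)"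
  shows "fd_rep G (sub_rep W a)"
proof -
  interpret group G by (rule G)
  interpret vectorspace class_ring "sub_rep W a" by (rule sub_rep_vectorspace[OF W])
  obtain C where C: "C \<subseteq> W" "pm.independent C" "W \<subseteq> pm.span C"
    using pm.maximal_independent_subset by blast
  have "finite C"
    using pm.independent_span_bound[OF finB C(2)] C(1) WB by blast
  moreover have "pm.span C = W"
    using C W by (simp add: pm.span_minimal subset_antisym)
  ultimately have "fin_dim"
    unfolding fin_dim_def
    using C(1) span_in_sub_rep[OF W C(1), of a] by (auto simp: span_in_def)
  then show ?thesis
    by unfold_locales
      (auto simp: LinearCombinations.module_hom_def st one mult add scl)
qed


section \<open>Additivity of classes in the representation ring\<close>

lemma rep_iso_trans:
  assumes "rep_iso G U V" "rep_iso G V W"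
    and "\<And>g v. g \<in> carrier G \<Longrightarrow> v \<in> carrier U \<Longrightarrow> act U g v \<in> carrier U"
  shows "rep_iso G U W"
proof -
  obtain f where f: "f \<in> LinearCombinations.module_hom class_ring U V" "bij_betw f (carrier U) (carrier V)"
    "\<forall>g\<in>carrier G. \<forall>v\<in>carrier U. f (act U g v) = act V g (f v)"
    using assms(1) unfolding rep_iso_def by blast
  obtain h where h: "h \<in> LinearCombinations.module_hom class_ring V W" "bij_betw h (carrier V) (carrier W)"
    "\<forall>g\<in>carrier G. \<forall>v\<in>carrier V. h (act V g v) = act W g (h v)"
    using assms(2) unfolding rep_iso_def by blast
  have *: "f v \<in> carrier V" if "v \<in> carrier U" for v
    using f(2) that by (auto simp: bij_betw_def)
  show ?thesis
    unfolding rep_iso_def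
  proof (intro bexI[of _ "h \<circ> f"] conjI ballI)
    show "bij_betw (h \<circ> f) (carrier U) (carrier W)"
      by (rule bij_betw_trans[OF f(2) h(2)])
    show "h \<circ> f \<in> LinearCombinations.module_hom class_ring U W"
      using f(1) h(1) * by (auto simp: LinearCombinations.module_hom_def Pi_def)
    show "(h \<circ> f) (act U g v) = act W g ((h \<circ> f) v)" if "g \<in> carrier G" "v \<in> carrier U" for g v
      using f(3) h(3) that * assms(3) by simp
  qed
qed

lemma fd_rep_act_closed:
  assumes "fd_rep G V" "g \<in> carrier G" "v \<in> carrier V"
  shows "act V g v \<in> carrier V"
  using fd_rep.act_linear[OF assms(1,2)] assms(3) by (auto simp: LinearCombinations.module_hom_def)

text \<open>No closure or module laws are known for \<open>W\<close>: each of its elements is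
  written as \<open>f v\<close>, and each law is pulled back to \<open>V\<close>.\<close>

lemma rep_iso_sym:
  fixes V :: "('g, 'k::field, 'v) rep"
  assumes V: "fd_rep G V" and iso: "rep_iso G V W"
  shows "rep_iso G W V"
proof -
  interpret fd_rep G V by (rule V)
  obtain f where f: "f \<in> LinearCombinations.module_hom class_ring V W" "bij_betw f (carrier V) (carrier W)"
    and eq: "\<And>g v. g \<in> carrier G \<Longrightarrow> v \<in> carrier V \<Longrightarrow> f (act V g v) = act W g (f v)"
    using iso unfolding rep_iso_def by blast
  define h where "h = inv_into (carrier V) f"
  have hf: "h (f v) = v" if "v \<in> carrier V" for v
    unfolding h_def using f(2) that by (simp add: bij_betw_inv_into_left)
  have ex: "\<exists>v\<in>carrier V. w = f v" if "w \<in> carrier W" for w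
    using f(2) that by (auto simp: bij_betw_def)
  have add: "f (u \<oplus>\<^bsub>V\<^esub> v) = f u \<oplus>\<^bsub>W\<^esub> f v" if "u \<in> carrier V" "v \<in> carrier V" for u v
    using f(1) that by (auto simp: LinearCombinations.module_hom_def)
  have smult: "f (c \<odot>\<^bsub>V\<^esub> v) = c \<odot>\<^bsub>W\<^esub> f v" if "v \<in> carrier V" for c v
    using f(1) that by (auto simp: LinearCombinations.module_hom_def)
  show ?thesis
    unfolding rep_iso_def
  proof (intro bexI[of _ h] conjI ballI)
    show "bij_betw h (carrier W) (carrier V)"
      unfolding h_def by (rule bij_betw_inv_into[OF f(2)])
    show "h (act W g w) = act V g (h w)" if g: "g \<in> carrier G" and w: "w \<in> carrier W" for g w
    proof -
      obtain v where "v \<in> carrier V" "w = f v" using ex[OF w] by blast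
      then show ?thesis
        using eq[OF g] hf fd_rep_act_closed[OF V g] by metis
    qed
    show "h \<in> LinearCombinations.module_hom class_ring W V"
      unfolding LinearCombinations.module_hom_def
    proof (intro CollectI conjI allI impI; (elim conjE)?)
      show "h \<in> carrier W \<rightarrow> carrier V"
        using ex hf by force
      fix w w' assume "w \<in> carrier W" "w' \<in> carrier W"
      then obtain v v' where "v \<in> carrier V" "w = f v" "v' \<in> carrier V" "w' = f v'"
        using ex by metis
      then show "h (w \<oplus>\<^bsub>W\<^esub> w') = h w \<oplus>\<^bsub>V\<^esub> h w'"
        by (simp add: hf flip: add)
    next
      fix c :: 'k and w assume "w \<in> carrier W"
      then obtain v where "v \<in> carrier V" "w = f v"
        using ex by metis
      then show "h (c \<odot>\<^bsub>W\<^esub> w) = c \<odot>\<^bsub>V\<^esub> h w"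
        by (simp add: hf flip: smult)
    qed
  qed
qed

lemma iso_class_eqI:
  assumes V: "fd_rep G V" and iso: "rep_iso G V W"
    and W: "\<And>g w. g \<in> carrier G \<Longrightarrow> w \<in> carrier W \<Longrightarrow> act W g w \<in> carrier W"
  shows "iso_class G V = iso_class G W"
  unfolding iso_class_def
  using rep_iso_trans[OF iso] rep_iso_trans[OF rep_iso_sym[OF V iso]] fd_rep_act_closed[OF V] W
  by blast

lemma rep_iso_act_closed:
  assumes V: "fd_rep G V" and iso: "rep_iso G V W" "g \<in> carrier G" "w \<in> carrier W"
  shows "act W g w \<in> carrier W"
proof -
  obtain f where f: "f \<in> LinearCombinations.module_hom class_ring V W" "bij_betw f (carrier V) (carrier W)"
    and eq: "\<And>g v. g \<in> carrier G \<Longrightarrow> v \<in> carrier V \<Longrightarrow> f (act V g v) = act W g (f v)"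
    using iso unfolding rep_iso_def by blast
  obtain v where v: "v \<in> carrier V" "w = f v"
    using f(2) assms(4) by (auto simp: bij_betw_def)
  then show ?thesis
    using eq[OF assms(3) v(1)] fd_rep_act_closed[OF V assms(3) v(1)] f(2) bij_betwE by force
qed



text \<open>This allows the class of a symmetric power to be read off from a polynomial model: the
  axioms of a finite-dimensional module are verified for the model, never for the quotient that
  defines \<open>Sym\<close>.\<close>

lemma iso_class_eq:
  assumes "fd_rep G V" "rep_iso G V W"
  shows "iso_class G W = iso_class G V"
  using iso_class_eqI[OF assms rep_iso_act_closed[OF assms]] by simp

text \<open>Coordinates with respect to a finite basis, numbered by an injection \<open>e\<close>,
  transport the module to the type over which \<open>iso_classes\<close> ranges.\<close>

lemma fd_rep_copy:
  fixes V :: "('g, 'k::field, 'v) rep"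
  assumes V: "fd_rep G V"
  obtains W :: "(nat \<Rightarrow>\<^sub>0 'k) set" and a
  where "pm.subspace W" "fd_rep G (sub_rep W a)" "rep_iso G (sub_rep W a) V"
proof -
  interpret fd_rep G V by (rule V)
  obtain B where B: "finite B" "basis B"
    using finite_basis_exists fin_dim by blast
  have BV: "B \<subseteq> carrier V" using B(2) by (simp add: basis_def)
  obtain e :: "'v \<Rightarrow> nat" where e: "inj_on e B"
    using finite_imp_inj_to_nat_seg[OF B(1)] by blast
  define W where "W = {x :: nat \<Rightarrow>\<^sub>0 'k. Poly_Mapping.keys x \<subseteq> e ` B}"
  define h where "h x = lincomb (\<lambda>b. Poly_Mapping.lookup x (e b)) B" for x :: "nat \<Rightarrow>\<^sub>0 'k"
  have W_span: "W = pm.span ((\<lambda>s. Poly_Mapping.single s 1) ` (e ` B))"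
    unfolding W_def by (rule keys_subset_span)
  have W: "pm.subspace W" unfolding W_span by (rule pm.subspace_span)
  have hV: "h x \<in> carrier V" for x
    unfolding h_def using BV by (intro lincomb_closed) auto
  have h_add: "h (x + y) = h x \<oplus>\<^bsub>V\<^esub> h y" for x y
    unfolding h_def lookup_add using BV B(1) by (subst lincomb_sum[symmetric]) auto
  have h_scl: "h (scl c x) = c \<odot>\<^bsub>V\<^esub> h x" for c x
    unfolding h_def lookup_scl using BV by (subst lincomb_smult[symmetric]) auto
  have ex1: "\<exists>!a. a \<in> B \<rightarrow>\<^sub>E UNIV \<and> lincomb a B = v" if "v \<in> carrier V" for v
    using basis_criterion[OF B(1) BV] B(2) that by simp
  \<comment> \<open>\<open>basis_criterion\<close> gives uniqueness only among extensional
    coefficient functions, so coefficients are restricted to \<open>B\<close> before they are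
    compared.\<close>
  have restr: "lincomb (restrict a B) B = lincomb a B" for a
    by (rule lincomb_cong) (use BV in auto)
  have bij: "bij_betw h W (carrier V)"
  proof (rule bij_betwI')
    show "(h x = h y) = (x = y)" if "x \<in> W" "y \<in> W" for x y
    proof
      assume eq: "h x = h y"
      have "restrict (\<lambda>b. Poly_Mapping.lookup x (e b)) B = restrict (\<lambda>b. Poly_Mapping.lookup y (e b)) B"
        using ex1[OF hV[of x]] eq restr unfolding h_def by (metis UNIV_I restrict_PiE_iff)
      then have "Poly_Mapping.lookup x (e b) = Poly_Mapping.lookup y (e b)" if "b \<in> B" for b
        using that by (metis restrict_apply')
      then show "x = y"
        using that by (intro poly_mapping_eqI) (auto simp: W_def in_keys_iff subset_iff, metis imageE)
    qed simp
    show "h x \<in> carrier V" for x by (rule hV)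
    show "\<exists>x\<in>W. v = h x" if v: "v \<in> carrier V" for v
    proof -
      obtain a where a: "lincomb a B = v" using ex1[OF v] by blast
      define x where "x = (\<Sum>b\<in>B. Poly_Mapping.single (e b) (a b))"
      have "x \<in> W" unfolding x_def
        by (intro pm.subspace_sum[OF W]) (auto simp: W_def)
      moreover have "Poly_Mapping.lookup x (e b) = a b" if "b \<in> B" for b
      proof -
        have "Poly_Mapping.lookup x (e b) = (\<Sum>b'\<in>B. if b' = b then a b else 0)"
          unfolding x_def lookup_sum lookup_single
          by (rule sum.cong) (use e that in \<open>auto simp: when_def inj_on_def\<close>)
        then show ?thesis using B(1) that by simp
      qed
      then have "h x = v" unfolding h_def a[symmetric]
        by (intro lincomb_cong) (use BV in auto)
      ultimately show ?thesis by blast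
    qed
  qed
  define h' where "h' = inv_into W h"
  have h'h: "h' (h x) = x" if "x \<in> W" for x
    unfolding h'_def using bij that by (simp add: bij_betw_inv_into_left)
  have hh': "h (h' v) = v" if "v \<in> carrier V" for v
    unfolding h'_def using bij that by (simp add: bij_betw_inv_into_right)
  have h'W: "h' v \<in> W" if "v \<in> carrier V" for v
    unfolding h'_def using bij that by (metis bij_betw_def inv_into_into)
  define a where "a g x = h' (act V g (h x))" for g x
  note act_cl = fd_rep_act_closed[OF V]
  have h_a: "h (a g x) = act V g (h x)" if "g \<in> carrier G" for g x
    unfolding a_def by (rule hh') (use that act_cl hV in auto)
  have aW: "a g x \<in> W" if "g \<in> carrier G" for g x
    unfolding a_def by (rule h'W) (use that act_cl hV in auto)
  have inj: "x = y" if "h x = h y" "x \<in> W" "y \<in> W" for x y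
    using that h'h by metis
  have act_add: "act V g (u \<oplus>\<^bsub>V\<^esub> v) = act V g u \<oplus>\<^bsub>V\<^esub> act V g v"
    if "g \<in> carrier G" "u \<in> carrier V" "v \<in> carrier V" for g u v
    using act_linear[OF that(1)] that by (auto simp: LinearCombinations.module_hom_def)
  have act_scl: "act V g (c \<odot>\<^bsub>V\<^esub> v) = c \<odot>\<^bsub>V\<^esub> act V g v"
    if "g \<in> carrier G" "v \<in> carrier V" for g c v
    using act_linear[OF that(1)] that by (auto simp: LinearCombinations.module_hom_def)
  have "fd_rep G (sub_rep W a)"
  proof (rule fd_rep_sub_rep[OF is_group W])
    show "finite ((\<lambda>s. Poly_Mapping.single s (1::'k)) ` (e ` B))" using B(1) by simp
    show "W \<subseteq> pm.span ((\<lambda>s. Poly_Mapping.single s 1) ` (e ` B))" using W_span by simp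
    fix g x assume g: "g \<in> carrier G" and x: "x \<in> W"
    show "a g (x + y) = a g x + a g y" if "y \<in> W" for y
      by (rule inj) (use g x aW W in \<open>auto simp: h_a h_add act_add hV intro: pm.subspace_add\<close>)
    show "a g (scl c x) = scl c (a g x)" for c
      by (rule inj) (use g x aW W in \<open>auto simp: h_a h_scl act_scl hV intro: pm.subspace_scale\<close>)
    show "a g x \<in> W" using aW g by blast
    show "a (g \<otimes>\<^bsub>G\<^esub> k) x = a g (a k x)" if "k \<in> carrier G" for k
      by (rule inj) (use g x aW W that in \<open>auto simp: h_a act_mult hV\<close>)
  next
    show "a \<one>\<^bsub>G\<^esub> x = x" if "x \<in> W" for x
      by (rule inj) (use aW that in \<open>auto simp: h_a act_one hV\<close>)
  qed
  moreover have "rep_iso G (sub_rep W a) V"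
    unfolding rep_iso_def
    by (intro bexI[of _ h])
      (use bij in \<open>auto simp: h_a LinearCombinations.module_hom_def h_add h_scl hV\<close>)
  ultimately show ?thesis using W that by blast
qed

lemma dsum_rep_simps [simp]:
  "carrier (dsum_rep U V) = carrier U \<times> carrier V"
  "add (dsum_rep U V) = (\<lambda>v w. (fst v \<oplus>\<^bsub>U\<^esub> fst w, snd v \<oplus>\<^bsub>V\<^esub> snd w))"
  "smult (dsum_rep U V) = (\<lambda>c v. (c \<odot>\<^bsub>U\<^esub> fst v, c \<odot>\<^bsub>V\<^esub> snd v))"
  "act (dsum_rep U V) = (\<lambda>g. map_prod (act U g) (act V g))"
  by (simp_all add: dsum_rep_def direct_sum_def module.extend_def rep.fields_def)

lemma rep_iso_dsum:
  assumes "rep_iso G U U'" "rep_iso G V V'"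
  shows "rep_iso G (dsum_rep U V) (dsum_rep U' V')"
proof -
  obtain f where f: "f \<in> LinearCombinations.module_hom class_ring U U'" "bij_betw f (carrier U) (carrier U')"
    "\<forall>g\<in>carrier G. \<forall>v\<in>carrier U. f (act U g v) = act U' g (f v)"
    using assms(1) unfolding rep_iso_def by blast
  obtain h where h: "h \<in> LinearCombinations.module_hom class_ring V V'" "bij_betw h (carrier V) (carrier V')"
    "\<forall>g\<in>carrier G. \<forall>v\<in>carrier V. h (act V g v) = act V' g (h v)"
    using assms(2) unfolding rep_iso_def by blast
  show ?thesis
    unfolding rep_iso_def
  proof (intro bexI[of _ "map_prod f h"] conjI ballI)
    show "bij_betw (map_prod f h) (carrier (dsum_rep U V)) (carrier (dsum_rep U' V'))"
      using f(2) h(2) by (auto simp: bij_betw_def inj_on_def map_prod_surj_on)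
    show "map_prod f h \<in> LinearCombinations.module_hom class_ring (dsum_rep U V) (dsum_rep U' V')"
      using f(1) h(1) by (auto simp: LinearCombinations.module_hom_def Pi_def)
    show "map_prod f h (act (dsum_rep U V) g v) = act (dsum_rep U' V') g (map_prod f h v)"
      if "g \<in> carrier G" "v \<in> carrier (dsum_rep U V)" for g v
      using that f(3) h(3) by auto
  qed
qed


lemma fd_rep_sub_rep_span:
  fixes W :: "('s \<Rightarrow>\<^sub>0 'k::field) set"
  assumes "fd_rep G (sub_rep W a)" "pm.subspace W"
  obtains B where "finite B" "B \<subseteq> W" "W = pm.span B"
proof -
  interpret fd_rep G "sub_rep W a" by (rule assms(1))
  obtain B where "finite B" "B \<subseteq> W" "span B = W"
    using fin_dim unfolding fin_dim_def by auto
  then show ?thesis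
    using that span_in_sub_rep[OF assms(2), of B a] by (auto simp: span_in_def)
qed

lemma fd_rep_sub_repD:
  assumes "fd_rep G (sub_rep W a)"
  shows "g \<in> carrier G \<Longrightarrow> x \<in> W \<Longrightarrow> a g x \<in> W"
    and "g \<in> carrier G \<Longrightarrow> x \<in> W \<Longrightarrow> y \<in> W \<Longrightarrow> a g (x + y) = a g x + a g y"
    and "g \<in> carrier G \<Longrightarrow> x \<in> W \<Longrightarrow> a g (scl c x) = scl c (a g x)"
    and "x \<in> W \<Longrightarrow> a \<one>\<^bsub>G\<^esub> x = x"
    and "g \<in> carrier G \<Longrightarrow> h \<in> carrier G \<Longrightarrow> x \<in> W \<Longrightarrow> a (g \<otimes>\<^bsub>G\<^esub> h) x = a g (a h x)"
  using fd_rep.act_linear[OF assms, of g] fd_rep.act_one[OF assms, of x] fd_rep.act_mult[OF assms, of g h x]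
  by (auto simp: LinearCombinations.module_hom_def)

text \<open>A direct sum lives on pairs, whereas isomorphism classes consist of modules on one
  function type. Even indices make room for the first summand and odd indices for the second;
  \<open>i0\<close>, \<open>i1\<close> are the inclusions and \<open>p0\<close>, \<open>p1\<close>
  the projections.\<close>

lemma sub_rep_dsum_copy:
  fixes A B :: "(nat \<Rightarrow>\<^sub>0 'k::field) set"
  assumes A: "pm.subspace A" "fd_rep G (sub_rep A a)" and B: "pm.subspace B" "fd_rep G (sub_rep B b)"
  obtains X :: "('g, 'k, nat \<Rightarrow>\<^sub>0 'k) rep"
  where "fd_rep G X" "rep_iso G X (dsum_rep (sub_rep A a) (sub_rep B b))"
proof -
  define i0 :: "(nat \<Rightarrow>\<^sub>0 'k) \<Rightarrow> (nat \<Rightarrow>\<^sub>0 'k)" where "i0 = lext (\<lambda>s. Poly_Mapping.single (2 * s) 1)"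
  define i1 :: "(nat \<Rightarrow>\<^sub>0 'k) \<Rightarrow> (nat \<Rightarrow>\<^sub>0 'k)" where "i1 = lext (\<lambda>s. Poly_Mapping.single (Suc (2 * s)) 1)"
  define p0 :: "(nat \<Rightarrow>\<^sub>0 'k) \<Rightarrow> (nat \<Rightarrow>\<^sub>0 'k)"
    where "p0 = lext (\<lambda>s. if even s then Poly_Mapping.single (s div 2) 1 else 0)"
  define p1 :: "(nat \<Rightarrow>\<^sub>0 'k) \<Rightarrow> (nat \<Rightarrow>\<^sub>0 'k)"
    where "p1 = lext (\<lambda>s. if odd s then Poly_Mapping.single (s div 2) 1 else 0)"
  have lin: "lin i0" "lin i1" "lin p0" "lin p1"
    unfolding i0_def i1_def p0_def p1_def by (rule lin_lext)+
  note [simp] = lin[THEN pm.linear_add] lin[THEN pm.linear_scale] lin[THEN pm.linear_0]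
  have comp: "lin (\<lambda>x. f (h x))" if "lin f" "lin h" for f h :: "(nat \<Rightarrow>\<^sub>0 'k) \<Rightarrow> (nat \<Rightarrow>\<^sub>0 'k)"
    using Vector_Spaces.linear_compose[OF that(2,1)] by (simp add: o_def)
  have p0i0 [simp]: "p0 (i0 x) = x" and p1i0 [simp]: "p1 (i0 x) = 0"
    and p0i1 [simp]: "p0 (i1 x) = 0" and p1i1 [simp]: "p1 (i1 x) = x" for x
  proof -
    show "p0 (i0 x) = x"
      by (rule lin_eqI[OF comp[OF lin(3,1)] pm.linear_ident]) (simp add: i0_def p0_def)
    show "p1 (i0 x) = 0"
      by (rule lin_eqI[OF comp[OF lin(4,1)] pm.linear_zero]) (simp add: i0_def p1_def)
    show "p0 (i1 x) = 0"
      by (rule lin_eqI[OF comp[OF lin(3,2)] pm.linear_zero]) (simp add: i1_def p0_def)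
    show "p1 (i1 x) = x"
      by (rule lin_eqI[OF comp[OF lin(4,2)] pm.linear_ident]) (simp add: i1_def p1_def)
  qed
  have ip: "i0 (p0 z) + i1 (p1 z) = z" for z
  proof (rule lin_eqI[OF pm.linear_compose_add[OF comp[OF lin(1,3)] comp[OF lin(2,4)]] pm.linear_ident])
    show "i0 (p0 (Poly_Mapping.single s 1)) + i1 (p1 (Poly_Mapping.single s 1)) = Poly_Mapping.single s 1" for s
      by (cases "even s") (auto simp: i0_def i1_def p0_def p1_def pm.linear_0[OF lin_lext])
  qed
  define W where "W = {z. p0 z \<in> A} \<inter> {z. p1 z \<in> B}"
  define c where "c g z = i0 (a g (p0 z)) + i1 (b g (p1 z))" for g z
  have W: "pm.subspace W" unfolding W_def
    by (intro pm.subspace_inter pm.linear_subspace_linear_preimage lin A(1) B(1))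
  obtain FA where FA: "finite FA" "FA \<subseteq> A" "A = pm.span FA" using fd_rep_sub_rep_span[OF A(2,1)] .
  obtain FB where FB: "finite FB" "FB \<subseteq> B" "B = pm.span FB" using fd_rep_sub_rep_span[OF B(2,1)] .
  note Aa = fd_rep_sub_repD[OF A(2)] and Bb = fd_rep_sub_repD[OF B(2)]
  have "fd_rep G (sub_rep W c)"
  proof (rule fd_rep_sub_rep[OF _ W])
    show "Group.group G" using A(2) by (simp add: fd_rep_def)
    show "finite (i0 ` FA \<union> i1 ` FB)" using FA FB by simp
    show "W \<subseteq> pm.span (i0 ` FA \<union> i1 ` FB)"
    proof
      fix z assume "z \<in> W"
      then have "i0 (p0 z) \<in> pm.span (i0 ` FA)" "i1 (p1 z) \<in> pm.span (i1 ` FB)"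
        using FA(3) FB(3) by (auto simp: W_def pm.linear_span_image lin)
      then have "i0 (p0 z) + i1 (p1 z) \<in> pm.span (i0 ` FA \<union> i1 ` FB)"
        by (intro pm.span_add) (meson in_mono pm.span_mono sup_ge1 sup_ge2)+
      then show "z \<in> pm.span (i0 ` FA \<union> i1 ` FB)" by (simp add: ip)
    qed
  qed (auto simp: c_def W_def Aa Bb ip pm.scale_right_distrib)
  moreover have "rep_iso G (sub_rep W c) (dsum_rep (sub_rep A a) (sub_rep B b))"
    unfolding rep_iso_def
  proof (intro bexI[of _ "\<lambda>z. (p0 z, p1 z)"] conjI)
    show "bij_betw (\<lambda>z. (p0 z, p1 z)) (carrier (sub_rep W c)) (carrier (dsum_rep (sub_rep A a) (sub_rep B b)))"
      by (rule bij_betw_byWitness[of _ "\<lambda>(x, y). i0 x + i1 y"]) (auto simp: ip W_def)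
  qed (auto simp: c_def W_def LinearCombinations.module_hom_def)
  ultimately show ?thesis by (rule that)
qed

lemma dsum_copy:
  assumes U: "fd_rep G U" and V: "fd_rep G V"
  obtains X :: "('g, 'k::field, nat \<Rightarrow>\<^sub>0 'k) rep"
  where "fd_rep G X" "rep_iso G X (dsum_rep U V)"
proof -
  obtain A :: "(nat \<Rightarrow>\<^sub>0 'k) set" and a where A: "pm.subspace A" "fd_rep G (sub_rep A a)" "rep_iso G (sub_rep A a) U"
    using fd_rep_copy[OF U] .
  obtain B :: "(nat \<Rightarrow>\<^sub>0 'k) set" and b where B: "pm.subspace B" "fd_rep G (sub_rep B b)" "rep_iso G (sub_rep B b) V"
    using fd_rep_copy[OF V] .
  obtain X :: "('g, 'k, nat \<Rightarrow>\<^sub>0 'k) rep" where X: "fd_rep G X" "rep_iso G X (dsum_rep (sub_rep A a) (sub_rep B b))"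
    using sub_rep_dsum_copy[OF A(1,2) B(1,2)] .
  have "rep_iso G X (dsum_rep U V)"
    by (rule rep_iso_trans[OF X(2) rep_iso_dsum[OF A(3) B(3)] fd_rep_act_closed[OF X(1)]])
  with X(1) show ?thesis by (rule that)
qed

section \<open>Additivity in the free group on the classes and in its quotient\<close>

lemma iso_class_in:
  fixes V :: "('g, 'k::field, 'v) rep"
  assumes V: "fd_rep G V"
  shows "iso_class G V \<in> iso_classes G"
proof -
  obtain W :: "(nat \<Rightarrow>\<^sub>0 'k) set" and a where W: "fd_rep G (sub_rep W a)" "rep_iso G (sub_rep W a) V"
    using fd_rep_copy[OF V] .
  then show ?thesis
    using iso_class_eq[OF W] by (auto simp: iso_classes_def)
qed

lemma iso_class_dsum_in:
  assumes "fd_rep G U" "fd_rep G V"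
  shows "iso_class G (dsum_rep U V) \<in> iso_classes G"
  using dsum_copy[OF assms] iso_class_eq iso_class_in by metis

lemma class_ring_free_simps [simp]:
  "carrier (class_ring_free K G) = {c. Poly_Mapping.keys c \<subseteq> iso_classes G}"
  "add (class_ring_free K G) = (+)" "zero (class_ring_free K G) = 0"
  by (simp_all add: class_ring_free_def)

lemma abelian_group_class_ring_free: "abelian_group (class_ring_free K G)"
proof (rule abelian_groupI)
  show "x \<oplus>\<^bsub>class_ring_free K G\<^esub> y \<in> carrier (class_ring_free K G)"
    if "x \<in> carrier (class_ring_free K G)" "y \<in> carrier (class_ring_free K G)" for x y
    using that Poly_Mapping.keys_add[of x y] by auto
  show "\<exists>y\<in>carrier (class_ring_free K G). y \<oplus>\<^bsub>class_ring_free K G\<^esub> x = \<zero>\<^bsub>class_ring_free K G\<^esub>"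
    if "x \<in> carrier (class_ring_free K G)" for x
    using that by (intro bexI[of _ "-x"]) auto
qed (auto simp: algebra_simps)

lemma subgroup_sum_relations:
  "subgroup (sum_relations K G) (add_monoid (class_ring_free K G))"
  unfolding sum_relations_def
proof (rule group.generate_is_subgroup)
  show "group (add_monoid (class_ring_free K G))"
    by (rule abelian_group.a_group[OF abelian_group_class_ring_free])
next
  have "Poly_Mapping.keys (frag_of (iso_class G (dsum_rep U V)) - frag_of (iso_class G U) - frag_of (iso_class G V))
     \<subseteq> iso_classes G" if "fd_rep G U" "fd_rep G V" for U V :: "('b, 'a, nat \<Rightarrow>\<^sub>0 'a) rep"
    using keys_diff[of "frag_of (iso_class G (dsum_rep U V)) - frag_of (iso_class G U)" "frag_of (iso_class G V)"]
      keys_diff[of "frag_of (iso_class G (dsum_rep U V))" "frag_of (iso_class G U)"]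
      iso_class_dsum_in[OF that] iso_class_in[OF that(1)] iso_class_in[OF that(2)]
    by (auto simp: keys_frag_of)
  then show "{frag_of (iso_class G (dsum_rep U V)) - frag_of (iso_class G U) - frag_of (iso_class G V) |
        (U :: ('b, 'a, nat \<Rightarrow>\<^sub>0 'a) rep) (V :: ('b, 'a, nat \<Rightarrow>\<^sub>0 'a) rep). fd_rep G U \<and> fd_rep G V}
     \<subseteq> carrier (add_monoid (class_ring_free K G))"
    by auto
qed

lemma abelian_subgroup_sum_relations: "abelian_subgroup (sum_relations K G) (class_ring_free K G)"
  by (intro abelian_subgroupI3 additive_subgroup.intro subgroup_sum_relations abelian_group_class_ring_free)

text \<open>The identities to be proved are additive, so they can be verified in this group, a
  quotient of a free abelian group by the subgroup of relations.\<close>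

lemma abelian_group_green_ring: "abelian_group (green_ring K G)"
proof -
  interpret abelian_subgroup "sum_relations K G" "class_ring_free K G"
    by (rule abelian_subgroup_sum_relations)
  have "comm_group (add_monoid (green_ring K G))"
    using a_factorgroup_is_comm_group
    by (simp add: green_ring_def FactRing_def a_factorgroup_is_comm_group[unfolded A_FactGroup_def'])
  then show ?thesis
    by (intro abelian_group.intro abelian_monoid.intro abelian_group_axioms.intro)
      (auto simp: comm_group_def)
qed

text \<open>The defining relations mention only modules on
  \<open>nat \<Rightarrow>\<^sub>0 'k\<close>, so \<open>U\<close> and \<open>V\<close> are first
  replaced by such copies; the difference of the two sides is then a generator of
  \<open>sum_relations\<close>.\<close>

lemma green_class_add:
  fixes U :: "('g, 'k::field, 'u) rep" and V :: "('g, 'k, 'v) rep"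
  assumes X: "fd_rep G X" and U: "fd_rep G U" and V: "fd_rep G V"
    and iso: "rep_iso G X (dsum_rep U V)"
  shows "green_class G X = green_class G U \<oplus>\<^bsub>green_ring TYPE('k) G\<^esub> green_class G V"
proof -
  let ?R = "class_ring_free TYPE('k) G"
  let ?S = "sum_relations TYPE('k) G"
  interpret abelian_subgroup ?S ?R
    by (rule abelian_subgroup_sum_relations)
  obtain A :: "(nat \<Rightarrow>\<^sub>0 'k) set" and a where A: "fd_rep G (sub_rep A a)" "rep_iso G (sub_rep A a) U"
    using fd_rep_copy[OF U] .
  obtain B :: "(nat \<Rightarrow>\<^sub>0 'k) set" and b where B: "fd_rep G (sub_rep B b)" "rep_iso G (sub_rep B b) V"
    using fd_rep_copy[OF V] .
  let ?A = "sub_rep A a" and ?B = "sub_rep B b"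
  have eqs: "iso_class G U = iso_class G ?A" "iso_class G V = iso_class G ?B"
    using iso_class_eq A B by blast+
  have "rep_iso G X (dsum_rep ?A ?B)"
    using rep_iso_trans[OF iso rep_iso_dsum[OF rep_iso_sym[OF A] rep_iso_sym[OF B]]]
      fd_rep_act_closed[OF X] by blast
  then have X_eq: "iso_class G X = iso_class G (dsum_rep ?A ?B)"
    using iso_class_eq[OF X] by metis
  let ?x = "frag_of (iso_class G (dsum_rep ?A ?B))" and ?u = "frag_of (iso_class G ?A)"
    and ?v = "frag_of (iso_class G ?B)"
  have mem: "?x - ?u - ?v \<in> ?S"
    unfolding sum_relations_def by (rule generate.incl) (use A(1) B(1) in blast)
  have carr: "?x \<in> carrier ?R" "?u \<in> carrier ?R" "?v \<in> carrier ?R"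
    using iso_class_dsum_in[OF A(1) B(1)] iso_class_in[OF A(1)] iso_class_in[OF B(1)]
    by (auto simp: keys_frag_of)
  have uv: "?u + ?v \<in> carrier ?R"
    using add.m_closed[OF carr(2,3)] by simp
  have "?x \<in> ?S +>\<^bsub>?R\<^esub> (?u + ?v)"
    using mem unfolding a_r_coset_def r_coset_def by (force simp: algebra_simps)
  then have "?S +>\<^bsub>?R\<^esub> (?u + ?v) = ?S +>\<^bsub>?R\<^esub> ?x"
    by (rule a_repr_independence[OF _ uv subgroup_sum_relations])
  moreover have "(?S +>\<^bsub>?R\<^esub> ?u) <+>\<^bsub>?R\<^esub> (?S +>\<^bsub>?R\<^esub> ?v) = ?S +>\<^bsub>?R\<^esub> (?u + ?v)"
    using a_rcos_sum[OF carr(2,3)] by simp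
  ultimately show ?thesis
    by (simp add: green_class_def eqs X_eq green_ring_def FactRing_def)
qed

lemma green_class_closed:
  fixes V :: "('g, 'k::field, 'v) rep"
  assumes "fd_rep G V"
  shows "green_class G V \<in> carrier (green_ring TYPE('k) G)"
proof -
  interpret abelian_subgroup "sum_relations TYPE('k) G" "class_ring_free TYPE('k) G"
    by (rule abelian_subgroup_sum_relations)
  show ?thesis
    using iso_class_in[OF assms]
    by (auto simp: green_class_def green_ring_def FactRing_def keys_frag_of intro!: a_rcosetsI a_subset)
qed


section \<open>Polynomials and derivations\<close>

text \<open>A monomial is the multiset of its indices, so the convolution product over multiset
  addition is multiplication of polynomials. Every natural number indexes a variable; the
  restriction to the first \<open>n\<close> of them is imposed by \<open>hom_poly\<close>.\<close>

type_synonym 'k mvpoly = "nat multiset \<Rightarrow>\<^sub>0 'k"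

lemma mult_scl_left [simp]: "scl c (f :: 'k::field mvpoly) * g = scl c (f * g)"
  by (simp add: scl_conv_mult mult.assoc)

lemma mult_scl_right [simp]: "f * scl c (g :: 'k::field mvpoly) = scl c (f * g)"
  by (simp add: scl_conv_mult mult.left_commute)

lemma lin_mult_left: "lin (\<lambda>g :: 'k::field mvpoly. f * g)"
  by (rule linI) (simp_all add: algebra_simps)

lemma lin_mult_right: "lin (\<lambda>f :: 'k::field mvpoly. f * g)"
  by (rule linI) (simp_all add: algebra_simps)

lemma lin_comp: "lin f \<Longrightarrow> lin h \<Longrightarrow> lin (\<lambda>x. f (h x))"
  using Vector_Spaces.linear_compose[of scl scl h scl f] by (simp add: o_def)

lemma lin_funpow:
  fixes f :: "('s \<Rightarrow>\<^sub>0 'k::field) \<Rightarrow> ('s \<Rightarrow>\<^sub>0 'k)"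
  shows "lin f \<Longrightarrow> lin (f ^^ j)"
  by (induction j) (simp_all add: pm.linear_id Vector_Spaces.linear_compose)

lemma mvpoly_bilinear_eqI:
  fixes F H :: "'k::field mvpoly \<Rightarrow> 'k mvpoly \<Rightarrow> 't \<Rightarrow>\<^sub>0 'k"
  assumes "\<And>g. lin (\<lambda>f. F f g)" "\<And>g. lin (\<lambda>f. H f g)" "\<And>f. lin (F f)" "\<And>f. lin (H f)"
    and "\<And>m m'. F (Poly_Mapping.single m 1) (Poly_Mapping.single m' 1) =
        H (Poly_Mapping.single m 1) (Poly_Mapping.single m' 1)"
  shows "F f g = H f g"
  by (rule lin_eqI[of "\<lambda>f. F f g"], rule assms, rule assms, rule lin_eqI, rule assms, rule assms, rule assms)

definition var :: "nat \<Rightarrow> 'k::field mvpoly"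
  where "var i = Poly_Mapping.single {#i#} 1"

lemma single_add_mset: "Poly_Mapping.single (add_mset i m) (1::'k::field) = var i * Poly_Mapping.single m 1"
  by (simp add: var_def mult_single)

text \<open>If \<open>i\<close> does not occur in \<open>m\<close>, the subtraction leaves
  \<open>m\<close> as it is, but the coefficient is then \<open>0\<close>.\<close>

definition pdiff :: "nat \<Rightarrow> 'k::field mvpoly \<Rightarrow> 'k mvpoly"
  where "pdiff i = lext (\<lambda>m. Poly_Mapping.single (m - {#i#}) (of_nat (count m i)))"

definition is_deriv :: "('k::field mvpoly \<Rightarrow> 'k mvpoly) \<Rightarrow> bool"
  where "is_deriv D \<longleftrightarrow> lin D \<and> (\<forall>f g. D (f * g) = D f * g + f * D g)"

lemma lin_pdiff: "lin (pdiff i)"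
  unfolding pdiff_def by (rule lin_lext)

lemma pdiff_single: "pdiff i (Poly_Mapping.single m 1) = Poly_Mapping.single (m - {#i#}) (of_nat (count m i))"
  by (simp add: pdiff_def)

lemma pdiff_one: "pdiff i 1 = 0"
  using pdiff_single[of i "{#}"] by simp

lemma is_deriv_pdiff: "is_deriv (pdiff i :: 'k::field mvpoly \<Rightarrow> 'k mvpoly)"
proof -
  have "pdiff i (f * g) = pdiff i f * g + f * pdiff i g" for f g :: "'k mvpoly"
  proof (rule mvpoly_bilinear_eqI[where F = "\<lambda>f g. pdiff i (f * g)" and H = "\<lambda>f g. pdiff i f * g + f * pdiff i g"])
    fix m m' :: "nat multiset"
    have "Poly_Mapping.single (m + m' - {#i#}) (of_nat (count m i) :: 'k) = Poly_Mapping.single (m - {#i#} + m') (of_nat (count m i))"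
      by (cases "i \<in># m") (auto simp: not_in_iff)
    moreover have "Poly_Mapping.single (m + m' - {#i#}) (of_nat (count m' i) :: 'k) = Poly_Mapping.single (m + (m' - {#i#})) (of_nat (count m' i))"
      by (cases "i \<in># m'") (auto simp: not_in_iff)
    ultimately show "pdiff i (Poly_Mapping.single m (1::'k) * Poly_Mapping.single m' 1) =
        pdiff i (Poly_Mapping.single m 1) * Poly_Mapping.single m' 1 + Poly_Mapping.single m 1 * pdiff i (Poly_Mapping.single m' 1)"
      by (simp add: pdiff_single mult_single single_add)
  qed (intro pm.linear_compose_add lin_comp[OF lin_pdiff] lin_comp[OF lin_mult_left] lin_comp[OF lin_mult_right]
      lin_mult_left lin_mult_right lin_pdiff)+
  then show ?thesis by (simp add: is_deriv_def lin_pdiff)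
qed

text \<open>The derivative in the direction of the all-ones vector. By
  \<open>dirdiff_linform\<close> it restricts to the augmentation on linear forms, so its kernel in
  degree one is the Specht module.\<close>

definition dirdiff :: "nat \<Rightarrow> 'k::field mvpoly \<Rightarrow> 'k mvpoly"
  where "dirdiff n f = (\<Sum>i=1..n. pdiff i f)"

lemma lin_dirdiff: "lin (dirdiff n)"
  unfolding dirdiff_def by (intro pm.linear_compose_sum ballI lin_pdiff)

lemma is_deriv_dirdiff: "is_deriv (dirdiff n :: 'k::field mvpoly \<Rightarrow> 'k mvpoly)"
proof -
  have "pdiff i (f * g) = pdiff i f * g + f * pdiff i g" for i and f g :: "'k mvpoly"
    using is_deriv_pdiff unfolding is_deriv_def by blast
  then show ?thesis
    by (simp add: is_deriv_def lin_dirdiff)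
      (simp add: dirdiff_def sum.distrib sum_distrib_left sum_distrib_right)
qed

lemma pdiff_var: "pdiff i (var j) = (if i = j then 1 else 0)"
  by (auto simp: var_def pdiff_single)

lemma dirdiff_var: "i \<in> {1..n} \<Longrightarrow> dirdiff n (var i) = 1"
  by (simp add: dirdiff_def pdiff_var)

definition varsum :: "nat \<Rightarrow> 'k::field mvpoly"
  where "varsum n = (\<Sum>i=1..n. var i)"

lemma pdiff_varsum: "i \<in> {1..n} \<Longrightarrow> pdiff i (varsum n) = 1"
  by (simp add: varsum_def pm.linear_sum[OF lin_pdiff] pdiff_var)

lemma dirdiff_varsum: "dirdiff n (varsum n :: 'k::field mvpoly) = of_nat n"
  by (simp add: dirdiff_def pdiff_varsum)


section \<open>Dividing by a derivation, or by an element on which the derivation is 1\<close>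

definition taylor_sec :: "('k::field mvpoly \<Rightarrow> 'k mvpoly) \<Rightarrow> 'k mvpoly \<Rightarrow> nat \<Rightarrow> 'k mvpoly \<Rightarrow> 'k mvpoly"
  where "taylor_sec D u N f = (\<Sum>j<N. scl ((-1) ^ j / of_nat (fact (Suc j))) (u ^ Suc j * (D ^^ j) f))"

text \<open>Let \<open>E\<close> be the sum over \<open>j\<close> of
  \<open>(-1)^j u^j/j! D^j\<close>, formally the substitution \<open>u = 0\<close>; if
  \<open>D u = 1\<close>, then \<open>D E = 0\<close> and \<open>E (u f) = 0\<close>. Up to
  truncation, \<open>taylor_sec\<close> is \<open>1 - E\<close> with one factor \<open>D\<close>
  cancelled on the right, and \<open>taylor_ret\<close> is \<open>1 - E\<close> with one factor
  \<open>u\<close> cancelled on the left.\<close>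

definition taylor_ret :: "('k::field mvpoly \<Rightarrow> 'k mvpoly) \<Rightarrow> 'k mvpoly \<Rightarrow> nat \<Rightarrow> 'k mvpoly \<Rightarrow> 'k mvpoly"
  where "taylor_ret D u N f = (\<Sum>j<N. scl ((-1) ^ j / of_nat (fact (Suc j))) (u ^ j * (D ^^ Suc j) f))"

context
  fixes D :: "'k::field mvpoly \<Rightarrow> 'k mvpoly" and u :: "'k mvpoly"
  assumes D: "is_deriv D" and u: "D u = 1"
begin

lemma lin_deriv: "lin D" and deriv_mult: "D (f * g) = D f * g + f * D g"
  using D by (auto simp: is_deriv_def)

lemma deriv_power: "D (u ^ Suc j) = of_nat (Suc j) * u ^ j"
proof (induction j)
  case (Suc j)
  have "D (u ^ Suc (Suc j)) = D u * u ^ Suc j + u * D (u ^ Suc j)"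
    by (simp only: power_Suc[of u "Suc j"] deriv_mult)
  then show ?case by (simp only: Suc.IH u) (simp add: algebra_simps)
qed (simp add: u)

text \<open>The Leibniz rule: at most one of the \<open>j + 1\<close> factors \<open>D\<close> can
  hit \<open>u\<close>, because \<open>D u = 1\<close> is killed by a second one.\<close>

lemma funpow_deriv_mult: "(D ^^ Suc j) (u * f) = u * (D ^^ Suc j) f + of_nat (Suc j) * (D ^^ j) f"
proof (induction j)
  case (Suc j)
  have of_nat: "D (of_nat k * g) = of_nat k * D g" for k g
    by (induction k) (auto simp: algebra_simps pm.linear_add[OF lin_deriv] pm.linear_0[OF lin_deriv])
  have "(D ^^ Suc (Suc j)) (u * f) = D ((D ^^ Suc j) (u * f))" by simp
  also have "\<dots> = D (u * (D ^^ Suc j) f) + of_nat (Suc j) * D ((D ^^ j) f)"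
    unfolding Suc.IH by (simp only: pm.linear_add[OF lin_deriv] of_nat)
  also have "\<dots> = u * (D ^^ Suc (Suc j)) f + of_nat (Suc (Suc j)) * (D ^^ Suc j) f"
    by (simp add: deriv_mult u algebra_simps)
  finally show ?case .
qed (simp add: deriv_mult u add.commute)

text \<open>With \<open>a j\<close> as in the proof, each summand is \<open>a j - a (Suc j)\<close>,
  where \<open>a 0 = f\<close> and \<open>a N = 0\<close>. The same sum arises from
  \<open>D (taylor_sec D u N f)\<close> by the product rule and from
  \<open>taylor_ret D u N (u * f)\<close> by \<open>funpow_deriv_mult\<close>.\<close>

lemma taylor_telescope:
  assumes N: "(of_nat (fact N) :: 'k) \<noteq> 0" and nil: "(D ^^ N) f = 0"
  shows "(\<Sum>j<N. scl ((-1) ^ j / of_nat (fact (Suc j)))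
      (u ^ Suc j * (D ^^ Suc j) f + of_nat (Suc j) * (u ^ j * (D ^^ j) f))) = f"
proof -
  define a where "a j = scl ((-1) ^ j / of_nat (fact j)) (u ^ j * (D ^^ j) f)" for j
  have "scl ((-1) ^ j / of_nat (fact (Suc j)))
      (u ^ Suc j * (D ^^ Suc j) f + of_nat (Suc j) * (u ^ j * (D ^^ j) f)) = a j - a (Suc j)"
    if "j < N" for j
  proof -
    \<comment> \<open>Every smaller factorial divides \<open>fact N\<close>, so all denominators are
      nonzero as well.\<close>
    have "fact (Suc j) dvd (fact N :: nat)"
      using that by (intro fact_dvd) simp
    then have "(of_nat (fact (Suc j)) :: 'k) \<noteq> 0"
      using N by (metis dvd_def mult_zero_left of_nat_mult)
    then have nz: "(of_nat (Suc j) :: 'k) \<noteq> 0" "(of_nat (fact j) :: 'k) \<noteq> 0"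
      by (simp_all only: fact_Suc of_nat_mult) auto
    have "of_nat (Suc j) * (u ^ j * (D ^^ j) f) = scl (of_nat (Suc j)) (u ^ j * (D ^^ j) f)"
      by (simp only: scl_conv_mult single_of_nat)
    moreover have "(-1) ^ j / of_nat (fact (Suc j)) * of_nat (Suc j) = ((-1) ^ j / of_nat (fact j) :: 'k)"
    proof -
      have *: "c / (b * a) * b = c / a" if "b \<noteq> 0" for a b c :: 'k
        using that by simp
      have "of_nat (fact (Suc j)) = (of_nat (Suc j) * of_nat (fact j) :: 'k)"
        by (simp only: fact_Suc of_nat_mult of_nat_id)
      then show ?thesis using *[OF nz(1)] by simp
    qed
    ultimately show ?thesis
      unfolding a_def by (simp only: pm.scale_right_distrib pm.scale_scale)
        simp
  qed
  then have "(\<Sum>j<N. scl ((-1) ^ j / of_nat (fact (Suc j)))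
      (u ^ Suc j * (D ^^ Suc j) f + of_nat (Suc j) * (u ^ j * (D ^^ j) f))) = (\<Sum>j<N. a j - a (Suc j))"
    by simp
  also have "\<dots> = f"
    by (simp only: sum_lessThan_telescope') (simp add: a_def nil)
  finally show ?thesis .
qed

lemma deriv_taylor_sec:
  assumes "(of_nat (fact N) :: 'k) \<noteq> 0" "(D ^^ N) f = 0"
  shows "D (taylor_sec D u N f) = f"
proof -
  have "D (u ^ Suc j * (D ^^ j) f) = u ^ Suc j * (D ^^ Suc j) f + of_nat (Suc j) * (u ^ j * (D ^^ j) f)" for j
    unfolding deriv_mult deriv_power by (simp add: algebra_simps)
  then show ?thesis
    unfolding taylor_sec_def
    by (simp only: pm.linear_sum[OF lin_deriv] pm.linear_scale[OF lin_deriv] taylor_telescope[OF assms])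
qed

lemma taylor_ret_mult:
  assumes "(of_nat (fact N) :: 'k) \<noteq> 0" "(D ^^ N) f = 0"
  shows "taylor_ret D u N (u * f) = f"
proof -
  have "u ^ j * (D ^^ Suc j) (u * f) = u ^ Suc j * (D ^^ Suc j) f + of_nat (Suc j) * (u ^ j * (D ^^ j) f)" for j
    unfolding funpow_deriv_mult by (simp add: algebra_simps)
  then show ?thesis
    unfolding taylor_ret_def by (simp only: taylor_telescope[OF assms])
qed

end

lemma lin_taylor_sec: "lin D \<Longrightarrow> lin (taylor_sec D u N)"
  unfolding taylor_sec_def
  by (intro pm.linear_compose_sum ballI pm.linear_compose_scale_right lin_comp[OF lin_mult_left] lin_funpow)

lemma lin_taylor_ret: "lin D \<Longrightarrow> lin (taylor_ret D u N)"
  unfolding taylor_ret_def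
  by (intro pm.linear_compose_sum ballI pm.linear_compose_scale_right lin_comp[OF lin_mult_left] lin_funpow)


section \<open>Homogeneous polynomials and operators that lower the degree\<close>

definition monoms :: "nat \<Rightarrow> nat \<Rightarrow> nat multiset set"
  where "monoms n r = {m. set_mset m \<subseteq> {1..n} \<and> size m = r}"

definition hom_poly :: "nat \<Rightarrow> nat \<Rightarrow> 'k::field mvpoly set"
  where "hom_poly n r = {f. Poly_Mapping.keys f \<subseteq> monoms n r}"

lemma hom_poly_span: "hom_poly n r = pm.span ((\<lambda>m. Poly_Mapping.single m 1) ` monoms n r)"
  unfolding hom_poly_def by (rule keys_subset_span)

lemma finite_monoms: "finite (monoms n r)"
proof -
  have "monoms n r \<subseteq> mset ` {xs. set xs \<subseteq> {1..n} \<and> length xs = r}"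
  proof
    fix m assume "m \<in> monoms n r"
    moreover obtain xs where "mset xs = m" using ex_mset by blast
    ultimately show "m \<in> mset ` {xs. set xs \<subseteq> {1..n} \<and> length xs = r}"
      by (auto simp: monoms_def)
  qed
  then show ?thesis
    by (rule finite_subset) (intro finite_imageI finite_lists_length_eq, simp)
qed

lemma subspace_hom_poly: "pm.subspace (hom_poly n r)"
  unfolding hom_poly_span by (rule pm.subspace_span)

lemma hom_poly_subsetI:
  assumes "pm.subspace S" "\<And>m. m \<in> monoms n r \<Longrightarrow> Poly_Mapping.single m 1 \<in> S"
  shows "hom_poly n r \<subseteq> S"
  unfolding hom_poly_span by (rule pm.span_minimal) (use assms in auto)

lemma single_in_hom_poly [simp]: "m \<in> monoms n r \<Longrightarrow> Poly_Mapping.single m c \<in> hom_poly n r"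
  by (auto simp: hom_poly_def)

lemma hom_poly_mult:
  assumes "f \<in> hom_poly n r" "g \<in> hom_poly n s"
  shows "f * g \<in> hom_poly n (r + s)"
  using assms keys_mult[of f g] by (fastforce simp: hom_poly_def monoms_def)

lemma var_in_hom_poly: "i \<in> {1..n} \<Longrightarrow> var i \<in> hom_poly n (Suc 0)"
  unfolding var_def by (rule single_in_hom_poly) (simp add: monoms_def)

lemma var_mult_hom_poly: "i \<in> {1..n} \<Longrightarrow> f \<in> hom_poly n r \<Longrightarrow> var i * f \<in> hom_poly n (Suc r)"
  using hom_poly_mult[OF var_in_hom_poly] by simp

lemma varsum_in_hom_poly: "varsum n \<in> hom_poly n (Suc 0)"
  unfolding varsum_def by (intro pm.subspace_sum[OF subspace_hom_poly] var_in_hom_poly)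

lemma one_in_hom_poly: "1 \<in> hom_poly n 0"
  unfolding single_one[symmetric] by (rule single_in_hom_poly) (simp add: monoms_def)

lemma power_in_hom_poly: "u \<in> hom_poly n (Suc 0) \<Longrightarrow> u ^ j \<in> hom_poly n j"
  using hom_poly_mult[of u n "Suc 0"] by (induction j) (auto simp: one_in_hom_poly)

text \<open>The clause for degree \<open>0\<close> makes such an operator nilpotent:
  \<open>D ^^ Suc r\<close> vanishes in degree \<open>r\<close>, so the Taylor sums with
  \<open>N = Suc r\<close> lose nothing by truncation.\<close>

definition lowering :: "nat \<Rightarrow> ('k::field mvpoly \<Rightarrow> 'k mvpoly) \<Rightarrow> bool"
  where "lowering n D \<longleftrightarrow> (\<forall>r. \<forall>f\<in>hom_poly n (Suc r). D f \<in> hom_poly n r) \<and> (\<forall>f\<in>hom_poly n 0. D f = 0)"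

lemma lowering_Suc: "lowering n D \<Longrightarrow> f \<in> hom_poly n (Suc r) \<Longrightarrow> D f \<in> hom_poly n r"
  and lowering_0: "lowering n D \<Longrightarrow> f \<in> hom_poly n 0 \<Longrightarrow> D f = 0"
  by (simp_all add: lowering_def)

lemma lowering_pdiff: "lowering n (pdiff i)"
  unfolding lowering_def
proof (intro conjI allI ballI)
  fix r and f :: "'k::field mvpoly" assume "f \<in> hom_poly n (Suc r)"
  moreover have "hom_poly n (Suc r) \<subseteq> {f :: 'k mvpoly. pdiff i f \<in> hom_poly n r}"
  proof (rule hom_poly_subsetI)
    show "Poly_Mapping.single m 1 \<in> {f :: 'k mvpoly. pdiff i f \<in> hom_poly n r}" if "m \<in> monoms n (Suc r)" for m
    proof (cases "i \<in># m")
      case True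
      then have "m - {#i#} \<in> monoms n r"
        using that by (auto simp: monoms_def size_Diff_singleton dest: in_diffD)
      then show ?thesis by (simp add: pdiff_single)
    qed (simp add: pdiff_single not_in_iff pm.subspace_0[OF subspace_hom_poly])
  qed (intro pm.linear_subspace_linear_preimage lin_pdiff subspace_hom_poly)
  ultimately show "pdiff i f \<in> hom_poly n r" by blast
next
  fix f :: "'k::field mvpoly" assume "f \<in> hom_poly n 0"
  moreover have "hom_poly n 0 \<subseteq> {f :: 'k mvpoly. pdiff i f = 0}"
    by (rule hom_poly_subsetI) (auto simp: monoms_def pdiff_one intro: pm.linear_subspace_kernel lin_pdiff)
  ultimately show "pdiff i f = 0" by blast
qed

lemma lowering_dirdiff: "lowering n (dirdiff n)"
  using lowering_pdiff[of n]
  by (auto simp: lowering_def dirdiff_def intro!: pm.subspace_sum[OF subspace_hom_poly] sum.neutral)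

lemma lowering_funpow:
  assumes "lowering n D" "f \<in> hom_poly n r"
  shows "j \<le> r \<Longrightarrow> (D ^^ j) f \<in> hom_poly n (r - j)" and "(D ^^ Suc r) f = 0"
proof -
  show *: "(D ^^ j) f \<in> hom_poly n (r - j)" if "j \<le> r" for j
    using that
  proof (induction j)
    case (Suc j)
    then have "(D ^^ j) f \<in> hom_poly n (Suc (r - Suc j))"
      by (simp add: Suc_diff_Suc)
    then show ?case
      using assms(1) by (simp add: lowering_def)
  qed (use assms in simp)
  show "(D ^^ Suc r) f = 0"
    using *[of r] assms(1) by (simp add: lowering_def)
qed

lemma taylor_sec_hom_poly:
  assumes "lowering n D" "u \<in> hom_poly n (Suc 0)" "f \<in> hom_poly n k"
  shows "taylor_sec D u (Suc k) f \<in> hom_poly n (Suc k)"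
  unfolding taylor_sec_def
proof (intro pm.subspace_sum[OF subspace_hom_poly] pm.subspace_scale[OF subspace_hom_poly])
  fix j assume "j \<in> {..<Suc k}"
  then show "u ^ Suc j * (D ^^ j) f \<in> hom_poly n (Suc k)"
    using hom_poly_mult[OF power_in_hom_poly[OF assms(2), of "Suc j"] lowering_funpow(1)[OF assms(1,3), of j]]
    by (simp del: power_Suc)
qed

lemma taylor_ret_hom_poly:
  assumes "lowering n D" "u \<in> hom_poly n (Suc 0)" "f \<in> hom_poly n (Suc k)"
  shows "taylor_ret D u (Suc k) f \<in> hom_poly n k"
  unfolding taylor_ret_def
proof (intro pm.subspace_sum[OF subspace_hom_poly] pm.subspace_scale[OF subspace_hom_poly])
  fix j assume "j \<in> {..<Suc k}"
  then show "u ^ j * (D ^^ Suc j) f \<in> hom_poly n k"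
    using hom_poly_mult[OF power_in_hom_poly[OF assms(2), of j] lowering_funpow(1)[OF assms(1,3), of "Suc j"]]
    by (simp del: funpow.simps)
qed

lemma single_sum': "finite A \<Longrightarrow> Poly_Mapping.single s (\<Sum>i\<in>A. f i) = (\<Sum>i\<in>A. Poly_Mapping.single s (f i))"
  by (induction A rule: finite_induct) (simp_all add: single_add)

lemma euler:
  assumes "f \<in> hom_poly n k"
  shows "(\<Sum>i=1..n. var i * pdiff i f) = scl (of_nat k) (f :: 'k::field mvpoly)"
proof -
  let ?E = "\<lambda>f :: 'k mvpoly. \<Sum>i=1..n. var i * pdiff i f"
  have "hom_poly n k \<subseteq> {f. ?E f - scl (of_nat k) f = 0}"
  proof (rule hom_poly_subsetI)
    show "pm.subspace {f. ?E f - scl (of_nat k) f = 0}"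
      by (intro pm.linear_subspace_kernel pm.linear_compose_sub pm.linear_compose_sum ballI
          lin_comp[OF lin_mult_left] lin_pdiff pm.linear_scale_self)
    fix m assume m: "m \<in> monoms n k"
    have "var i * pdiff i (Poly_Mapping.single m (1::'k)) = Poly_Mapping.single m (of_nat (count m i))" for i
      by (cases "i \<in># m") (auto simp: var_def pdiff_single mult_single not_in_iff)
    then have "?E (Poly_Mapping.single m 1) = Poly_Mapping.single m (\<Sum>i=1..n. of_nat (count m i))"
      by (simp add: single_sum')
    also have "(\<Sum>i=1..n. of_nat (count m i)) = (of_nat (\<Sum>i=1..n. count m i) :: 'k)" by simp
    also have "(\<Sum>i=1..n. count m i) = size m"
      unfolding size_multiset_overloaded_eq
      by (rule sum.mono_neutral_right) (use m in \<open>auto simp: monoms_def not_in_iff\<close>)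
    finally show "Poly_Mapping.single m 1 \<in> {f. ?E f - scl (of_nat k) f = 0}"
      using m by (simp add: monoms_def)
  qed
  then show ?thesis using assms by auto
qed


section \<open>Equivariant section and retraction\<close>

definition perm_act :: "(nat \<Rightarrow> nat) \<Rightarrow> 'k::field mvpoly \<Rightarrow> 'k mvpoly"
  where "perm_act \<sigma> = lext (\<lambda>m. Poly_Mapping.single (image_mset \<sigma> m) 1)"

lemma lin_perm_act: "lin (perm_act \<sigma>)"
  unfolding perm_act_def by (rule lin_lext)

lemma perm_act_single: "perm_act \<sigma> (Poly_Mapping.single m 1) = Poly_Mapping.single (image_mset \<sigma> m) 1"
  by (simp add: perm_act_def)

lemma perm_act_mult: "perm_act \<sigma> (f * g) = perm_act \<sigma> f * perm_act \<sigma> g"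
  by (rule mvpoly_bilinear_eqI[where F = "\<lambda>f g. perm_act \<sigma> (f * g)" and H = "\<lambda>f g. perm_act \<sigma> f * perm_act \<sigma> g"])
    (intro lin_comp[OF lin_perm_act] lin_comp[OF lin_mult_left] lin_comp[OF lin_mult_right]
      lin_mult_left lin_mult_right lin_perm_act | simp add: perm_act_single mult_single)+

lemma perm_act_one: "perm_act \<sigma> 1 = 1"
  using perm_act_single[of \<sigma> "{#}"] by simp

lemma perm_act_power: "perm_act \<sigma> (f ^ j) = perm_act \<sigma> f ^ j"
  by (induction j) (simp_all add: perm_act_one perm_act_mult)

lemma perm_act_var: "perm_act \<sigma> (var i) = var (\<sigma> i)"
  by (simp add: var_def perm_act_single)

lemma perm_act_id: "perm_act id f = f"
  by (simp add: perm_act_def lext_id)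

lemma perm_act_comp: "perm_act (\<sigma> \<circ> \<tau>) f = perm_act \<sigma> (perm_act \<tau> f)"
  by (rule lin_eqI[OF lin_perm_act lin_comp[OF lin_perm_act lin_perm_act]])
    (simp add: perm_act_single image_mset.compositionality)

lemma perm_act_hom_poly:
  assumes "\<sigma> permutes {1..n}" "f \<in> hom_poly n r"
  shows "perm_act \<sigma> f \<in> hom_poly n r"
proof -
  have "hom_poly n r \<subseteq> {f. perm_act \<sigma> f \<in> hom_poly n r}"
  proof (rule hom_poly_subsetI)
    show "Poly_Mapping.single m 1 \<in> {f. perm_act \<sigma> f \<in> hom_poly n r}" if "m \<in> monoms n r" for m
    proof -
      have "image_mset \<sigma> m \<in> monoms n r"
        using that permutes_in_image[OF assms(1)] by (fastforce simp: monoms_def)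
      then show ?thesis by (simp add: perm_act_single)
    qed
  qed (intro pm.linear_subspace_linear_preimage lin_perm_act subspace_hom_poly)
  then show ?thesis using assms(2) by blast
qed

text \<open>An injective substitution merges no variables, so the multiplicity of \<open>i\<close>
  in a monomial is that of \<open>\<sigma> i\<close> in its image.\<close>

lemma perm_act_pdiff:
  assumes "inj \<sigma>"
  shows "perm_act \<sigma> (pdiff i f) = pdiff (\<sigma> i) (perm_act \<sigma> f)"
proof (rule lin_eqI[OF lin_comp[OF lin_perm_act lin_pdiff] lin_comp[OF lin_pdiff lin_perm_act]])
  fix m
  have "count (image_mset \<sigma> m) (\<sigma> i) = count m i"
    using assms by (induction m) (auto simp: inj_eq)
  moreover have "image_mset \<sigma> (m - {#i#}) = image_mset \<sigma> m - {#\<sigma> i#}" if "i \<in># m"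
    using that by (simp add: image_mset_Diff)
  ultimately show "perm_act \<sigma> (pdiff i (Poly_Mapping.single m 1)) =
      pdiff (\<sigma> i) (perm_act \<sigma> (Poly_Mapping.single m 1))"
    by (cases "i \<in># m") (auto simp: perm_act_single pdiff_single perm_act_def not_in_iff pm.linear_0[OF lin_lext])
qed

lemma sum_permutes: "\<sigma> permutes A \<Longrightarrow> (\<Sum>i\<in>A. h (\<sigma> i)) = (\<Sum>i\<in>A. h i)"
  using sum.permute[of \<sigma> A h] by (simp add: o_def)

lemma perm_act_dirdiff:
  assumes "\<sigma> permutes {1..n}"
  shows "perm_act \<sigma> (dirdiff n f) = dirdiff n (perm_act \<sigma> f)"
  unfolding dirdiff_def
  by (simp only: pm.linear_sum[OF lin_perm_act] perm_act_pdiff[OF permutes_inj[OF assms]]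
      sum_permutes[OF assms, of "\<lambda>i. pdiff i (perm_act \<sigma> f)"])

lemma perm_act_varsum:
  assumes "\<sigma> permutes {1..n}"
  shows "perm_act \<sigma> (varsum n) = varsum n"
  unfolding varsum_def
  by (simp only: pm.linear_sum[OF lin_perm_act] perm_act_var sum_permutes[OF assms, of var])

lemma perm_act_funpow:
  fixes D D' :: "'k::field mvpoly \<Rightarrow> 'k mvpoly"
  assumes "\<And>f. perm_act \<sigma> (D f) = D' (perm_act \<sigma> f)"
  shows "perm_act \<sigma> ((D ^^ j) f) = (D' ^^ j) (perm_act \<sigma> f)"
  by (induction j) (simp_all add: assms)

lemma perm_act_taylor_sec:
  assumes "\<And>f. perm_act \<sigma> (D f) = D' (perm_act \<sigma> f)"
  shows "perm_act \<sigma> (taylor_sec D u N f) = taylor_sec D' (perm_act \<sigma> u) N (perm_act \<sigma> f)"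
  unfolding taylor_sec_def pm.linear_sum[OF lin_perm_act] pm.linear_scale[OF lin_perm_act]
    perm_act_mult perm_act_power perm_act_funpow[of \<sigma> D D', OF assms] ..

lemma perm_act_taylor_ret:
  assumes "\<And>f. perm_act \<sigma> (D f) = D' (perm_act \<sigma> f)"
  shows "perm_act \<sigma> (taylor_ret D u N f) = taylor_ret D' (perm_act \<sigma> u) N (perm_act \<sigma> f)"
  unfolding taylor_ret_def pm.linear_sum[OF lin_perm_act] pm.linear_scale[OF lin_perm_act]
    perm_act_mult perm_act_power perm_act_funpow[of \<sigma> D D', OF assms] ..

text \<open>Every \<open>taylor_sec\<close> here is a section of the same \<open>dirdiff n\<close>,
  so the weights can act on the argument: after \<open>dirdiff n\<close> only the weighted sum is
  left, which is \<open>f\<close> by Euler's identity. Weighting preserves the degree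
  \<open>k\<close>, hence \<open>N = Suc k\<close>.\<close>

definition dirdiff_sec :: "nat \<Rightarrow> nat \<Rightarrow> 'k::field mvpoly \<Rightarrow> 'k mvpoly"
  where "dirdiff_sec n k f = scl (1 / of_nat k)
    (\<Sum>i=1..n. taylor_sec (dirdiff n) (var i) (Suc k) (var i * pdiff i f))"

text \<open>Here the weights act on the value: each \<open>taylor_ret\<close> undoes the same
  multiplication by \<open>varsum n\<close>, so on \<open>varsum n * f\<close> every weight meets
  \<open>f\<close> itself. The parameter \<open>k\<close> is the degree of the value, one less than
  that of the argument.\<close>

definition varsum_ret :: "nat \<Rightarrow> nat \<Rightarrow> 'k::field mvpoly \<Rightarrow> 'k mvpoly"
  where "varsum_ret n k f = scl (1 / of_nat k)
    (\<Sum>i=1..n. var i * pdiff i (taylor_ret (pdiff i) (varsum n) (Suc k) f))"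

lemma lin_dirdiff_sec: "lin (dirdiff_sec n k)"
  unfolding dirdiff_sec_def
  by (intro pm.linear_compose_scale_right pm.linear_compose_sum ballI
      lin_comp[OF lin_taylor_sec[OF lin_dirdiff]] lin_comp[OF lin_mult_left] lin_pdiff)

lemma lin_varsum_ret: "lin (varsum_ret n k)"
  unfolding varsum_ret_def
  by (intro pm.linear_compose_scale_right pm.linear_compose_sum ballI
      lin_comp[OF lin_mult_left] lin_comp[OF lin_pdiff] lin_taylor_ret[OF lin_pdiff])

lemma var_pdiff_hom_poly:
  assumes "i \<in> {1..n}" "f \<in> hom_poly n k"
  shows "var i * pdiff i f \<in> hom_poly n k"
proof (cases k)
  case 0
  then have "pdiff i f = 0" using lowering_0[OF lowering_pdiff] assms(2) by simp
  then show ?thesis by (simp add: pm.subspace_0[OF subspace_hom_poly])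
next
  case (Suc r)
  then have "pdiff i f \<in> hom_poly n r" using lowering_Suc[OF lowering_pdiff] assms(2) by simp
  then show ?thesis unfolding Suc by (rule var_mult_hom_poly[OF assms(1)])
qed

lemma dirdiff_sec_hom_poly:
  assumes "f \<in> hom_poly n k"
  shows "dirdiff_sec n k f \<in> hom_poly n (Suc k)"
  unfolding dirdiff_sec_def
  by (intro pm.subspace_sum[OF subspace_hom_poly] pm.subspace_scale[OF subspace_hom_poly]
      taylor_sec_hom_poly lowering_dirdiff var_in_hom_poly var_pdiff_hom_poly assms)

lemma varsum_ret_hom_poly:
  assumes "f \<in> hom_poly n (Suc k)"
  shows "varsum_ret n k f \<in> hom_poly n k"
  unfolding varsum_ret_def
  by (intro pm.subspace_sum[OF subspace_hom_poly] pm.subspace_scale[OF subspace_hom_poly]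
      taylor_ret_hom_poly lowering_pdiff varsum_in_hom_poly var_pdiff_hom_poly assms)

context
  fixes k :: nat and K :: "'k::field itself"
  assumes k: "0 < k" and inv: "(of_nat (fact (Suc k)) :: 'k) \<noteq> 0"
begin

lemma of_nat_k: "(of_nat k :: 'k) \<noteq> 0"
proof -
  have "k dvd fact (Suc k)"
    using k by (intro dvd_fact) auto
  then show ?thesis
    using inv by (metis dvd_def mult_zero_left of_nat_mult)
qed

lemma dirdiff_dirdiff_sec:
  assumes "(f :: 'k mvpoly) \<in> hom_poly n k"
  shows "dirdiff n (dirdiff_sec n k f) = f"
proof -
  have "dirdiff n (taylor_sec (dirdiff n) (var i) (Suc k) (var i * pdiff i f)) = var i * pdiff i f"
    if "i \<in> {1..n}" for i
    by (rule deriv_taylor_sec[OF is_deriv_dirdiff dirdiff_var[OF that] inv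
        lowering_funpow(2)[OF lowering_dirdiff var_pdiff_hom_poly[OF that assms]]])
  then show ?thesis
    by (simp add: dirdiff_sec_def pm.linear_scale[OF lin_dirdiff] pm.linear_sum[OF lin_dirdiff]
        euler[OF assms, simplified] of_nat_k)
qed

lemma varsum_ret_mult:
  assumes "(f :: 'k mvpoly) \<in> hom_poly n k"
  shows "varsum_ret n k (varsum n * f) = f"
proof -
  have "taylor_ret (pdiff i) (varsum n) (Suc k) (varsum n * f) = f"
    if "i \<in> {1..n}" for i
    by (rule taylor_ret_mult[OF is_deriv_pdiff pdiff_varsum[OF that] inv
        lowering_funpow(2)[OF lowering_pdiff assms]])
  then show ?thesis
    by (simp add: varsum_ret_def euler[OF assms, simplified] of_nat_k)
qed

end

text \<open>\<open>\<sigma>\<close> carries the summand for \<open>i\<close> to the summand for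
  \<open>\<sigma> i\<close>, so the sum is only reordered. In this sum the derivation
  \<open>dirdiff n\<close> is fixed and \<open>var i\<close> moves; in \<open>varsum_ret\<close> the
  derivation \<open>pdiff i\<close> moves and \<open>varsum n\<close> is fixed.\<close>

lemma perm_act_dirdiff_sec:
  assumes "\<sigma> permutes {1..n}"
  shows "perm_act \<sigma> (dirdiff_sec n k f) = dirdiff_sec n k (perm_act \<sigma> f)"
  unfolding dirdiff_sec_def
  by (simp only: pm.linear_scale[OF lin_perm_act] pm.linear_sum[OF lin_perm_act]
      perm_act_taylor_sec[of \<sigma> "dirdiff n" "dirdiff n", OF perm_act_dirdiff[OF assms]] perm_act_var perm_act_mult
      perm_act_pdiff[OF permutes_inj[OF assms]])
    (simp only: sum_permutes[OF assms, of "\<lambda>i. taylor_sec (dirdiff n) (var i) (Suc k) (var i * pdiff i (perm_act \<sigma> f))"])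

lemma perm_act_varsum_ret:
  assumes "\<sigma> permutes {1..n}"
  shows "perm_act \<sigma> (varsum_ret n k f) = varsum_ret n k (perm_act \<sigma> f)"
proof -
  note pd = perm_act_pdiff[OF permutes_inj[OF assms]]
  show ?thesis
    unfolding varsum_ret_def
    by (simp only: pm.linear_scale[OF lin_perm_act] pm.linear_sum[OF lin_perm_act]
      perm_act_taylor_ret[of \<sigma> "pdiff i" "pdiff (\<sigma> i)" for i, OF pd] perm_act_var perm_act_mult
      pd perm_act_varsum[OF assms])
    (simp only: sum_permutes[OF assms, of "\<lambda>i. var i * pdiff i (taylor_ret (pdiff i) (varsum n) (Suc k) (perm_act \<sigma> f))"])
qed

section \<open>The kernel of the derivation, and division by the sum of the variables inside
  it\<close>

definition ker_poly :: "nat \<Rightarrow> nat \<Rightarrow> 'k::field mvpoly set"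
  where "ker_poly n r = {f \<in> hom_poly n r. dirdiff n f = 0}"

lemma subspace_ker_poly: "pm.subspace (ker_poly n r)"
  unfolding ker_poly_def Collect_conj_eq Collect_mem_eq
  by (intro pm.subspace_inter subspace_hom_poly pm.linear_subspace_kernel lin_dirdiff)

text \<open>\<open>varsum_ret\<close> need not preserve the kernel of \<open>dirdiff n\<close>.
  Subtracting the section of the derivative repairs this, and the correction vanishes on
  \<open>varsum n * f\<close> for \<open>f\<close> in the kernel. The degrees run through
  \<open>k + 2\<close>, \<open>k + 1\<close>, \<open>k\<close> and back to \<open>k + 1\<close>; the
  section starting in degree \<open>k\<close> requires \<open>0 < k\<close>.\<close>

definition ker_ret :: "nat \<Rightarrow> nat \<Rightarrow> 'k::field mvpoly \<Rightarrow> 'k mvpoly"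
  where "ker_ret n k f = varsum_ret n (Suc k) f - dirdiff_sec n k (dirdiff n (varsum_ret n (Suc k) f))"

lemma lin_ker_ret: "lin (ker_ret n k)"
  unfolding ker_ret_def
  by (intro pm.linear_compose_sub lin_varsum_ret lin_comp[OF lin_dirdiff_sec] lin_comp[OF lin_dirdiff])

lemma perm_act_ker_ret:
  assumes "\<sigma> permutes {1..n}"
  shows "perm_act \<sigma> (ker_ret n k f) = ker_ret n k (perm_act \<sigma> f)"
  by (simp add: ker_ret_def pm.linear_diff[OF lin_perm_act] perm_act_varsum_ret[OF assms]
      perm_act_dirdiff_sec[OF assms] perm_act_dirdiff[OF assms])

lemma perm_act_ker_poly:
  assumes "\<sigma> permutes {1..n}" "f \<in> ker_poly n r"
  shows "perm_act \<sigma> f \<in> ker_poly n r"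
  using assms by (simp add: ker_poly_def perm_act_hom_poly pm.linear_0[OF lin_perm_act] flip: perm_act_dirdiff)

context
  fixes k :: nat and K :: "'k::field itself"
  assumes k: "0 < k" and inv: "(of_nat (fact (Suc (Suc k))) :: 'k) \<noteq> 0"
begin

lemma inv': "(of_nat (fact (Suc k)) :: 'k) \<noteq> 0"
  using inv by (simp only: fact_Suc[of "Suc k"] of_nat_mult) auto

lemma ker_ret_in:
  assumes "(f :: 'k mvpoly) \<in> hom_poly n (Suc (Suc k))"
  shows "ker_ret n k f \<in> ker_poly n (Suc k)"
proof -
  let ?q = "varsum_ret n (Suc k) f"
  have q: "?q \<in> hom_poly n (Suc k)" by (rule varsum_ret_hom_poly[OF assms])
  then have D: "dirdiff n ?q \<in> hom_poly n k" using lowering_dirdiff by (auto simp: lowering_def)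
  show ?thesis
    unfolding ker_poly_def ker_ret_def
    using pm.subspace_diff[OF subspace_hom_poly q dirdiff_sec_hom_poly[OF D]]
    by (simp add: pm.linear_diff[OF lin_dirdiff] dirdiff_dirdiff_sec[OF k inv' D])
qed

lemma ker_ret_mult:
  assumes "(f :: 'k mvpoly) \<in> ker_poly n (Suc k)"
  shows "ker_ret n k (varsum n * f) = f"
  using assms varsum_ret_mult[OF _ inv, of f n]
  by (simp add: ker_ret_def ker_poly_def pm.linear_0[OF lin_dirdiff_sec])

end

text \<open>The place where the characteristic dividing \<open>n\<close> enters: the derivative of
  \<open>varsum n\<close> is \<open>n\<close>.\<close>

lemma varsum_mult_ker_poly:
  assumes "(of_nat n :: 'k::field) = 0" "(f :: 'k mvpoly) \<in> ker_poly n r"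
  shows "varsum n * f \<in> ker_poly n (Suc r)"
proof -
  have "dirdiff n (varsum n * f) = dirdiff n (varsum n) * f + varsum n * dirdiff n f"
    using is_deriv_dirdiff unfolding is_deriv_def by blast
  moreover have "(of_nat n :: 'k mvpoly) = 0"
    using assms(1) by (metis single_of_nat single_zero)
  ultimately show ?thesis
    using assms(2) hom_poly_mult[OF varsum_in_hom_poly, of f n r]
    by (auto simp: ker_poly_def dirdiff_varsum)
qed


section \<open>Recognition of symmetric powers\<close>

lemma quot_rep_simps [simp]:
  "carrier (quot_rep V U) = a_rcosets\<^bsub>V\<^esub> U" "add (quot_rep V U) = set_add V"
  "smult (quot_rep V U) = (\<lambda>c A. \<Union>a\<in>A. U +>\<^bsub>V\<^esub> (c \<odot>\<^bsub>V\<^esub> a))"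
  "act (quot_rep V U) = (\<lambda>g A. \<Union>a\<in>A. U +>\<^bsub>V\<^esub> act V g a)"
  by (simp_all add: quot_rep_def)

lemma coset_sub_rep: "N +>\<^bsub>sub_rep W a\<^esub> x = (\<lambda>h. h + x) ` N"
  by (auto simp: a_r_coset_def r_coset_def)

context
  fixes N W :: "('s \<Rightarrow>\<^sub>0 'k::field) set" and a :: "'g \<Rightarrow> ('s \<Rightarrow>\<^sub>0 'k) \<Rightarrow> ('s \<Rightarrow>\<^sub>0 'k)"
  assumes N: "pm.subspace N"
begin

abbreviation "cst x \<equiv> N +>\<^bsub>sub_rep W a\<^esub> x"

lemma mem_cst_iff: "y \<in> cst x \<longleftrightarrow> y - x \<in> N"
  unfolding coset_sub_rep by (auto intro!: image_eqI[where x = "y - x"])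

lemma cst_eq_iff: "cst x = cst y \<longleftrightarrow> x - y \<in> N"
proof
  assume "cst x = cst y"
  then have "x \<in> cst y" using mem_cst_iff[of x x] pm.subspace_0[OF N] by simp
  then show "x - y \<in> N" by (simp add: mem_cst_iff)
next
  assume xy: "x - y \<in> N"
  show "cst x = cst y"
  proof (rule Set.set_eqI)
    fix z
    have "z - x \<in> N \<longleftrightarrow> z - y \<in> N"
      using pm.subspace_add[OF N _ xy, of "z - x"] pm.subspace_diff[OF N _ xy, of "z - y"] by auto
    then show "z \<in> cst x \<longleftrightarrow> z \<in> cst y" by (simp add: mem_cst_iff)
  qed
qed

lemma cst_rcosets: "a_rcosets\<^bsub>sub_rep W a\<^esub> N = cst ` W"
  by (auto simp: A_RCOSETS_def RCOSETS_def a_r_coset_def)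

lemma cst_add: "cst x <+>\<^bsub>sub_rep W a\<^esub> cst y = cst (x + y)"
proof (rule Set.set_eqI)
  fix z
  have "z \<in> cst x <+>\<^bsub>sub_rep W a\<^esub> cst y \<longleftrightarrow> (\<exists>u\<in>cst x. \<exists>v\<in>cst y. z = u + v)"
    by (auto simp: set_add_def set_mult_def)
  also have "\<dots> \<longleftrightarrow> z \<in> cst (x + y)"
  proof
    assume "\<exists>u\<in>cst x. \<exists>v\<in>cst y. z = u + v"
    then obtain u v where "u - x \<in> N" "v - y \<in> N" "z = u + v" by (auto simp: mem_cst_iff)
    then show "z \<in> cst (x + y)"
      using pm.subspace_add[OF N, of "u - x" "v - y"] by (simp add: mem_cst_iff algebra_simps)
  next
    assume "z \<in> cst (x + y)"
    then show "\<exists>u\<in>cst x. \<exists>v\<in>cst y. z = u + v"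
      by (intro bexI[of _ "z - y"] bexI[of _ y]) (auto simp: mem_cst_iff algebra_simps pm.subspace_0[OF N])
  qed
  finally show "z \<in> cst x <+>\<^bsub>sub_rep W a\<^esub> cst y \<longleftrightarrow> z \<in> cst (x + y)" .
qed

text \<open>The operations of \<open>quot_rep\<close> are unions over all representatives of a
  coset. If \<open>f\<close> respects congruence with \<open>x\<close> modulo \<open>N\<close>, all
  members of the union are the same coset.\<close>

lemma Union_cst:
  assumes "\<And>y. y - x \<in> N \<Longrightarrow> f y - f x \<in> N"
  shows "(\<Union>y\<in>cst x. cst (f y)) = cst (f x)"
proof -
  have "cst (f y) = cst (f x)" if "y \<in> cst x" for y
    unfolding cst_eq_iff using that by (intro assms) (simp add: mem_cst_iff)
  moreover have "x \<in> cst x" by (simp add: mem_cst_iff pm.subspace_0[OF N])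
  ultimately show ?thesis by blast
qed

lemma cst_smult: "(\<Union>y\<in>cst x. cst (scl c y)) = cst (scl c x)"
  by (rule Union_cst) (metis N pm.scale_right_diff_distrib pm.subspace_scale)

end

lemma lin_lext_comp: "lin F \<Longrightarrow> F (lext \<phi> v) = lext (\<lambda>i. F (\<phi> i)) v"
  by (simp add: lext_def pm.linear_sum pm.linear_scale)

lemma lext_diff: "lext (\<lambda>i. a i - b i) v = lext a v - lext b v"
  by (simp add: lext_def pm.scale_right_diff_distrib sum_subtractf)

lemma lext_in_subspace:
  assumes "pm.subspace N" "\<And>i. i \<in> Poly_Mapping.keys v \<Longrightarrow> \<psi> i \<in> N"
  shows "lext \<psi> v \<in> N"
  unfolding lext_def by (intro pm.subspace_sum[OF assms(1)] pm.subspace_scale[OF assms(1)] assms(2))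

section \<open>Symmetric powers by generators and relations\<close>

locale lin_action =
  fixes G :: "('g, 'm) monoid_scheme" and V :: "('g, 'k::field, 'v) rep"
  assumes add_cl: "u \<in> carrier V \<Longrightarrow> v \<in> carrier V \<Longrightarrow> u \<oplus>\<^bsub>V\<^esub> v \<in> carrier V"
    and smult_cl: "v \<in> carrier V \<Longrightarrow> c \<odot>\<^bsub>V\<^esub> v \<in> carrier V"
    and act_cl: "g \<in> carrier G \<Longrightarrow> v \<in> carrier V \<Longrightarrow> act V g v \<in> carrier V"
    and act_add: "g \<in> carrier G \<Longrightarrow> u \<in> carrier V \<Longrightarrow> v \<in> carrier V \<Longrightarrow>
      act V g (u \<oplus>\<^bsub>V\<^esub> v) = act V g u \<oplus>\<^bsub>V\<^esub> act V g v"
    and act_smult: "g \<in> carrier G \<Longrightarrow> v \<in> carrier V \<Longrightarrow> act V g (c \<odot>\<^bsub>V\<^esub> v) = c \<odot>\<^bsub>V\<^esub> act V g v"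
begin

abbreviation e :: "'v list \<Rightarrow> 'v list \<Rightarrow>\<^sub>0 'k" where "e xs \<equiv> Poly_Mapping.single xs 1"

definition vlists :: "nat \<Rightarrow> 'v list set"
  where "vlists r = {xs. set xs \<subseteq> carrier V \<and> length xs = r}"

definition sym_rel :: "nat \<Rightarrow> ('v list \<Rightarrow>\<^sub>0 'k) set"
  where "sym_rel r =
     {e (xs @ (u \<oplus>\<^bsub>V\<^esub> v) # ys) - e (xs @ u # ys) - e (xs @ v # ys) | xs u v ys.
           u \<in> carrier V \<and> v \<in> carrier V \<and> xs @ u # ys \<in> vlists r} \<union>
        {e (xs @ (c \<odot>\<^bsub>V\<^esub> u) # ys) - scl c (e (xs @ u # ys)) | xs c u ys.
           xs @ u # ys \<in> vlists r} \<union>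
        {e xs - e ys | xs ys. xs \<in> vlists r \<and> ys \<in> vlists r \<and> mset xs = mset ys}"

definition sym_null :: "nat \<Rightarrow> ('v list \<Rightarrow>\<^sub>0 'k) set"
  where "sym_null r = pm.span (sym_rel r)"

definition list_act :: "'g \<Rightarrow> ('v list \<Rightarrow>\<^sub>0 'k) \<Rightarrow> ('v list \<Rightarrow>\<^sub>0 'k)"
  where "list_act g = lext (\<lambda>xs. e (map (act V g) xs))"

definition list_space :: "nat \<Rightarrow> ('v list \<Rightarrow>\<^sub>0 'k) set"
  where "list_space r = {f. Poly_Mapping.keys f \<subseteq> vlists r}"

lemma list_space_span: "list_space r = pm.span (e ` vlists r)"
  unfolding list_space_def by (rule keys_subset_span)

lemma subspace_list_space: "pm.subspace (list_space r)"
  unfolding list_space_span by (rule pm.subspace_span)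

lemma subspace_sym_null: "pm.subspace (sym_null r)"
  unfolding sym_null_def by (rule pm.subspace_span)

lemma e_in_list_space: "xs \<in> vlists r \<Longrightarrow> e xs \<in> list_space r"
  unfolding list_space_span by (rule pm.span_base) simp

lemma vlists_replace: "xs @ u # ys \<in> vlists r \<Longrightarrow> v \<in> carrier V \<Longrightarrow> xs @ v # ys \<in> vlists r"
  and vlists_carrier: "xs @ u # ys \<in> vlists r \<Longrightarrow> u \<in> carrier V"
  by (auto simp: vlists_def)

lemma sym_rel_sub: "sym_rel r \<subseteq> list_space r"
  unfolding sym_rel_def
  by (auto intro!: pm.subspace_diff[OF subspace_list_space] pm.subspace_scale[OF subspace_list_space]
      e_in_list_space intro: vlists_replace add_cl smult_cl vlists_carrier simp del: scl_single)

lemma sym_null_sub: "sym_null r \<subseteq> list_space r"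
  unfolding sym_null_def by (rule pm.span_minimal[OF sym_rel_sub subspace_list_space])

lemma Sym_eq: "Sym r V = quot_rep (sub_rep (list_space r) list_act) (sym_null r)"
proof -
  have F: "free_rep {xs. set xs \<subseteq> carrier V \<and> length xs = r} (\<lambda>g. map (act V g)) = sub_rep (list_space r) list_act"
    by (simp add: free_rep_eq list_space_def vlists_def list_act_def[abs_def])
  have "sym_null r = span_in (sub_rep (list_space r) list_act) (sym_rel r)"
    unfolding sym_null_def by (rule span_in_sub_rep[symmetric, OF subspace_list_space sym_rel_sub])
  then show ?thesis
    unfolding Sym_def Let_def F sub_rep_simps by (simp only: sym_rel_def vlists_def)
qed

lemma sym_null_add: "xs @ u # ys \<in> vlists r \<Longrightarrow> v \<in> carrier V \<Longrightarrow>
    e (xs @ (u \<oplus>\<^bsub>V\<^esub> v) # ys) - e (xs @ u # ys) - e (xs @ v # ys) \<in> sym_null r"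
  unfolding sym_null_def sym_rel_def by (rule pm.span_base) (use vlists_carrier in blast)

lemma sym_null_smult: "xs @ u # ys \<in> vlists r \<Longrightarrow>
    e (xs @ (c \<odot>\<^bsub>V\<^esub> u) # ys) - scl c (e (xs @ u # ys)) \<in> sym_null r"
  unfolding sym_null_def sym_rel_def by (rule pm.span_base) blast

lemma sym_null_mset: "xs \<in> vlists r \<Longrightarrow> ys \<in> vlists r \<Longrightarrow> mset xs = mset ys \<Longrightarrow> e xs - e ys \<in> sym_null r"
  unfolding sym_null_def sym_rel_def by (rule pm.span_base) blast

lemma lin_list_act: "lin (list_act g)"
  unfolding list_act_def by (rule lin_lext)

lemma list_act_e: "list_act g (e xs) = e (map (act V g) xs)"
  by (simp add: list_act_def)

lemma map_act_vlists: "g \<in> carrier G \<Longrightarrow> xs \<in> vlists r \<Longrightarrow> map (act V g) xs \<in> vlists r"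
  using act_cl by (auto simp: vlists_def)

text \<open>Each of the three kinds of relation is mapped to a relation of the same kind.\<close>

lemma list_act_sym_null:
  assumes g: "g \<in> carrier G" and x: "x \<in> sym_null r"
  shows "list_act g x \<in> sym_null r"
proof -
  have "sym_rel r \<subseteq> {x. list_act g x \<in> sym_null r}"
  proof
    fix x assume "x \<in> sym_rel r"
    then consider
      (add) xs u v ys where "x = e (xs @ (u \<oplus>\<^bsub>V\<^esub> v) # ys) - e (xs @ u # ys) - e (xs @ v # ys)"
        "v \<in> carrier V" "xs @ u # ys \<in> vlists r"
      | (smult) xs c u ys where "x = e (xs @ (c \<odot>\<^bsub>V\<^esub> u) # ys) - scl c (e (xs @ u # ys))" "xs @ u # ys \<in> vlists r"
      | (mset) xs ys where "x = e xs - e ys" "xs \<in> vlists r" "ys \<in> vlists r" "mset xs = mset ys"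
      unfolding sym_rel_def by blast
    then have "list_act g x \<in> sym_null r"
    proof cases
      case add
      then show ?thesis
        using sym_null_add[of "map (act V g) xs" "act V g u" "map (act V g) ys" r "act V g v"]
          map_act_vlists[OF g, of "xs @ u # ys" r] vlists_carrier[of xs u ys r]
        by (simp add: pm.linear_diff[OF lin_list_act] list_act_e act_add act_cl g)
    next
      case smult
      then show ?thesis
        using sym_null_smult[of "map (act V g) xs" "act V g u" "map (act V g) ys" r c]
          map_act_vlists[OF g, of "xs @ u # ys" r] vlists_carrier[of xs u ys r]
        by (simp add: pm.linear_diff[OF lin_list_act] pm.linear_scale[OF lin_list_act] list_act_e
            act_smult g del: scl_single)
    next
      case mset
      then show ?thesis
        using sym_null_mset[OF map_act_vlists[OF g mset(2)] map_act_vlists[OF g mset(3)]]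
        by (simp add: pm.linear_diff[OF lin_list_act] list_act_e)
    qed
    then show "x \<in> {x. list_act g x \<in> sym_null r}" by simp
  qed
  then have "sym_null r \<subseteq> {x. list_act g x \<in> sym_null r}"
    unfolding sym_null_def[of r]
    by (rule pm.span_minimal[OF _ pm.linear_subspace_linear_preimage[OF lin_list_act pm.subspace_span]])
  then show ?thesis using x by blast
qed

text \<open>\<open>\<beta>\<close> is symmetric and multilinear, so its linear extension kills the
  relations and descends to the symmetric power; \<open>t\<close> inverts it modulo the relations.
  Equivariance is asked of \<open>\<beta>\<close> alone, which leaves \<open>t\<close> free to
  depend on a choice of basis and on an ordering of factors.\<close>

lemma Sym_iso:
  fixes W :: "('s \<Rightarrow>\<^sub>0 'k) set" and \<beta> :: "'v list \<Rightarrow> 's \<Rightarrow>\<^sub>0 'k" and t :: "('s \<Rightarrow>\<^sub>0 'k) \<Rightarrow> ('v list \<Rightarrow>\<^sub>0 'k)"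
  assumes W: "pm.subspace W" and \<rho>: "\<And>g. g \<in> carrier G \<Longrightarrow> lin (\<rho> g)" and t: "lin t"
    and \<beta>_W: "\<And>xs. xs \<in> vlists r \<Longrightarrow> \<beta> xs \<in> W"
    and W_span: "W \<subseteq> pm.span (\<beta> ` vlists r)"
    and \<beta>_add: "\<And>xs u ys v. xs @ u # ys \<in> vlists r \<Longrightarrow> v \<in> carrier V \<Longrightarrow>
        \<beta> (xs @ (u \<oplus>\<^bsub>V\<^esub> v) # ys) = \<beta> (xs @ u # ys) + \<beta> (xs @ v # ys)"
    and \<beta>_smult: "\<And>xs u ys c. xs @ u # ys \<in> vlists r \<Longrightarrow> \<beta> (xs @ (c \<odot>\<^bsub>V\<^esub> u) # ys) = scl c (\<beta> (xs @ u # ys))"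
    and \<beta>_mset: "\<And>xs ys. xs \<in> vlists r \<Longrightarrow> ys \<in> vlists r \<Longrightarrow> mset xs = mset ys \<Longrightarrow> \<beta> xs = \<beta> ys"
    and t_\<beta>: "\<And>xs. xs \<in> vlists r \<Longrightarrow> t (\<beta> xs) - e xs \<in> sym_null r"
    and \<beta>_act: "\<And>g xs. g \<in> carrier G \<Longrightarrow> xs \<in> vlists r \<Longrightarrow> \<beta> (map (act V g) xs) = \<rho> g (\<beta> xs)"
  shows "rep_iso G (sub_rep W \<rho>) (Sym r V)"
proof -
  let ?F = "sub_rep (list_space r) list_act"
  let ?N = "sym_null r"
  let ?b = "lext \<beta>"
  note N = subspace_sym_null[of r]
  have b_e: "?b (e xs) = \<beta> xs" for xs by simp
  have b_null: "?b x = 0" if "x \<in> ?N" for x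
  proof (rule pm.linear_eq_0_on_span[OF lin_lext _ that[unfolded sym_null_def]])
    fix x assume "x \<in> sym_rel r"
    then show "?b x = 0"
      unfolding sym_rel_def
      by (auto simp: pm.linear_diff[OF lin_lext] pm.linear_scale[OF lin_lext] \<beta>_add \<beta>_smult vlists_carrier
          simp del: scl_single intro: \<beta>_mset)
  qed
  have W_ind: "W \<subseteq> S" if "pm.subspace S" "\<And>xs. xs \<in> vlists r \<Longrightarrow> \<beta> xs \<in> S" for S
    using W_span pm.span_minimal[OF _ that(1), of "\<beta> ` vlists r"] that(2) by blast
  have t_F: "t f \<in> list_space r" if "f \<in> W" for f
  proof -
    have "W \<subseteq> {f. t f \<in> list_space r}"
    proof (rule W_ind)
      show "pm.subspace {f. t f \<in> list_space r}"
        by (rule pm.linear_subspace_linear_preimage[OF t subspace_list_space])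
      fix xs assume "xs \<in> vlists r"
      then have "t (\<beta> xs) - e xs + e xs \<in> list_space r"
        by (intro pm.subspace_add[OF subspace_list_space] e_in_list_space subsetD[OF sym_null_sub] t_\<beta>)
      then show "\<beta> xs \<in> {f. t f \<in> list_space r}" by simp
    qed
    then show ?thesis using that by blast
  qed
  have bt: "?b (t f) = f" if "f \<in> W" for f
  proof -
    have "W \<subseteq> {f. ?b (t f) - f = 0}"
    proof (rule W_ind)
      show "pm.subspace {f. ?b (t f) - f = 0}"
        by (intro pm.linear_subspace_kernel pm.linear_compose_sub lin_comp[OF lin_lext t] pm.linear_ident)
      fix xs assume "xs \<in> vlists r"
      then show "\<beta> xs \<in> {f. ?b (t f) - f = 0}"
        using b_null[OF t_\<beta>, of xs] by (simp add: pm.linear_diff[OF lin_lext])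
    qed
    then show ?thesis using that by auto
  qed
  have b_W: "?b x \<in> W" if "x \<in> list_space r" for x
    by (rule lext_in_subspace[OF W]) (use that \<beta>_W in \<open>auto simp: list_space_def\<close>)
  have tb: "t (?b x) - x \<in> ?N" if "x \<in> list_space r" for x
  proof -
    have "list_space r \<subseteq> {x. t (?b x) - x \<in> ?N}"
      unfolding list_space_span
    proof (rule pm.span_minimal)
      show "pm.subspace {x. t (?b x) - x \<in> ?N}"
        by (intro pm.linear_subspace_linear_preimage pm.linear_compose_sub lin_comp[OF t lin_lext] pm.linear_ident N)
    qed (use t_\<beta> in auto)
    then show ?thesis using that by blast
  qed
  \<comment> \<open>On a generator \<open>\<beta> xs\<close> both terms are congruent to
    \<open>e (map (act V g) xs)\<close>: the first by \<open>\<beta>_act\<close> and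
    \<open>t_\<beta>\<close>, the second because the relations are stable under
    \<open>g\<close>.\<close>
  have t_act: "t (\<rho> g f) - list_act g (t f) \<in> ?N" if g: "g \<in> carrier G" and f: "f \<in> W" for g f
  proof -
    have "W \<subseteq> {f. t (\<rho> g f) - list_act g (t f) \<in> ?N}"
    proof (rule W_ind)
      show "pm.subspace {f. t (\<rho> g f) - list_act g (t f) \<in> ?N}"
        by (intro pm.linear_subspace_linear_preimage pm.linear_compose_sub lin_comp[OF t \<rho>[OF g]]
            lin_comp[OF lin_list_act t] N)
      fix xs assume xs: "xs \<in> vlists r"
      have "(t (\<beta> (map (act V g) xs)) - e (map (act V g) xs)) - list_act g (t (\<beta> xs) - e xs) \<in> ?N"
        by (intro pm.subspace_diff[OF N] t_\<beta> map_act_vlists list_act_sym_null xs g)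
      then show "\<beta> xs \<in> {f. t (\<rho> g f) - list_act g (t f) \<in> ?N}"
        by (simp add: pm.linear_diff[OF lin_list_act] list_act_e \<beta>_act[OF g xs])
    qed
    then show ?thesis using f by blast
  qed
  let ?c = "\<lambda>x. ?N +>\<^bsub>?F\<^esub> x"
  have act_c: "(\<Union>y\<in>?c x. ?c (list_act g y)) = ?c (list_act g x)" if "g \<in> carrier G" for g x
    by (rule Union_cst[OF N]) (simp add: list_act_sym_null[OF that] flip: pm.linear_diff[OF lin_list_act])
  show ?thesis
    unfolding rep_iso_def Sym_eq
  proof (intro bexI[of _ "\<lambda>f. ?c (t f)"] conjI ballI)
    show "bij_betw (\<lambda>f. ?c (t f)) (carrier (sub_rep W \<rho>)) (carrier (quot_rep ?F ?N))"
      unfolding bij_betw_def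
    proof (intro conjI inj_onI equalityI subsetI)
      fix f g assume "f \<in> carrier (sub_rep W \<rho>)" "g \<in> carrier (sub_rep W \<rho>)" "?c (t f) = ?c (t g)"
      then show "f = g"
        using b_null[of "t f - t g"] bt[of f] bt[of g]
        by (simp add: cst_eq_iff[OF N] pm.linear_diff[OF lin_lext])
    next
      fix A assume "A \<in> carrier (quot_rep ?F ?N)"
      then obtain x where x: "x \<in> list_space r" "A = ?c x"
        by (auto simp: cst_rcosets[OF N])
      have "?c (t (?b x)) = ?c x"
        by (simp add: cst_eq_iff[OF N] tb x(1))
      then show "A \<in> (\<lambda>f. ?c (t f)) ` carrier (sub_rep W \<rho>)"
        using b_W[OF x(1)] x(2) by (metis image_eqI sub_rep_simps(1))
    qed (use t_F in \<open>auto simp: cst_rcosets[OF N]\<close>)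
    show "(\<lambda>f. ?c (t f)) \<in> LinearCombinations.module_hom class_ring (sub_rep W \<rho>) (quot_rep ?F ?N)"
      using t_F by (auto simp: LinearCombinations.module_hom_def cst_rcosets[OF N] cst_add[OF N] cst_smult[OF N]
          pm.linear_add[OF t] pm.linear_scale[OF t])
    show "?c (t (act (sub_rep W \<rho>) g f)) = act (quot_rep ?F ?N) g (?c (t f))"
      if "g \<in> carrier G" "f \<in> carrier (sub_rep W \<rho>)" for g f
      using that t_act by (simp add: act_c cst_eq_iff[OF N])
  qed
qed

end


section \<open>Products of linear forms\<close>

definition linform :: "(nat \<Rightarrow>\<^sub>0 'k::field) \<Rightarrow> 'k mvpoly"
  where "linform = lext var"

definition forms :: "(nat \<Rightarrow>\<^sub>0 'k::field) list \<Rightarrow> 'k mvpoly"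
  where "forms vs = prod_list (map linform vs)"

abbreviation perm_space :: "nat \<Rightarrow> (nat \<Rightarrow>\<^sub>0 'k::field) set"
  where "perm_space n \<equiv> {v. Poly_Mapping.keys v \<subseteq> {1..n}}"

definition aug :: "nat \<Rightarrow> (nat \<Rightarrow>\<^sub>0 'k::field) \<Rightarrow> 'k"
  where "aug n v = (\<Sum>i=1..n. Poly_Mapping.lookup v i)"

definition specht_space :: "nat \<Rightarrow> (nat \<Rightarrow>\<^sub>0 'k::field) set"
  where "specht_space n = {v \<in> perm_space n. aug n v = 0}"

lemma lin_linform: "lin linform"
  unfolding linform_def by (rule lin_lext)

lemma linform_single: "linform (Poly_Mapping.single i 1) = var i"
  by (simp add: linform_def)

lemma forms_simps [simp]: "forms [] = 1" "forms (v # vs) = linform v * forms vs" "forms (us @ vs) = forms us * forms vs"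
  by (simp_all add: forms_def)

lemma forms_mset: "mset us = mset vs \<Longrightarrow> forms us = forms vs"
  unfolding forms_def by (metis mset_map prod_mset_prod_list)

lemma single_mset_eq_prod: "Poly_Mapping.single (mset xs) (1::'k::field) = forms (map (\<lambda>i. Poly_Mapping.single i 1) xs)"
  by (induction xs) (simp_all add: single_add_mset linform_single)

lemma single_eq_forms:
  "Poly_Mapping.single m (1::'k::field) = forms (map (\<lambda>i. Poly_Mapping.single i 1) (sorted_list_of_multiset m))"
  using single_mset_eq_prod[of "sorted_list_of_multiset m"] by simp

lemma perm_space_span: "perm_space n = pm.span ((\<lambda>i. Poly_Mapping.single i 1) ` {1..n})"
  by (rule keys_subset_span)

lemma subspace_perm_space: "pm.subspace (perm_space n)"
  unfolding perm_space_span by (rule pm.subspace_span)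

lemma aug_add [simp]: "aug n (u + v) = aug n u + aug n v"
  and aug_diff [simp]: "aug n (u - v) = aug n u - aug n v"
  and aug_scl [simp]: "aug n (scl c v) = c * aug n v"
  and aug_zero [simp]: "aug n 0 = 0"
  by (simp_all add: aug_def lookup_add lookup_minus sum.distrib sum_subtractf sum_distrib_left)

lemma aug_single [simp]: "i \<in> {1..n} \<Longrightarrow> aug n (Poly_Mapping.single i c) = c"
  by (simp add: aug_def lookup_single when_def)

lemma subspace_specht_space: "pm.subspace (specht_space n)"
proof (rule pm.subspaceI)
  note M = subspace_perm_space[of n]
  show "0 \<in> specht_space n" by (simp add: specht_space_def)
  show "u + v \<in> specht_space n" if "u \<in> specht_space n" "v \<in> specht_space n" for u v :: "nat \<Rightarrow>\<^sub>0 'a"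
    using that pm.subspace_add[OF M, of u v] by (simp add: specht_space_def)
  show "scl c v \<in> specht_space n" if "v \<in> specht_space n" for c and v :: "nat \<Rightarrow>\<^sub>0 'a"
    using that pm.subspace_scale[OF M, of v c] by (simp add: specht_space_def)
qed

lemma linform_hom_poly:
  assumes "v \<in> perm_space n"
  shows "linform v \<in> hom_poly n (Suc 0)"
  unfolding linform_def
  by (rule lext_in_subspace[OF subspace_hom_poly]) (use assms in \<open>auto intro!: var_in_hom_poly\<close>)

lemma forms_hom_poly: "set vs \<subseteq> perm_space n \<Longrightarrow> forms vs \<in> hom_poly n (length vs)"
proof (induction vs)
  case (Cons v vs)
  then show ?case using hom_poly_mult[OF linform_hom_poly, of v n "forms vs" "length vs"] by simp
qed (simp add: one_in_hom_poly)

lemma dirdiff_linform: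
  assumes "v \<in> perm_space n"
  shows "dirdiff n (linform v) = scl (aug n v) 1"
proof -
  have "dirdiff n (linform v) = lext (\<lambda>i. dirdiff n (var i)) v"
    unfolding linform_def by (rule lin_lext_comp[OF lin_dirdiff])
  also have "\<dots> = (\<Sum>i\<in>Poly_Mapping.keys v. scl (Poly_Mapping.lookup v i) 1)"
    unfolding lext_def by (rule sum.cong) (use assms in \<open>auto simp: dirdiff_var\<close>)
  also have "\<dots> = scl (\<Sum>i\<in>Poly_Mapping.keys v. Poly_Mapping.lookup v i) 1"
    by (rule pm.scale_sum_left[symmetric])
  also have "(\<Sum>i\<in>Poly_Mapping.keys v. Poly_Mapping.lookup v i) = aug n v"
    unfolding aug_def by (rule sum.mono_neutral_left) (use assms in \<open>auto simp: in_keys_iff\<close>)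
  finally show ?thesis .
qed

lemma dirdiff_mult: "dirdiff n (f * g) = dirdiff n f * g + f * dirdiff n g"
  using is_deriv_dirdiff unfolding is_deriv_def by blast

lemma dirdiff_one: "dirdiff n 1 = 0"
  by (simp add: dirdiff_def pdiff_one)

lemma ker_poly_mult_linform:
  assumes "v \<in> specht_space n" "f \<in> ker_poly n r"
  shows "linform v * f \<in> ker_poly n (Suc r)"
  using assms hom_poly_mult[OF linform_hom_poly, of v n f r]
  by (simp add: ker_poly_def specht_space_def dirdiff_mult dirdiff_linform)

lemma forms_ker_poly: "set vs \<subseteq> specht_space n \<Longrightarrow> forms vs \<in> ker_poly n (length vs)"
proof (induction vs)
  case Nil
  then show ?case by (simp add: ker_poly_def one_in_hom_poly dirdiff_one)
next
  case (Cons v vs)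
  then show ?case using ker_poly_mult_linform[of v n "forms vs" "length vs"] by simp
qed

definition form_span :: "nat \<Rightarrow> nat \<Rightarrow> 'k::field mvpoly set"
  where "form_span n r = pm.span (forms ` {vs. set vs \<subseteq> specht_space n \<and> length vs = r})"

lemma form_span_ker_poly: "form_span n r \<subseteq> ker_poly n r"
  unfolding form_span_def
  by (rule pm.span_minimal[OF _ subspace_ker_poly]) (use forms_ker_poly in blast)

lemma form_span_mult_linform:
  fixes v :: "nat \<Rightarrow>\<^sub>0 'k::field"
  assumes "v \<in> specht_space n" "f \<in> form_span n r"
  shows "linform v * f \<in> form_span n (Suc r)"
proof -
  have "form_span n r \<subseteq> {f. linform v * f \<in> form_span n (Suc r)}"
    unfolding form_span_def[of n r]
  proof (rule pm.span_minimal)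
    show "pm.subspace {f. linform v * f \<in> form_span n (Suc r)}"
      unfolding form_span_def
      by (rule pm.linear_subspace_linear_preimage[OF lin_mult_left pm.subspace_span])
    show "forms ` {vs. set vs \<subseteq> specht_space n \<and> length vs = r} \<subseteq> {f. linform v * f \<in> form_span n (Suc r)}"
    proof (clarify)
      fix vs :: "(nat \<Rightarrow>\<^sub>0 'k) list" assume "set vs \<subseteq> specht_space n" "r = length vs"
      then have "forms (v # vs) \<in> form_span n (Suc (length vs))"
        unfolding form_span_def using assms(1) by (intro pm.span_base imageI) auto
      then show "linform v * forms vs \<in> form_span n (Suc (length vs))" by simp
    qed
  qed
  then show ?thesis using assms(2) by blast
qed

text \<open>Replacing a variable \<open>x_i\<close> by \<open>(x_i - x_n) + x_n\<close> separates
  products of differences from multiples of \<open>x_n\<close>. The clause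
  \<open>r = 0 \<longrightarrow> b = 0\<close> is there because \<open>r - 1\<close> is truncated:
  for \<open>r = 0\<close>, membership would still allow a constant \<open>b\<close>.\<close>

lemma hom_poly_decomp:
  assumes "1 \<le> n" "(f :: 'k::field mvpoly) \<in> hom_poly n r"
  shows "\<exists>a\<in>form_span n r. \<exists>b. f = a + var n * b \<and> b \<in> hom_poly n (r - 1) \<and> (r = 0 \<longrightarrow> b = 0)"
  using assms(2)
proof (induction r arbitrary: f)
  case 0
  have "hom_poly n 0 \<subseteq> (form_span n 0 :: 'k mvpoly set)"
  proof (rule hom_poly_subsetI)
    have "forms [] \<in> (form_span n 0 :: 'k mvpoly set)"
      unfolding form_span_def by (intro pm.span_base imageI) simp
    then show "Poly_Mapping.single m 1 \<in> (form_span n 0 :: 'k mvpoly set)" if "m \<in> monoms n 0" for m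
      using that by (simp add: monoms_def)
  qed (simp add: form_span_def)
  then show ?case using 0 by (intro bexI[of _ f] exI[of _ 0]) (auto simp: pm.subspace_0[OF subspace_hom_poly])
next
  case (Suc r)
  let ?S = "{f :: 'k mvpoly. \<exists>a\<in>form_span n (Suc r). \<exists>b\<in>hom_poly n r. f = a + var n * b}"
  have FS: "pm.subspace (form_span n (Suc r))" unfolding form_span_def by (rule pm.subspace_span)
  have "hom_poly n (Suc r) \<subseteq> ?S"
  proof (rule hom_poly_subsetI)
    have "?S = (\<lambda>(x, y). x + y) ` (form_span n (Suc r) \<times> (\<lambda>b. var n * b) ` hom_poly n r)"
      by auto
    also have "\<dots> = {x + y |x y. x \<in> form_span n (Suc r) \<and> y \<in> (\<lambda>b. var n * b) ` hom_poly n r}"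
      by auto
    finally show "pm.subspace ?S"
      using pm.subspace_sums[OF FS pm.linear_subspace_image[OF lin_mult_left subspace_hom_poly]] by simp
    fix m assume m: "m \<in> monoms n (Suc r)"
    then obtain i m' where im: "m = add_mset i m'"
      by (cases m) (auto simp: monoms_def)
    then have i: "i \<in> {1..n}" and m': "m' \<in> monoms n r" using m by (auto simp: monoms_def)
    obtain a b :: "'k mvpoly" where ab: "a \<in> form_span n r" "Poly_Mapping.single m' 1 = a + var n * b"
      "b \<in> hom_poly n (r - 1)" "r = 0 \<longrightarrow> b = 0"
      using Suc.IH[OF single_in_hom_poly[OF m', of 1]] by blast
    define v :: "nat \<Rightarrow>\<^sub>0 'k" where "v = Poly_Mapping.single i 1 - Poly_Mapping.single n 1"
    have v: "v \<in> specht_space n"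
      using i assms(1) pm.subspace_diff[OF subspace_perm_space, of "Poly_Mapping.single i 1" n "Poly_Mapping.single n 1"]
      by (simp add: specht_space_def v_def)
    have lv: "linform v = var i - var n"
      by (simp add: v_def pm.linear_diff[OF lin_linform] linform_single)
    have "var i * b \<in> hom_poly n r"
      using var_mult_hom_poly[OF i ab(3)] ab(4) by (cases r) (auto simp: pm.subspace_0[OF subspace_hom_poly])
    moreover have "a \<in> hom_poly n r" using form_span_ker_poly ab(1) by (auto simp: ker_poly_def)
    ultimately have "a + var i * b \<in> hom_poly n r" by (rule pm.subspace_add[OF subspace_hom_poly, rotated])
    \<comment> \<open>If the smaller monomial is \<open>a + x_n b\<close>, then
      \<open>x_i (a + x_n b) = (x_i - x_n) a + x_n (a + x_i b)\<close>.\<close>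
    moreover have "Poly_Mapping.single m (1::'k) = linform v * a + var n * (a + var i * b)"
      unfolding im single_add_mset ab(2) lv by (simp add: algebra_simps)
    ultimately show "Poly_Mapping.single m 1 \<in> ?S"
      using form_span_mult_linform[OF v ab(1)] by blast
  qed
  then obtain a b where "a \<in> form_span n (Suc r)" "b \<in> hom_poly n r" "f = a + var n * b"
    using Suc.prems by blast
  then show ?case by auto
qed

text \<open>The remainder divisible by \<^term>\<open>var n\<close> vanishes because its derivatives can be
  shown to be zero in descending order.\<close>

lemma ker_poly_eq_form_span:
  assumes n: "1 \<le> n" and inv: "(of_nat (fact r) :: 'k::field) \<noteq> 0"
  shows "ker_poly n r = (form_span n r :: 'k mvpoly set)"
proof (rule equalityI[OF _ form_span_ker_poly], rule subsetI)
  fix f :: "'k mvpoly" assume f: "f \<in> ker_poly n r"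
  then obtain a b where a: "a \<in> form_span n r" and f_eq: "f = a + var n * b"
    and b: "b \<in> hom_poly n (r - 1)" "r = 0 \<Longrightarrow> b = 0"
    using hom_poly_decomp[OF n, of f r] by (auto simp: ker_poly_def)
  have u: "dirdiff n (var n :: 'k mvpoly) = 1" using n by (simp add: dirdiff_var)
  have "a \<in> ker_poly n r" using a form_span_ker_poly by blast
  then have D: "dirdiff n (var n * b) = 0"
    using f by (simp add: ker_poly_def f_eq pm.linear_add[OF lin_dirdiff])
  have "b = 0"
  proof (cases r)
    case 0
    then show ?thesis by (rule b(2))
  next
    case (Suc k)
    have "j \<le> Suc k \<Longrightarrow> (dirdiff n ^^ (Suc k - j)) b = 0" for j
    proof (induction j)
      case 0
      then show ?case using lowering_funpow(2)[OF lowering_dirdiff, of b n k] b(1) Suc by simp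
    next
      case (Suc j)
      let ?i = "k - j"
      have i: "Suc k - j = Suc ?i" "Suc k - Suc j = ?i" using Suc.prems by auto
      \<comment> \<open>With \<open>D\<close> for the derivation and \<open>i = k - j\<close>,
        expanding this gives \<open>x_n D^(i+1) b + (i+1) D^i b\<close>. The first term is zero by
        the induction hypothesis, and \<open>i + 1 \<le> r\<close> is invertible.\<close>
      have "(dirdiff n ^^ Suc ?i) (var n * b) = 0"
        by (simp only: funpow_Suc_right o_apply D)
          (induction ("?i"), simp_all add: pm.linear_0[OF lin_dirdiff])
      then have "of_nat (Suc ?i) * (dirdiff n ^^ ?i) b = 0"
        using funpow_deriv_mult[OF is_deriv_dirdiff u, of ?i b] Suc i by (simp del: funpow.simps of_nat_Suc)
      moreover have "of_nat (Suc ?i) * (dirdiff n ^^ ?i) b = scl (of_nat (Suc ?i)) ((dirdiff n ^^ ?i) b)"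
        by (simp only: scl_conv_mult single_of_nat)
      moreover have "(of_nat (Suc ?i) :: 'k) \<noteq> 0"
      proof -
        have "Suc ?i dvd fact r"
          using \<open>r = Suc k\<close> by (intro dvd_fact) auto
        then show ?thesis
          using inv by (metis dvd_def mult_zero_left of_nat_mult)
      qed
      ultimately show ?case by (simp only: i pm.scale_eq_0_iff) simp
    qed
    from this[of "Suc k"] show ?thesis by simp
  qed
  then show "f \<in> form_span n r" using a f_eq by simp
qed

section \<open>Lifting polynomials back to formal combinations of lists\<close>

context lin_action
begin

text \<open>The map \<open>t\<close> of \<open>Sym_iso\<close>: a monomial is spelled out as the
  sorted list of its factors, with \<open>h i\<close> in place of \<open>x_i\<close>. The order is
  immaterial modulo the relations. The prefix \<open>ys\<close> collects the factors already treated
  in the induction of \<open>mono_lift_forms\<close>.\<close>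

definition mono_lift :: "'v list \<Rightarrow> (nat \<Rightarrow> 'v) \<Rightarrow> 'k mvpoly \<Rightarrow> ('v list \<Rightarrow>\<^sub>0 'k)"
  where "mono_lift ys h = lext (\<lambda>m. e (ys @ map h (sorted_list_of_multiset m)))"

lemma lin_mono_lift: "lin (mono_lift ys h)"
  unfolding mono_lift_def by (rule lin_lext)

text \<open>Moving \<open>x_i\<close> from the polynomial into the prefix only reorders the
  list.\<close>

lemma mono_lift_var:
  assumes h: "\<And>i. i \<in> {1..n} \<Longrightarrow> h i \<in> carrier V" and i: "i \<in> {1..n}"
    and ys: "set ys \<subseteq> carrier V" "length ys + Suc k = r" and f: "f \<in> hom_poly n k"
  shows "mono_lift ys h (var i * f) - mono_lift (ys @ [h i]) h f \<in> sym_null r"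
proof -
  have "hom_poly n k \<subseteq> {f. mono_lift ys h (var i * f) - mono_lift (ys @ [h i]) h f \<in> sym_null r}"
  proof (rule hom_poly_subsetI)
    show "pm.subspace {f. mono_lift ys h (var i * f) - mono_lift (ys @ [h i]) h f \<in> sym_null r}"
      by (intro pm.linear_subspace_linear_preimage pm.linear_compose_sub lin_comp[OF lin_mono_lift lin_mult_left]
          lin_mono_lift subspace_sym_null)
    fix m assume m: "m \<in> monoms n k"
    have "length (sorted_list_of_multiset m) = k"
      using m by (simp add: monoms_def flip: size_mset)
    moreover have "length (sorted_list_of_multiset (add_mset i m)) = Suc k"
      using m by (simp add: monoms_def del: sorted_list_of_multiset_insert flip: size_mset)
    moreover have "set (map h (sorted_list_of_multiset (add_mset i m))) \<subseteq> carrier V"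
      "set (map h (sorted_list_of_multiset m)) \<subseteq> carrier V"
      using m i h by (auto simp: monoms_def simp del: sorted_list_of_multiset_insert)
    ultimately have "e (ys @ map h (sorted_list_of_multiset (add_mset i m)))
        - e ((ys @ [h i]) @ map h (sorted_list_of_multiset m)) \<in> sym_null r"
      using ys h[OF i]
      by (intro sym_null_mset) (simp_all add: vlists_def mset_map del: sorted_list_of_multiset_insert)
    then show "Poly_Mapping.single m 1 \<in> {f. mono_lift ys h (var i * f) - mono_lift (ys @ [h i]) h f \<in> sym_null r}"
      by (simp add: mono_lift_def del: sorted_list_of_multiset_insert flip: single_add_mset)
  qed
  then show ?thesis using f by blast
qed

text \<open>\<open>H\<close> transfers the basis of the permutation module to \<open>V\<close>: it
  is the identity for \<open>M\<close>, a projection for \<open>S\<close>, and a projection followed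
  by passage to cosets for \<open>D\<close>.\<close>

context
  fixes H :: "(nat \<Rightarrow>\<^sub>0 'k) \<Rightarrow> 'v" and n :: nat
  assumes H_cl: "\<And>v. v \<in> perm_space n \<Longrightarrow> H v \<in> carrier V"
    and H_add: "\<And>u v. u \<in> perm_space n \<Longrightarrow> v \<in> perm_space n \<Longrightarrow> H (u + v) = H u \<oplus>\<^bsub>V\<^esub> H v"
    and H_smult: "\<And>c v. v \<in> perm_space n \<Longrightarrow> H (scl c v) = c \<odot>\<^bsub>V\<^esub> H v"
begin

lemma sym_null_expand:
  assumes "set ys \<subseteq> carrier V" "set zs \<subseteq> carrier V" "length ys + Suc (length zs) = r" "v \<in> perm_space n"
  shows "lext (\<lambda>i. e (ys @ H (Poly_Mapping.single i 1) # zs)) v - e (ys @ H v # zs) \<in> sym_null r"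
proof -
  note M = subspace_perm_space[of n]
  let ?L = "lext (\<lambda>i. e (ys @ H (Poly_Mapping.single i 1) # zs))"
  let ?S = "{v \<in> perm_space n. ?L v - e (ys @ H v # zs) \<in> sym_null r}"
  have vl: "ys @ H v # zs \<in> vlists r" if "v \<in> perm_space n" for v
    using assms H_cl[OF that] by (simp add: vlists_def)
  have scale: "scl c v \<in> ?S" if "v \<in> ?S" for c v
  proof -
    have v: "v \<in> perm_space n" using that by simp
    have "scl c (?L v - e (ys @ H v # zs)) \<in> sym_null r"
      by (rule pm.subspace_scale[OF subspace_sym_null]) (use that in auto)
    from pm.subspace_diff[OF subspace_sym_null this sym_null_smult[OF vl[OF v]]]
    have "scl c (?L v - e (ys @ H v # zs)) - (e (ys @ (c \<odot>\<^bsub>V\<^esub> H v) # zs) - scl c (e (ys @ H v # zs))) \<in> sym_null r" .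
    then have "?L (scl c v) - e (ys @ H (scl c v) # zs) \<in> sym_null r"
      by (simp add: H_smult[OF v] pm.linear_scale[OF lin_lext] pm.scale_right_diff_distrib)
    then show ?thesis using pm.subspace_scale[OF M v] by simp
  qed
  have single: "(\<lambda>i. Poly_Mapping.single i 1) ` {1..n} \<subseteq> ?S"
    by (auto simp: pm.subspace_0[OF subspace_sym_null])
  have "pm.subspace ?S"
  proof (rule pm.subspaceI)
    \<comment> \<open>No law for the zero of \<open>V\<close> is available in
      \<open>lin_action\<close>; \<open>H 0\<close> is null in a slot because it is \<open>0\<close>
      times a vector.\<close>
    have "e (ys @ (0 \<odot>\<^bsub>V\<^esub> H 0) # zs) - scl 0 (e (ys @ H 0 # zs)) \<in> sym_null r"
      by (rule sym_null_smult[OF vl]) simp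
    moreover have "H 0 = 0 \<odot>\<^bsub>V\<^esub> H 0" using H_smult[of 0 0] by simp
    ultimately show "0 \<in> ?S"
      by (simp add: pm.linear_0[OF lin_lext] pm.subspace_neg[OF subspace_sym_null] del: scl_single)
    show "u + v \<in> ?S" if "u \<in> ?S" "v \<in> ?S" for u v
    proof -
      have uv: "u \<in> perm_space n" "v \<in> perm_space n" using that by simp_all
      have "(?L u - e (ys @ H u # zs)) + (?L v - e (ys @ H v # zs))
          - (e (ys @ (H u \<oplus>\<^bsub>V\<^esub> H v) # zs) - e (ys @ H u # zs) - e (ys @ H v # zs)) \<in> sym_null r"
        by (rule pm.subspace_diff[OF subspace_sym_null pm.subspace_add[OF subspace_sym_null]
            sym_null_add[OF vl[OF uv(1)] H_cl[OF uv(2)]]]) (use that in auto)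
      then have "?L (u + v) - e (ys @ H (u + v) # zs) \<in> sym_null r"
        by (simp add: H_add[OF uv] pm.linear_add[OF lin_lext] algebra_simps)
      then show ?thesis using pm.subspace_add[OF M uv] by simp
    qed
  qed (rule scale)
  with single have "pm.span ((\<lambda>i. Poly_Mapping.single i 1) ` {1..n}) \<subseteq> ?S"
    by (rule pm.span_minimal)
  moreover have "v \<in> pm.span ((\<lambda>i. Poly_Mapping.single i 1) ` {1..n})"
    using assms(4) by (simp only: perm_space_span)
  ultimately show ?thesis by blast
qed

text \<open>Induction on the factors by three congruences: the first factor is expanded in the
  variables and each variable moved into the prefix; the remaining product is lifted by the
  induction hypothesis; the prefix entries are collected into \<open>H v\<close> by
  multilinearity.\<close>

lemma mono_lift_forms:
  assumes "set ys \<subseteq> carrier V" "set vs \<subseteq> perm_space n" "length ys + length vs = r"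
  shows "mono_lift ys (\<lambda>i. H (Poly_Mapping.single i 1)) (forms vs) - e (ys @ map H vs) \<in> sym_null r"
  using assms
proof (induction vs arbitrary: ys)
  case Nil
  have "mono_lift ys (\<lambda>i. H (Poly_Mapping.single i 1)) (Poly_Mapping.single {#} 1) = e ys"
    by (simp add: mono_lift_def del: single_one)
  then show ?case by (simp add: pm.subspace_0[OF subspace_sym_null])
next
  case (Cons v vs)
  let ?h = "\<lambda>i. H (Poly_Mapping.single i 1)"
  note N = subspace_sym_null[of r]
  have h: "?h i \<in> carrier V" if "i \<in> {1..n}" for i
    by (rule H_cl) (use that in simp)
  have v: "v \<in> perm_space n" and vs: "set vs \<subseteq> perm_space n" using Cons.prems by auto
  have i: "i \<in> {1..n}" if "i \<in> Poly_Mapping.keys v" for i using v that by auto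
  have 1: "lext (\<lambda>i. mono_lift ys ?h (var i * forms vs) - mono_lift (ys @ [?h i]) ?h (forms vs)) v \<in> sym_null r"
    by (rule lext_in_subspace[OF N], rule mono_lift_var[where n = n and k = "length vs"])
      (use Cons.prems h i forms_hom_poly[OF vs] in auto)
  have 2: "lext (\<lambda>i. mono_lift (ys @ [?h i]) ?h (forms vs) - e ((ys @ [?h i]) @ map H vs)) v \<in> sym_null r"
    by (rule lext_in_subspace[OF N], rule Cons.IH) (use Cons.prems h i in auto)
  have 3: "lext (\<lambda>i. e (ys @ ?h i # map H vs)) v - e (ys @ H v # map H vs) \<in> sym_null r"
    by (rule sym_null_expand) (use Cons.prems H_cl in auto)
  have "mono_lift ys ?h (forms (v # vs)) = lext (\<lambda>i. mono_lift ys ?h (var i * forms vs)) v"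
    unfolding forms_simps linform_def
    by (rule lin_lext_comp[OF lin_comp[OF lin_mono_lift lin_mult_right]])
  with pm.subspace_add[OF N pm.subspace_add[OF N 1 2] 3] show ?case
    by (simp add: lext_diff)
qed

end

end


section \<open>The permutation module and the Specht module\<close>

definition vec_act :: "(nat \<Rightarrow> nat) \<Rightarrow> (nat \<Rightarrow>\<^sub>0 'k::field) \<Rightarrow> (nat \<Rightarrow>\<^sub>0 'k)"
  where "vec_act \<sigma> = lext (\<lambda>i. Poly_Mapping.single (\<sigma> i) 1)"

lemma lin_vec_act: "lin (vec_act \<sigma>)"
  unfolding vec_act_def by (rule lin_lext)

lemma vec_act_single: "vec_act \<sigma> (Poly_Mapping.single i 1) = Poly_Mapping.single (\<sigma> i) 1"
  by (simp add: vec_act_def)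

lemma perm_module_eq: "perm_module K n = sub_rep (perm_space n) vec_act"
  by (simp add: perm_module_def free_rep_eq vec_act_def[abs_def])

lemma specht_module_eq: "specht_module K n = sub_rep (specht_space n) vec_act"
  by (simp add: specht_module_def perm_module_eq specht_space_def aug_def) (simp add: sub_rep_def)

lemma lookup_vec_act:
  assumes "\<sigma> permutes {1..n}"
  shows "Poly_Mapping.lookup (vec_act \<sigma> v) (\<sigma> i) = Poly_Mapping.lookup v i"
proof -
  have "Poly_Mapping.lookup (vec_act \<sigma> v) (\<sigma> i) =
      (\<Sum>j\<in>Poly_Mapping.keys v. if j = i then Poly_Mapping.lookup v j else 0)"
    unfolding vec_act_def lext_def lookup_sum
    by (rule sum.cong) (auto simp: lookup_single when_def inj_eq[OF permutes_inj[OF assms]])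
  then show ?thesis by (simp add: in_keys_iff)
qed

lemma vec_act_perm_space:
  assumes "\<sigma> permutes {1..n}" "v \<in> perm_space n"
  shows "vec_act \<sigma> v \<in> perm_space n"
  unfolding vec_act_def
proof (rule lext_in_subspace[OF subspace_perm_space])
  fix i assume "i \<in> Poly_Mapping.keys v"
  then have "\<sigma> i \<in> {1..n}" using assms permutes_in_image[OF assms(1), of i] by blast
  then show "Poly_Mapping.single (\<sigma> i) 1 \<in> perm_space n" by simp
qed

lemma aug_vec_act:
  assumes "\<sigma> permutes {1..n}"
  shows "aug n (vec_act \<sigma> v) = aug n v"
  unfolding aug_def
  using sum_permutes[OF assms, of "Poly_Mapping.lookup (vec_act \<sigma> v)"]
  unfolding lookup_vec_act[OF assms] by simp

lemma vec_act_specht_space: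
  assumes "\<sigma> permutes {1..n}" "v \<in> specht_space n"
  shows "vec_act \<sigma> v \<in> specht_space n"
  using assms vec_act_perm_space[OF assms(1), of v] aug_vec_act[OF assms(1), of v] by (simp add: specht_space_def)

lemma linform_vec_act: "linform (vec_act \<sigma> v) = perm_act \<sigma> (linform v)"
  by (rule lin_eqI[OF lin_comp[OF lin_linform lin_vec_act] lin_comp[OF lin_perm_act lin_linform]])
    (simp add: vec_act_single linform_single perm_act_var)

lemma forms_vec_act: "forms (map (vec_act \<sigma>) vs) = perm_act \<sigma> (forms vs)"
  by (induction vs) (simp_all add: linform_vec_act perm_act_mult perm_act_one)

lemma lin_action_sub_rep:
  assumes "pm.subspace W" "\<And>g. g \<in> carrier G \<Longrightarrow> lin (a g)"
    and "\<And>g x. g \<in> carrier G \<Longrightarrow> x \<in> W \<Longrightarrow> a g x \<in> W"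
  shows "lin_action G (sub_rep W a)"
  by unfold_locales
    (simp_all add: assms pm.subspace_add[OF assms(1)] pm.subspace_scale[OF assms(1)] pm.linear_add pm.linear_scale)

lemma lin_action_perm: "lin_action (sym_group n) (sub_rep (perm_space n) vec_act)"
  by (rule lin_action_sub_rep[OF subspace_perm_space lin_vec_act])
    (rule vec_act_perm_space, simp_all add: sym_group_carrier)

lemma lin_action_specht: "lin_action (sym_group n) (sub_rep (specht_space n) vec_act)"
  by (rule lin_action_sub_rep[OF subspace_specht_space lin_vec_act])
    (rule vec_act_specht_space, simp_all add: sym_group_carrier)

lemma fd_rep_poly:
  assumes W: "pm.subspace W" "W \<subseteq> hom_poly n r"
    and "\<And>\<sigma> f. \<sigma> permutes {1..n} \<Longrightarrow> f \<in> W \<Longrightarrow> perm_act \<sigma> f \<in> W"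
  shows "fd_rep (sym_group n) (sub_rep W perm_act)"
proof (rule fd_rep_sub_rep[OF sym_group_is_group W(1)])
  show "finite ((\<lambda>m. Poly_Mapping.single m (1::'a)) ` monoms n r)"
    by (rule finite_imageI[OF finite_monoms])
  show "W \<subseteq> pm.span ((\<lambda>m. Poly_Mapping.single m 1) ` monoms n r)"
    using W(2) unfolding hom_poly_span .
qed (simp_all add: assms sym_group_carrier sym_group_one sym_group_mult perm_act_id perm_act_comp
    pm.linear_add[OF lin_perm_act] pm.linear_scale[OF lin_perm_act])

lemma forms_replace_add: "forms (xs @ (u + v) # ys) = forms (xs @ u # ys) + forms (xs @ v # ys)"
  by (simp add: pm.linear_add[OF lin_linform] algebra_simps)

lemma forms_replace_scl: "forms (xs @ scl c u # ys) = scl c (forms (xs @ u # ys))"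
  by (simp add: pm.linear_scale[OF lin_linform])

text \<open>The projection \<open>H\<close> of the permutation module onto \<open>U\<close> need not be equivariant.\<close>

lemma Sym_sub_rep_iso:
  fixes U :: "(nat \<Rightarrow>\<^sub>0 'k::field) set"
  assumes act: "lin_action (sym_group n) (sub_rep U vec_act)"
    and U: "U \<subseteq> perm_space n" and W: "pm.subspace W" "W = pm.span (forms ` {vs. set vs \<subseteq> U \<and> length vs = r})"
    and H: "lin H" "\<And>v. v \<in> perm_space n \<Longrightarrow> H v \<in> U" "\<And>v. v \<in> U \<Longrightarrow> H v = v"
  shows "rep_iso (sym_group n) (sub_rep W perm_act) (Sym r (sub_rep U vec_act))"
proof -
  interpret lin_action "sym_group n" "sub_rep U (vec_act :: _ \<Rightarrow> _ \<Rightarrow> nat \<Rightarrow>\<^sub>0 'k)" by (rule act)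
  have vl: "vlists r = {vs. set vs \<subseteq> U \<and> length vs = r}" by (simp add: vlists_def)
  show ?thesis
  proof (rule Sym_iso[OF W(1) lin_perm_act lin_mono_lift])
    show "forms xs \<in> W" if "xs \<in> vlists r" for xs
      using that unfolding W(2) vl by (intro pm.span_base imageI)
    show "W \<subseteq> pm.span (forms ` vlists r)" unfolding W(2) vl ..
    show "mono_lift [] (\<lambda>i. H (Poly_Mapping.single i 1)) (forms xs) - e xs \<in> sym_null r" if "xs \<in> vlists r" for xs
    proof -
      \<comment> \<open>\<open>H\<close> fixes \<open>U\<close>, so the list recovered by
        \<open>mono_lift_forms\<close> is \<open>xs\<close> itself.\<close>
      have "map H xs = xs" using that H(3) by (intro map_idI) (auto simp: vl)
      then show ?thesis
        using mono_lift_forms[of n H "[]" xs r] that U H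
        by (auto simp: vl pm.linear_add pm.linear_scale)
    qed
    show "forms (map (act (sub_rep U vec_act) g) xs) = perm_act g (forms xs)" for g xs
      by (simp add: forms_vec_act)
  qed (simp_all only: sub_rep_simps forms_replace_add forms_replace_scl, rule forms_mset)
qed

lemma hom_poly_forms_span: "hom_poly n r = pm.span (forms ` {vs. set vs \<subseteq> perm_space n \<and> length vs = r})"
proof (rule equalityI)
  show "hom_poly n r \<subseteq> pm.span (forms ` {vs. set vs \<subseteq> perm_space n \<and> length vs = r})"
  proof (rule hom_poly_subsetI[OF pm.subspace_span])
    fix m assume m: "m \<in> monoms n r"
    then have "length (sorted_list_of_multiset m) = r" by (simp add: monoms_def flip: size_mset)
    then show "Poly_Mapping.single m 1 \<in> pm.span (forms ` {vs. set vs \<subseteq> perm_space n \<and> length vs = r})"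
      unfolding single_eq_forms using m by (intro pm.span_base imageI) (auto simp: monoms_def)
  qed
  show "pm.span (forms ` {vs. set vs \<subseteq> perm_space n \<and> length vs = r}) \<subseteq> hom_poly n r"
    by (rule pm.span_minimal[OF _ subspace_hom_poly]) (use forms_hom_poly in blast)
qed

lemma Sym_perm_iso:
  "rep_iso (sym_group n) (sub_rep (hom_poly n r) perm_act) (Sym r (perm_module K n))"
  unfolding perm_module_eq
  by (rule Sym_sub_rep_iso[OF lin_action_perm subset_refl subspace_hom_poly hom_poly_forms_span pm.linear_ident]) auto

text \<open>The projection along \<open>x_n\<close>. Unlike the invariant line through the sum of
  all basis vectors, the line of \<open>x_n\<close> is a complement even when \<open>n\<close> is
  zero in the field.\<close>

definition specht_proj :: "nat \<Rightarrow> (nat \<Rightarrow>\<^sub>0 'k::field) \<Rightarrow> (nat \<Rightarrow>\<^sub>0 'k)"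
  where "specht_proj n v = v - scl (aug n v) (Poly_Mapping.single n 1)"

lemma lin_specht_proj: "lin (specht_proj n)"
  by (rule linI)
    (simp_all add: specht_proj_def pm.scale_left_distrib pm.scale_right_diff_distrib del: scl_single)

lemma specht_proj_in:
  assumes "1 \<le> n" "v \<in> perm_space n"
  shows "specht_proj n v \<in> specht_space n"
  using assms pm.subspace_diff[OF subspace_perm_space assms(2) pm.subspace_scale[OF subspace_perm_space, of "Poly_Mapping.single n 1"]]
  by (simp add: specht_space_def specht_proj_def del: scl_single)

lemma specht_proj_id: "v \<in> specht_space n \<Longrightarrow> specht_proj n v = v"
  by (simp add: specht_proj_def specht_space_def del: scl_single)

lemma Sym_specht_iso:
  fixes K :: "'k::field itself"
  assumes "1 \<le> n" "(of_nat (fact r) :: 'k) \<noteq> 0"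
  shows "rep_iso (sym_group n) (sub_rep (ker_poly n r) perm_act) (Sym r (specht_module K n))"
  unfolding specht_module_eq
proof (rule Sym_sub_rep_iso[OF lin_action_specht _ subspace_ker_poly _ lin_specht_proj[of n]])
  show "(ker_poly n r :: 'k mvpoly set) = pm.span (forms ` {vs. set vs \<subseteq> specht_space n \<and> length vs = r})"
    using ker_poly_eq_form_span[OF assms] by (simp only: form_span_def)
qed (use specht_proj_in[OF assms(1)] specht_proj_id in \<open>auto simp: specht_space_def\<close>)

text \<open>Serves both splittings: with \<open>dirdiff n\<close> and its section, and with
  \<open>ker_ret\<close> as \<open>\<pi>\<close> and multiplication by \<open>varsum n\<close> as
  \<open>\<iota>\<close>. In the second case the kernel of \<open>\<pi>\<close> stands in for the
  quotient by the image of \<open>\<iota>\<close>.\<close>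

lemma split_iso:
  fixes X :: "('s \<Rightarrow>\<^sub>0 'k::field) set" and Y :: "('t \<Rightarrow>\<^sub>0 'k) set"
  assumes X: "pm.subspace X" and \<pi>: "lin \<pi>" "\<And>x. x \<in> X \<Longrightarrow> \<pi> x \<in> Y"
    and \<iota>: "lin \<iota>" "\<And>y. y \<in> Y \<Longrightarrow> \<iota> y \<in> X" "\<And>y. y \<in> Y \<Longrightarrow> \<pi> (\<iota> y) = y"
    and a: "\<And>g. g \<in> carrier G \<Longrightarrow> lin (a g)"
    and eqv: "\<And>g x. g \<in> carrier G \<Longrightarrow> x \<in> X \<Longrightarrow> \<pi> (a g x) = b g (\<pi> x)"
      "\<And>g y. g \<in> carrier G \<Longrightarrow> y \<in> Y \<Longrightarrow> \<iota> (b g y) = a g (\<iota> y)"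
  shows "rep_iso G (sub_rep X a) (dsum_rep (sub_rep {x \<in> X. \<pi> x = 0} a) (sub_rep Y b))"
  unfolding rep_iso_def
proof (intro bexI[of _ "\<lambda>x. (x - \<iota> (\<pi> x), \<pi> x)"] conjI ballI)
  show "bij_betw (\<lambda>x. (x - \<iota> (\<pi> x), \<pi> x)) (carrier (sub_rep X a))
      (carrier (dsum_rep (sub_rep {x \<in> X. \<pi> x = 0} a) (sub_rep Y b)))"
    by (rule bij_betw_byWitness[of _ "\<lambda>(x, y). x + \<iota> y"])
      (auto simp: \<pi>(2) \<iota>(2,3) pm.linear_diff[OF \<pi>(1)] pm.linear_add[OF \<pi>(1)]
        intro: pm.subspace_diff[OF X] pm.subspace_add[OF X])
  show "(\<lambda>x. (x - \<iota> (\<pi> x), \<pi> x)) \<in> LinearCombinations.module_hom class_ring (sub_rep X a)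
      (dsum_rep (sub_rep {x \<in> X. \<pi> x = 0} a) (sub_rep Y b))"
    by (auto simp: LinearCombinations.module_hom_def \<pi>(2) \<iota>(2,3) pm.linear_diff[OF \<pi>(1)]
        pm.linear_add[OF \<pi>(1)] pm.linear_add[OF \<iota>(1)] pm.linear_scale[OF \<pi>(1)] pm.linear_scale[OF \<iota>(1)]
        pm.scale_right_diff_distrib pm.subspace_diff[OF X])
qed (simp add: eqv \<pi>(2) pm.linear_diff[OF a])


section \<open>The quotient module \<open>D\<close>\<close>

lemma lin_action_quot:
  fixes W N :: "('s \<Rightarrow>\<^sub>0 'k::field) set"
  assumes W: "pm.subspace W" and N: "pm.subspace N"
    and a: "\<And>g. g \<in> carrier G \<Longrightarrow> lin (a g)"
    and st: "\<And>g x. g \<in> carrier G \<Longrightarrow> x \<in> W \<Longrightarrow> a g x \<in> W" "\<And>g x. g \<in> carrier G \<Longrightarrow> x \<in> N \<Longrightarrow> a g x \<in> N"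
  shows "lin_action G (quot_rep (sub_rep W a) N)"
    and "g \<in> carrier G \<Longrightarrow> act (quot_rep (sub_rep W a) N) g (N +>\<^bsub>sub_rep W a\<^esub> x) = N +>\<^bsub>sub_rep W a\<^esub> a g x"
proof -
  let ?c = "\<lambda>x. N +>\<^bsub>sub_rep W a\<^esub> x"
  have act_c: "(\<Union>y\<in>?c x. ?c (a g y)) = ?c (a g x)" if "g \<in> carrier G" for g x
    by (rule Union_cst[OF N]) (simp add: st(2)[OF that] flip: pm.linear_diff[OF a[OF that]])
  let ?Q = "quot_rep (sub_rep W a) N"
  have Q: "\<exists>x\<in>W. u = ?c x" if "u \<in> carrier ?Q" for u
    using that by (auto simp: cst_rcosets[OF N])
  have simps: "?c x \<oplus>\<^bsub>?Q\<^esub> ?c y = ?c (x + y)" "c \<odot>\<^bsub>?Q\<^esub> ?c x = ?c (scl c x)"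
    "g \<in> carrier G \<Longrightarrow> act ?Q g (?c x) = ?c (a g x)" "x \<in> W \<Longrightarrow> ?c x \<in> carrier ?Q" for x y c g
    by (simp_all add: cst_add[OF N] cst_smult[OF N] act_c cst_rcosets[OF N])
  show "lin_action G ?Q"
  proof unfold_locales
    fix u assume "u \<in> carrier ?Q"
    then obtain x where x: "x \<in> W" "u = ?c x" using Q by blast
    show "c \<odot>\<^bsub>?Q\<^esub> u \<in> carrier ?Q" for c
      unfolding x simps by (intro simps pm.subspace_scale[OF W] x)
    fix g assume g: "g \<in> carrier G"
    show "act ?Q g u \<in> carrier ?Q"
      unfolding x simps(3)[OF g] by (intro simps st g x)
    show "act ?Q g (c \<odot>\<^bsub>?Q\<^esub> u) = c \<odot>\<^bsub>?Q\<^esub> act ?Q g u" for c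
      unfolding x by (simp only: simps g pm.linear_scale[OF a[OF g]])
  next
    fix u v assume "u \<in> carrier ?Q" "v \<in> carrier ?Q"
    then obtain x y where xy: "x \<in> W" "u = ?c x" "y \<in> W" "v = ?c y" using Q by meson
    show "u \<oplus>\<^bsub>?Q\<^esub> v \<in> carrier ?Q"
      unfolding xy simps by (intro simps pm.subspace_add[OF W] xy)
    show "act ?Q g (u \<oplus>\<^bsub>?Q\<^esub> v) = act ?Q g u \<oplus>\<^bsub>?Q\<^esub> act ?Q g v" if g: "g \<in> carrier G" for g
      unfolding xy by (simp only: simps g pm.linear_add[OF a[OF g]])
  qed
  show "g \<in> carrier G \<Longrightarrow> act (quot_rep (sub_rep W a) N) g (?c x) = ?c (a g x)"
    by (simp add: act_c)
qed

declare quot_rep_simps [simp del]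

definition ones :: "nat \<Rightarrow> (nat \<Rightarrow>\<^sub>0 'k::field)"
  where "ones n = (\<Sum>i=1..n. Poly_Mapping.single i 1)"

lemma linform_ones: "linform (ones n) = varsum n"
  by (simp add: ones_def varsum_def pm.linear_sum[OF lin_linform] linform_single)

lemma ones_perm_space: "ones n \<in> perm_space n"
  unfolding ones_def by (intro pm.subspace_sum[OF subspace_perm_space]) auto

lemma aug_ones: "aug n (ones n) = of_nat n"
  by (simp add: aug_def ones_def lookup_sum lookup_single when_def)

lemma vec_act_ones:
  assumes "\<sigma> permutes {1..n}"
  shows "vec_act \<sigma> (ones n) = ones n"
  unfolding ones_def
  by (simp only: pm.linear_sum[OF lin_vec_act] vec_act_single
      sum_permutes[OF assms, of "\<lambda>i. Poly_Mapping.single i 1"])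

text \<open>One factor is exchanged at a time, by
  \<open>u f - v f' = (u - v) f + v (f - f')\<close>, and \<open>linform\<close> turns a multiple of
  \<open>ones n\<close> into one of \<open>varsum n\<close>. The clause for \<open>[]\<close> takes
  care of the truncated \<open>length us - 1\<close>.\<close>

lemma forms_diff_varsum:
  assumes "list_all2 (\<lambda>u v. u \<in> specht_space n \<and> v \<in> specht_space n \<and> u - v \<in> pm.span {ones n}) us vs"
  shows "\<exists>g \<in> ker_poly n (length us - 1). (us = [] \<longrightarrow> g = 0) \<and> forms us - forms vs = varsum n * g"
  using assms
proof (induction rule: list_all2_induct)
  case Nil
  then show ?case by (intro bexI[of _ 0]) (auto simp: pm.subspace_0[OF subspace_ker_poly])
next
  case (Cons u us v vs)
  obtain g where g: "g \<in> ker_poly n (length us - 1)" "us = [] \<longrightarrow> g = 0" "forms us - forms vs = varsum n * g"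
    using Cons.IH by blast
  obtain c where c: "u - v = scl c (ones n)"
    using Cons.hyps by (auto simp: pm.span_singleton)
  have us: "set us \<subseteq> specht_space n"
    using Cons.hyps by (auto simp: list_all2_conv_all_nth set_conv_nth)
  have "linform v * g \<in> ker_poly n (length us)"
    using ker_poly_mult_linform[of v n g "length us - 1"] g Cons.hyps
    by (cases us) (auto simp: pm.subspace_0[OF subspace_ker_poly])
  moreover have "scl c (forms us) \<in> ker_poly n (length us)"
    by (intro pm.subspace_scale[OF subspace_ker_poly] forms_ker_poly us)
  ultimately have "scl c (forms us) + linform v * g \<in> ker_poly n (length us)"
    by (intro pm.subspace_add[OF subspace_ker_poly])
  moreover have "forms (u # us) - forms (v # vs) = linform (u - v) * forms us + linform v * (forms us - forms vs)"
    by (simp add: pm.linear_diff[OF lin_linform] algebra_simps)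
  then have "forms (u # us) - forms (v # vs) = varsum n * (scl c (forms us) + linform v * g)"
    by (simp add: c g(3) pm.linear_scale[OF lin_linform] linform_ones algebra_simps)
  ultimately show ?case by (intro bexI[of _ "scl c (forms us) + linform v * g"]) auto
qed

text \<open>Under the hypotheses of \<open>ker_split_iso\<close> this is a stable complement of
  \<open>varsum n * ker_poly n (Suc k)\<close> in \<open>ker_poly n (Suc (Suc k))\<close>. It
  replaces the quotient, so that the symmetric power of \<open>D\<close> has a model made of
  polynomials too.\<close>

definition D_poly :: "nat \<Rightarrow> nat \<Rightarrow> 'k::field mvpoly set"
  where "D_poly n k = {f \<in> ker_poly n (Suc (Suc k)). ker_ret n k f = 0}"

lemma subspace_D_poly: "pm.subspace (D_poly n k)"
  unfolding D_poly_def Collect_conj_eq Collect_mem_eq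
  by (intro pm.subspace_inter subspace_ker_poly pm.linear_subspace_kernel lin_ker_ret)

lemma perm_act_D_poly:
  assumes "\<sigma> permutes {1..n}" "f \<in> D_poly n k"
  shows "perm_act \<sigma> f \<in> D_poly n k"
  using assms perm_act_ker_ret[OF assms(1), of k f] perm_act_ker_poly[OF assms(1), of f]
  by (simp add: D_poly_def pm.linear_0[OF lin_perm_act])

locale specht_quot =
  fixes K :: "'k::field itself" and n k :: nat
  assumes n: "1 \<le> n" and n0: "(of_nat n :: 'k) = 0"
    and k: "0 < k" and inv: "(of_nat (fact (Suc (Suc k))) :: 'k) \<noteq> 0"
begin

abbreviation U :: "(nat \<Rightarrow>\<^sub>0 'k) set" where "U \<equiv> pm.span {ones n}"
abbreviation S :: "(nat \<Rightarrow> nat, 'k, nat \<Rightarrow>\<^sub>0 'k) rep" where "S \<equiv> sub_rep (specht_space n) vec_act"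

definition coset :: "(nat \<Rightarrow>\<^sub>0 'k) \<Rightarrow> (nat \<Rightarrow>\<^sub>0 'k) set"
  where "coset v = U +>\<^bsub>S\<^esub> v"

lemma ones_specht: "(ones n :: nat \<Rightarrow>\<^sub>0 'k) \<in> specht_space n"
  unfolding specht_space_def by (intro CollectI conjI ones_perm_space) (simp add: aug_ones n0)

lemma D_module_eq: "D_module K n = quot_rep S U"
  unfolding D_module_def specht_module_eq ones_def[symmetric]
  by (simp add: span_in_sub_rep[OF subspace_specht_space] ones_specht)

lemma U_act:
  assumes "\<sigma> permutes {1..n}" "v \<in> U"
  shows "vec_act \<sigma> v \<in> U"
  using assms by (auto simp: pm.span_singleton pm.linear_scale[OF lin_vec_act] vec_act_ones)

lemma lin_action_D: "lin_action (sym_group n) (quot_rep S U)"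
  and act_coset: "g \<in> carrier (sym_group n) \<Longrightarrow> act (quot_rep S U) g (coset v) = coset (vec_act g v)"
  unfolding coset_def
  by (rule lin_action_quot[where G = "sym_group n", OF subspace_specht_space pm.subspace_span lin_vec_act];
      simp add: vec_act_specht_space U_act sym_group_carrier)+

lemma carrier_D: "carrier (quot_rep S U) = coset ` specht_space n"
  unfolding coset_def by (simp add: quot_rep_simps cst_rcosets)

lemma coset_eq_iff: "coset u = coset v \<longleftrightarrow> u - v \<in> U"
  unfolding coset_def by (rule cst_eq_iff) (rule pm.subspace_span)

lemma add_coset: "coset u \<oplus>\<^bsub>quot_rep S U\<^esub> coset v = coset (u + v)"
  unfolding coset_def by (simp add: quot_rep_simps cst_add)

lemma smult_coset: "c \<odot>\<^bsub>quot_rep S U\<^esub> coset v = coset (scl c v)"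
  unfolding coset_def by (simp add: quot_rep_simps cst_smult)

definition repr :: "(nat \<Rightarrow>\<^sub>0 'k) set \<Rightarrow> (nat \<Rightarrow>\<^sub>0 'k)"
  where "repr A = (SOME v. v \<in> specht_space n \<and> coset v = A)"

lemma repr:
  assumes "v \<in> specht_space n"
  shows "repr (coset v) \<in> specht_space n" "repr (coset v) - v \<in> U"
proof -
  have "repr (coset v) \<in> specht_space n \<and> coset (repr (coset v)) = coset v"
    unfolding repr_def by (rule someI[of _ v]) (use assms in simp)
  then show "repr (coset v) \<in> specht_space n" "repr (coset v) - v \<in> U" by (simp_all add: coset_eq_iff)
qed

text \<open>On \<open>ker_poly n (Suc (Suc k))\<close>, the projection onto
  \<open>D_poly n k\<close> along \<open>varsum n * ker_poly n (Suc k)\<close>.\<close>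

definition cut :: "'k mvpoly \<Rightarrow> 'k mvpoly"
  where "cut f = f - varsum n * ker_ret n k f"

text \<open>The representatives chosen by \<open>repr\<close> need not depend linearly on the coset;
  \<open>cut\<close> is applied to remove the error that this causes in the product.\<close>

definition D_form :: "(nat \<Rightarrow>\<^sub>0 'k) set list \<Rightarrow> 'k mvpoly"
  where "D_form As = cut (forms (map repr As))"

lemma lin_cut: "lin cut"
  unfolding cut_def by (intro pm.linear_compose_sub pm.linear_ident lin_comp[OF lin_mult_left] lin_ker_ret)

lemma ker_polyD: "f \<in> ker_poly n r \<Longrightarrow> f \<in> hom_poly n r"
  by (simp add: ker_poly_def)

lemma cut_varsum: "g \<in> ker_poly n (Suc k) \<Longrightarrow> cut (varsum n * g) = 0"
  by (simp add: cut_def ker_ret_mult[OF k inv])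

lemma cut_D_poly: "f \<in> D_poly n k \<Longrightarrow> cut f = f"
  by (simp add: cut_def D_poly_def)

lemma cut_in:
  assumes "f \<in> ker_poly n (Suc (Suc k))"
  shows "cut f \<in> D_poly n k"
proof -
  have q: "ker_ret n k f \<in> ker_poly n (Suc k)" by (rule ker_ret_in[OF k inv ker_polyD[OF assms]])
  then have "cut f \<in> ker_poly n (Suc (Suc k))"
    unfolding cut_def by (intro pm.subspace_diff[OF subspace_ker_poly] assms varsum_mult_ker_poly n0)
  moreover have "ker_ret n k (cut f) = 0"
    unfolding cut_def by (simp add: pm.linear_diff[OF lin_ker_ret] ker_ret_mult[OF k inv q])
  ultimately show ?thesis by (simp add: D_poly_def)
qed

text \<open>A change of representatives alters the product by \<open>varsum n * g\<close> with
  \<open>g\<close> in the kernel, which \<open>cut\<close> sends to zero. Multilinearity of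
  \<open>D_form\<close> is then inherited from \<open>forms\<close>.\<close>

lemma D_form_coset:
  assumes "set vs \<subseteq> specht_space n" "length vs = Suc (Suc k)"
  shows "D_form (map coset vs) = cut (forms vs)"
proof -
  have "list_all2 (\<lambda>u v. u \<in> specht_space n \<and> v \<in> specht_space n \<and> u - v \<in> U) (map (\<lambda>v. repr (coset v)) vs) vs"
    using assms(1) repr by (auto simp: list_all2_conv_all_nth subset_iff)
  from forms_diff_varsum[OF this] obtain g where "g \<in> ker_poly n (Suc k)"
    "forms (map (\<lambda>v. repr (coset v)) vs) - forms vs = varsum n * g"
    using assms(2) by auto
  then have "cut (forms (map (\<lambda>v. repr (coset v)) vs) - forms vs) = 0" by (simp add: cut_varsum)
  then show ?thesis by (simp add: D_form_def o_def pm.linear_diff[OF lin_cut])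
qed

lemma coset_list: "set As \<subseteq> coset ` specht_space n \<Longrightarrow> \<exists>vs. set vs \<subseteq> specht_space n \<and> As = map coset vs"
proof (induction As)
  case (Cons A As)
  then obtain vs v where "set vs \<subseteq> specht_space n" "As = map coset vs" "v \<in> specht_space n" "A = coset v" by auto
  then show ?case by (intro exI[of _ "v # vs"]) simp
qed simp

lemma forms_specht_ker: "set vs \<subseteq> specht_space n \<Longrightarrow> length vs = r \<Longrightarrow> forms vs \<in> ker_poly n r"
  using forms_ker_poly by blast

text \<open>An application of \<open>Sym_iso\<close> with \<open>D_form\<close> as
  \<open>\<beta>\<close>. The new point compared with \<open>S\<close> is that \<open>cut\<close>
  subtracts a multiple of \<open>varsum n\<close>, whose lift has to be a consequence of the
  relations; \<open>t_varsum\<close> provides this.\<close>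

lemma Sym_D_iso:
  "rep_iso (sym_group n) (sub_rep (D_poly n k) perm_act) (Sym (Suc (Suc k)) (D_module K n))"
proof -
  let ?r = "Suc (Suc k)"
  let ?V = "quot_rep S U"
  interpret lin_action "sym_group n" ?V by (rule lin_action_D)
  have vlE: "\<exists>vs. set vs \<subseteq> specht_space n \<and> As = map coset vs \<and> length vs = ?r" if "As \<in> vlists ?r" for As
    using coset_list[of As] that by (auto simp: vlists_def carrier_D)
  have vl_iff: "map coset vs \<in> vlists ?r" if "set vs \<subseteq> specht_space n" "length vs = ?r" for vs
    using that by (auto simp: vlists_def carrier_D)
  have split: "\<exists>us v ws. xs = map coset us \<and> B = coset v \<and> ys = map coset ws \<and> set us \<subseteq> specht_space n
      \<and> v \<in> specht_space n \<and> set ws \<subseteq> specht_space n \<and> length us + Suc (length ws) = ?r"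
    if "xs @ B # ys \<in> vlists ?r" for xs B ys
  proof -
    have *: "set xs \<subseteq> coset ` specht_space n" "set ys \<subseteq> coset ` specht_space n"
      "B \<in> coset ` specht_space n" "length xs + Suc (length ys) = ?r"
      using that by (auto simp: vlists_def carrier_D)
    obtain us where us: "set us \<subseteq> specht_space n" "xs = map coset us" using coset_list[OF *(1)] by blast
    obtain ws where ws: "set ws \<subseteq> specht_space n" "ys = map coset ws" using coset_list[OF *(2)] by blast
    obtain v where v: "v \<in> specht_space n" "B = coset v" using *(3) by blast
    show ?thesis
      by (rule exI[of _ us], rule exI[of _ v], rule exI[of _ ws]) (use us ws v *(4) in simp)
  qed
  define H where "H v = coset (specht_proj n v)" for v
  have H_cl: "H v \<in> carrier ?V" if "v \<in> perm_space n" for v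
    unfolding H_def carrier_D by (intro imageI specht_proj_in[OF n that])
  have H_add: "H (u + v) = H u \<oplus>\<^bsub>?V\<^esub> H v" for u v
    unfolding H_def add_coset pm.linear_add[OF lin_specht_proj] ..
  have H_smult: "H (scl c v) = c \<odot>\<^bsub>?V\<^esub> H v" for c v
    unfolding H_def smult_coset pm.linear_scale[OF lin_specht_proj] ..
  let ?t = "mono_lift [] (\<lambda>i. H (Poly_Mapping.single i 1))"
  have t_forms: "?t (forms vs) - e (map H vs) \<in> sym_null ?r" if "set vs \<subseteq> perm_space n" "length vs = ?r" for vs
    using mono_lift_forms[of n H "[]" vs ?r] H_cl H_add H_smult that by simp
  have t_varsum: "?t (varsum n * g) \<in> sym_null ?r" if "g \<in> hom_poly n (Suc k)" for g
  proof -
    have "hom_poly n (Suc k) \<subseteq> {g. ?t (varsum n * g) \<in> sym_null ?r}"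
      unfolding hom_poly_forms_span
    proof (rule pm.span_minimal)
      show "pm.subspace {g. ?t (varsum n * g) \<in> sym_null ?r}"
        by (intro pm.linear_subspace_linear_preimage lin_comp[OF lin_mono_lift lin_mult_left] subspace_sym_null)
      show "forms ` {vs. set vs \<subseteq> perm_space n \<and> length vs = Suc k} \<subseteq> {g. ?t (varsum n * g) \<in> sym_null ?r}"
      proof clarify
        fix vs :: "(nat \<Rightarrow>\<^sub>0 'k) list" assume vs: "set vs \<subseteq> perm_space n" "length vs = Suc k"
        \<comment> \<open>\<open>ones n\<close> lies in the Specht module because \<open>n\<close>
          is zero in the field, so the projection fixes it and its coset is zero. Writing that coset
          as \<open>0\<close> times a coset makes the scalar relation applicable.\<close>
        have "H (ones n) = coset (ones n)" by (simp add: H_def specht_proj_id ones_specht)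
        also have "\<dots> = coset 0" by (simp add: coset_eq_iff pm.span_base)
        also have "\<dots> = 0 \<odot>\<^bsub>?V\<^esub> coset 0" by (simp add: smult_coset)
        finally have H0: "H (ones n) = 0 \<odot>\<^bsub>?V\<^esub> coset 0" .
        have "[] @ coset 0 # map H vs \<in> vlists ?r"
          using vs H_cl imageI[OF pm.subspace_0[OF subspace_specht_space], of coset]
          by (auto simp: vlists_def carrier_D)
        from sym_null_smult[OF this, of 0] have "e (map H (ones n # vs)) \<in> sym_null ?r"
          by (simp add: H0)
        moreover have "?t (forms (ones n # vs)) - e (map H (ones n # vs)) \<in> sym_null ?r"
          by (rule t_forms) (use vs ones_perm_space in auto)
        ultimately have "?t (forms (ones n # vs)) \<in> sym_null ?r"
          using pm.subspace_add[OF subspace_sym_null] by fastforce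
        then show "?t (varsum n * forms vs) \<in> sym_null ?r" by (simp add: linform_ones)
      qed
    qed
    then show ?thesis using that by blast
  qed
  have ker_forms: "(ker_poly n ?r :: 'k mvpoly set) = pm.span (forms ` {vs. set vs \<subseteq> specht_space n \<and> length vs = ?r})"
    using ker_poly_eq_form_span[OF n inv] unfolding form_span_def .
  show ?thesis
    unfolding D_module_eq
  proof (rule Sym_iso[OF subspace_D_poly lin_perm_act lin_mono_lift])
    show "D_form As \<in> D_poly n k" if "As \<in> vlists ?r" for As
      using vlE[OF that] D_form_coset cut_in forms_specht_ker by metis
    show "D_poly n k \<subseteq> pm.span (D_form ` vlists ?r)"
    proof
      fix f :: "'k mvpoly" assume f: "f \<in> D_poly n k"
      then have "f \<in> cut ` ker_poly n ?r"
        using cut_D_poly by (intro image_eqI[of _ _ f]) (auto simp: D_poly_def)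
      also have "\<dots> = pm.span (cut ` forms ` {vs. set vs \<subseteq> specht_space n \<and> length vs = ?r})"
        unfolding ker_forms by (rule pm.linear_span_image[OF lin_cut, symmetric])
      also have "\<dots> \<subseteq> pm.span (D_form ` vlists ?r)"
      proof (rule pm.span_mono, clarify)
        fix vs :: "(nat \<Rightarrow>\<^sub>0 'k) list" assume "set vs \<subseteq> specht_space n" "length vs = ?r"
        then show "cut (forms vs) \<in> D_form ` vlists ?r"
          using D_form_coset vl_iff by (intro image_eqI[of _ _ "map coset vs"]) auto
      qed
      finally show "f \<in> pm.span (D_form ` vlists ?r)" .
    qed
    show "D_form (xs @ (A \<oplus>\<^bsub>?V\<^esub> B) # ys) = D_form (xs @ A # ys) + D_form (xs @ B # ys)"
      if vl: "xs @ A # ys \<in> vlists ?r" and B: "B \<in> carrier ?V" for xs A ys B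
    proof -
      obtain us v ws where *: "xs = map coset us" "A = coset v" "ys = map coset ws" "set us \<subseteq> specht_space n"
        "v \<in> specht_space n" "set ws \<subseteq> specht_space n" "length us + Suc (length ws) = ?r"
        using split[OF vl] by blast
      obtain w where w: "w \<in> specht_space n" "B = coset w" using B by (auto simp: carrier_D)
      have "D_form (map coset (us @ (v + w) # ws)) = D_form (map coset (us @ v # ws)) + D_form (map coset (us @ w # ws))"
        using * w pm.subspace_add[OF subspace_specht_space *(5) w(1)]
        by (subst (1 2 3) D_form_coset) (auto simp: forms_replace_add pm.linear_add[OF lin_cut] simp del: forms_simps)
      then show ?thesis by (simp add: * w add_coset)
    qed
    show "D_form (xs @ (c \<odot>\<^bsub>?V\<^esub> A) # ys) = scl c (D_form (xs @ A # ys))"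
      if vl: "xs @ A # ys \<in> vlists ?r" for xs A ys c
    proof -
      obtain us v ws where *: "xs = map coset us" "A = coset v" "ys = map coset ws" "set us \<subseteq> specht_space n"
        "v \<in> specht_space n" "set ws \<subseteq> specht_space n" "length us + Suc (length ws) = ?r"
        using split[OF vl] by blast
      have "D_form (map coset (us @ scl c v # ws)) = scl c (D_form (map coset (us @ v # ws)))"
        using * pm.subspace_scale[OF subspace_specht_space *(5), of c]
        by (subst (1 2) D_form_coset) (auto simp: forms_replace_scl pm.linear_scale[OF lin_cut] simp del: forms_simps)
      then show ?thesis by (simp add: * smult_coset)
    qed
    \<comment> \<open>A representative depends on the entry and not on its position, so both lists
      of representatives have the same multiset.\<close>
    show "D_form xs = D_form ys" if "mset xs = mset ys" for xs ys
      unfolding D_form_def using that by (intro arg_cong[of _ _ cut] forms_mset) simp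
    show "?t (D_form As) - e As \<in> sym_null ?r" if As: "As \<in> vlists ?r" for As
    proof -
      obtain vs where vs: "set vs \<subseteq> specht_space n" "As = map coset vs" "length vs = ?r"
        using vlE[OF As] by blast
      have "map H vs = As" using vs by (auto simp: H_def specht_proj_id)
      moreover have "?t (forms vs) - e (map H vs) \<in> sym_null ?r"
        by (rule t_forms) (use vs in \<open>auto simp: specht_space_def\<close>)
      \<comment> \<open>What \<open>cut\<close> removes is lifted into the relations, so the lifts
        of \<open>D_form As\<close> and of \<open>forms vs\<close> are congruent.\<close>
      moreover have "?t (varsum n * ker_ret n k (forms vs)) \<in> sym_null ?r"
        by (intro t_varsum ker_polyD ker_ret_in[OF k inv] forms_specht_ker vs)
      ultimately have "?t (forms vs) - e As - ?t (varsum n * ker_ret n k (forms vs)) \<in> sym_null ?r"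
        using pm.subspace_diff[OF subspace_sym_null] by metis
      then show ?thesis
        by (simp add: vs(2) D_form_coset[OF vs(1,3)] cut_def pm.linear_diff[OF lin_mono_lift] algebra_simps)
    qed
    show "D_form (map (act ?V g) As) = perm_act g (D_form As)"
      if g: "g \<in> carrier (sym_group n)" and As: "As \<in> vlists ?r" for g As
    proof -
      obtain vs where vs: "set vs \<subseteq> specht_space n" "As = map coset vs" "length vs = ?r"
        using vlE[OF As] by blast
      have gp: "g permutes {1..n}" using g by (simp add: sym_group_carrier)
      have act_As: "map (act ?V g) As = map coset (map (vec_act g) vs)"
        by (simp add: vs(2) act_coset[OF g])
      have "set (map (vec_act g) vs) \<subseteq> specht_space n"
        using vs(1) vec_act_specht_space[OF gp] by auto
      moreover have "cut (perm_act g f) = perm_act g (cut f)" for f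
        by (simp add: cut_def pm.linear_diff[OF lin_perm_act] perm_act_mult perm_act_varsum[OF gp] perm_act_ker_ret[OF gp])
      ultimately show ?thesis
        unfolding act_As using vs D_form_coset[of "map (vec_act g) vs"] D_form_coset[of vs]
        by (simp add: forms_vec_act)
    qed
  qed
qed

end


section \<open>The splittings\<close>

text \<open>Splits the sequence \<open>0 -> Sym^r S -> Sym^r M -> Sym^(r-1) M -> 0\<close> for
  \<open>r = k + 1\<close>, in which \<open>dirdiff n\<close> is the map onto the last term.\<close>

lemma perm_split_iso:
  fixes K :: "'k::field itself"
  assumes k: "0 < k" and inv: "(of_nat (fact (Suc k)) :: 'k) \<noteq> 0"
  shows "rep_iso (sym_group n) (sub_rep (hom_poly n (Suc k) :: 'k mvpoly set) perm_act)
    (dsum_rep (sub_rep (ker_poly n (Suc k)) perm_act) (sub_rep (hom_poly n k) perm_act))"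
  unfolding ker_poly_def
proof (rule split_iso[OF subspace_hom_poly lin_dirdiff _ lin_dirdiff_sec[of n k]])
  show "dirdiff n f \<in> hom_poly n k" if "f \<in> hom_poly n (Suc k)" for f :: "'k mvpoly"
    by (rule lowering_Suc[OF lowering_dirdiff that])
qed (simp_all add: sym_group_carrier dirdiff_sec_hom_poly dirdiff_dirdiff_sec[OF k inv] lin_perm_act
    perm_act_dirdiff perm_act_dirdiff_sec)

text \<open>Splits the sequence \<open>0 -> Sym^(r-1) S -> Sym^r S -> Sym^r D -> 0\<close> for
  \<open>r = k + 2\<close>, in which multiplication by \<open>varsum n\<close> is the
  inclusion.\<close>

lemma ker_split_iso:
  fixes K :: "'k::field itself"
  assumes k: "0 < k" and inv: "(of_nat (fact (Suc (Suc k))) :: 'k) \<noteq> 0" and n0: "(of_nat n :: 'k) = 0"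
  shows "rep_iso (sym_group n) (sub_rep (ker_poly n (Suc (Suc k)) :: 'k mvpoly set) perm_act)
    (dsum_rep (sub_rep (D_poly n k) perm_act) (sub_rep (ker_poly n (Suc k)) perm_act))"
  unfolding D_poly_def
proof (rule split_iso[OF subspace_ker_poly lin_ker_ret _ lin_mult_left[of "varsum n"]])
  show "ker_ret n k f \<in> ker_poly n (Suc k)" if "f \<in> ker_poly n (Suc (Suc k))" for f :: "'k mvpoly"
    using that by (intro ker_ret_in[OF k inv]) (simp add: ker_poly_def)
qed (simp_all add: sym_group_carrier varsum_mult_ker_poly[OF n0] ker_ret_mult[OF k inv] lin_perm_act
    perm_act_ker_ret perm_act_mult perm_act_varsum)

lemma green_class_eqI:
  assumes "fd_rep G V" "rep_iso G V W"
  shows "green_class G W = green_class G V"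
  unfolding green_class_def iso_class_eq[OF assms] ..

lemma (in abelian_group) add_pow_two: "x \<in> carrier G \<Longrightarrow> [(2::nat)] \<cdot> x = x \<oplus> x"
  by (simp add: numeral_2_eq_2)

theorem proposition3p6:
  fixes K :: "'k::field itself" and p n :: nat
  assumes "prime p" and "CHAR('k) = p" and "n \<ge> 2"
  shows
    "(\<forall>r. 2 \<le> r \<and> r \<le> p - 1 \<longrightarrow>
        green_class (sym_group n) (Sym r (specht_module K n)) =
          green_class (sym_group n) (Sym r (perm_module K n))
          \<ominus>\<^bsub>green_ring K (sym_group n)\<^esub>
          green_class (sym_group n) (Sym (r - 1) (perm_module K n))) \<and>
     (p dvd n \<longrightarrow>
       (\<forall>r. 3 \<le> r \<and> r \<le> p - 1 \<longrightarrow>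
          green_class (sym_group n) (Sym r (D_module K n)) =
            (green_class (sym_group n) (Sym r (perm_module K n))
             \<oplus>\<^bsub>green_ring K (sym_group n)\<^esub>
             green_class (sym_group n) (Sym (r - 2) (perm_module K n)))
            \<ominus>\<^bsub>green_ring K (sym_group n)\<^esub>
            ([(2::nat)] \<cdot>\<^bsub>green_ring K (sym_group n)\<^esub>
             green_class (sym_group n) (Sym (r - 1) (perm_module K n)))))"
proof -
  let ?G = "sym_group n"
  let ?R = "green_ring K ?G"
  \<comment> \<open>The ring depends only on the type \<open>'k\<close>, whereas \<open>K\<close>
    and \<open>TYPE('k)\<close> are different terms.\<close>
  have K: "green_ring K ?G = green_ring TYPE('k) ?G"
    by (simp only: green_ring_def sum_relations_def class_ring_free_def)
  interpret R: abelian_group ?R by (rule abelian_group_green_ring)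
  \<comment> \<open>The prime \<open>p\<close> divides \<open>fact r\<close> only if
    \<open>p \<le> r\<close>; since \<open>p > 0\<close>, the bound \<open>r \<le> p - 1\<close>
    does mean \<open>r < p\<close>.\<close>
  have fact_nz: "(of_nat (fact r) :: 'k) \<noteq> 0" if "r \<le> p - 1" for r
    using that assms(1,2) prime_gt_0_nat[OF assms(1)]
    by (auto simp: of_nat_eq_0_iff_char_dvd prime_dvd_fact_iff simp del: of_nat_fact)
  define A where "A r = green_class ?G (sub_rep (hom_poly n r :: 'k mvpoly set) perm_act)" for r
  define B where "B r = green_class ?G (sub_rep (ker_poly n r :: 'k mvpoly set) perm_act)" for r
  define C where "C k = green_class ?G (sub_rep (D_poly n k :: 'k mvpoly set) perm_act)" for k
  have fdA: "fd_rep ?G (sub_rep (hom_poly n r :: 'k mvpoly set) perm_act)" for r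
    by (rule fd_rep_poly[OF subspace_hom_poly subset_refl]) (rule perm_act_hom_poly)
  have fdB: "fd_rep ?G (sub_rep (ker_poly n r :: 'k mvpoly set) perm_act)" for r
    by (rule fd_rep_poly[OF subspace_ker_poly _ perm_act_ker_poly]) (auto simp: ker_poly_def)
  have fdC: "fd_rep ?G (sub_rep (D_poly n k :: 'k mvpoly set) perm_act)" for k
    by (rule fd_rep_poly[OF subspace_D_poly _ perm_act_D_poly]) (auto simp: D_poly_def ker_poly_def)
  have carr: "A r \<in> carrier ?R" "B r \<in> carrier ?R" "C r \<in> carrier ?R" for r
    unfolding A_def B_def C_def K by (intro green_class_closed fdA fdB fdC)+
  have symA: "green_class ?G (Sym r (perm_module K n)) = A r" for r
    unfolding A_def by (rule green_class_eqI[OF fdA Sym_perm_iso])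
  have symB: "green_class ?G (Sym r (specht_module K n)) = B r" if "r \<le> p - 1" for r
    unfolding B_def using assms(3) by (intro green_class_eqI[OF fdB Sym_specht_iso] fact_nz that) simp
  have AB: "A (Suc k) = B (Suc k) \<oplus>\<^bsub>?R\<^esub> A k" if "0 < k" "Suc k \<le> p - 1" for k
    unfolding A_def B_def K by (intro green_class_add fdA fdB perm_split_iso that fact_nz)
  have part1: "B (Suc k) = A (Suc k) \<ominus>\<^bsub>?R\<^esub> A k" if "0 < k" "Suc k \<le> p - 1" for k
    unfolding AB[OF that] by (simp add: R.minus_eq R.a_assoc R.r_neg carr)
  have part2: "green_class ?G (Sym (Suc (Suc k)) (D_module K n)) =
      (A (Suc (Suc k)) \<oplus>\<^bsub>?R\<^esub> A k) \<ominus>\<^bsub>?R\<^esub> ([(2::nat)] \<cdot>\<^bsub>?R\<^esub> A (Suc k))"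
    if hk: "0 < k" "Suc (Suc k) \<le> p - 1" and hn: "p dvd n" for k
  proof -
    have n0: "(of_nat n :: 'k) = 0" using hn assms(2) by (simp add: of_nat_eq_0_iff_char_dvd)
    interpret specht_quot K n k
      by unfold_locales (use assms(3) n0 hk(1) fact_nz[OF hk(2)] in auto)
    have symC: "green_class ?G (Sym (Suc (Suc k)) (D_module K n)) = C k"
      unfolding C_def by (rule green_class_eqI[OF fdC Sym_D_iso])
    have BC: "B (Suc (Suc k)) = C k \<oplus>\<^bsub>?R\<^esub> B (Suc k)"
      unfolding B_def C_def K by (intro green_class_add fdB fdC ker_split_iso hk(1) fact_nz hk(2) n0)
    have 1: "A (Suc (Suc k)) = (C k \<oplus>\<^bsub>?R\<^esub> B (Suc k)) \<oplus>\<^bsub>?R\<^esub> (B (Suc k) \<oplus>\<^bsub>?R\<^esub> A k)"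
      using AB[of "Suc k"] AB[of k] hk BC by simp
    have 2: "A (Suc k) = B (Suc k) \<oplus>\<^bsub>?R\<^esub> A k" using AB[of k] hk by simp
    \<comment> \<open>Adding \<open>A k\<close> completes the leftover \<open>B (Suc k)\<close> to a
      second copy of \<open>A (Suc k)\<close>, so that \<open>C k\<close> remains once both copies
      are subtracted.\<close>
    have "A (Suc (Suc k)) \<oplus>\<^bsub>?R\<^esub> A k = C k \<oplus>\<^bsub>?R\<^esub> (A (Suc k) \<oplus>\<^bsub>?R\<^esub> A (Suc k))"
      unfolding 1 unfolding 2 by (simp add: R.a_ac carr)
    then show ?thesis
      unfolding symC R.add_pow_two[OF carr(1)] by (simp add: R.minus_eq R.a_assoc R.r_neg carr)
  qed
  show ?thesis
  proof (intro conjI impI allI; elim conjE)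
    fix r assume r: "2 \<le> r" "r \<le> p - 1"
    then obtain k where "r = Suc k" "0 < k" by (cases r) auto
    then show "green_class ?G (Sym r (specht_module K n)) =
        green_class ?G (Sym r (perm_module K n)) \<ominus>\<^bsub>?R\<^esub> green_class ?G (Sym (r - 1) (perm_module K n))"
      using part1[of k] r(2) by (simp add: symA symB)
  next
    fix r assume n: "p dvd n" and r: "3 \<le> r" "r \<le> p - 1"
    define k where "k = r - 2"
    have "r = Suc (Suc k)" "0 < k" using r(1) by (auto simp: k_def)
    then show "green_class ?G (Sym r (D_module K n)) =
        (green_class ?G (Sym r (perm_module K n)) \<oplus>\<^bsub>?R\<^esub> green_class ?G (Sym (r - 2) (perm_module K n)))
        \<ominus>\<^bsub>?R\<^esub> ([(2::nat)] \<cdot>\<^bsub>?R\<^esub> green_class ?G (Sym (r - 1) (perm_module K n)))"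
      using part2[of k] r(2) n by (simp add: symA)
  qed
qed

end
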